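(* Consider the multi-order tensor factor model described in the context and let the identification, loading, core-factor, noise and cross-thread conditions listed in the context hold. Fix $m\in[M]$. For each $n\in[M]\setminus\{m\}$, let $\mathcal{S}_n\subseteq[p_{n,1}]\times\cdots\times[p_{n,K_n}]$ be a random set of multi-indices drawn independently of the data $\{\mathcal{X}_t^{(1)},\dots,\mathcal{X}_t^{(M)}\}_{t\in[T]}$, and let $\mathcal{S}_n^\dagger\subseteq[p_n]$ denote the set of row indices of the matrix $\otimes_{k=1}^{K_n}\mathbf{A}_{n,k}$ that correspond to the rows of $\{\mathbf{A}_{n,1},\dots,\mathbf{A}_{n,K_n}\}$ with indices in $\mathcal{S}_n$. Assume that for any $n\in[M]\setminus\{m\}$ and any $j\in[r_n]$, $$\sigma_j\big\{(\otimes_{k=1}^{K_n}\mathbf{A}_{n,k})_{\mathcal{S}_n^\dagger}\big\}\asymp|\mathcal{S}_n^\dagger|^{1/2},$$ where $(\otimes_{k=1}^{K_n}\mathbf{A}_{n,k})_{\mathcal{S}_n^\dagger}$ is the sub-matrix of $\otimes_{k=1}^{K_n}\mathbf{A}_{n,k}$ with rows restricted to $\mathcal{S}_n^\dagger$. For $k\in[K_m]$, let $$\widehat{\boldsymbol\Sigma}_{m,k}^S=\sum_{n\in[M],\,n\ne m}\ \sum_{\boldsymbol i\in\mathcal{S}_n}\widehat{\boldsymbol\Omega}_{k,n,\boldsymbol i}^{(m)}\widehat{\boldsymbol\Omega}_{k,n,\boldsymbol i}^{(m)\top},\qquad \widehat{\boldsymbol\Omega}_{k,n,\boldsymbol i}^{(m)}=\frac1T\sum_{t=1}^T\mathrm{mat}_k(\mathcal{X}_t^{(m)})\cdot(\mathcal{X}_t^{(n)})_{\boldsymbol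 i},$$ and let $\widehat{\mathbf{A}}_{m,k}^S$ be $\sqrt{p_{m,k}}$ times the matrix of the $r_{m,k}$ leading (orthonormal) eigenvectors of $\widehat{\boldsymbol\Sigma}_{m,k}^S$. Then for any $k\in[K_m]$, $$\frac{1}{p_{m,k}}\big\|\widehat{\mathbf{A}}_{m,k}^S-\mathbf{A}_{m,k}\big\|_F^2=O_P\Big(\frac1T\Big).$$
   Context: Model. $[M]=\{1,\dots,M\}$, $M\ge2$. For $m\in[M]$, $t\in[T]$, $\mathcal{X}_t^{(m)}\in\mathbb{R}^{p_{m,1}\times\cdots\times p_{m,K_m}}$ is an observed mean-zero random tensor of order $K_m$ with $\mathcal{X}_t^{(m)}=\mathcal{G}_t^{(m)}\times_{k=1}^{K_m}\mathbf{A}_{m,k}+\mathcal{F}_t^{(m)}\times_{k=1}^{K_m}\mathbf{B}_{m,k}+\mathcal{E}_t^{(m)}$, where $\mathcal{G}_t^{(m)}\in\mathbb{R}^{r_{m,1}\times\cdots\times r_{m,K_m}}$ (global factor), $\mathcal{F}_t^{(m)}\in\mathbb{R}^{u_{m,1}\times\cdots\times u_{m,K_m}}$ (local factor) and $\mathcal{E}_t^{(m)}$ (noise) are random and unobserved, and $\mathbf{A}_{m,k}\in\mathbb{R}^{p_{m,k}\times r_{m,k}}$, $\mathbf{B}_{m,k}\in\mathbb{R}^{p_{m,k}\times u_{m,k}}$ are deterministic loading matrices. Notation. $\mathrm{mat}_k$: mode-$k$ unfolding; $\times_k$: mode-$k$ product, $\mathrm{mat}_k(\mathcal{X}\times_k\mathbf{A})=\mathbf{A}\,\mathrm{mat}_k(\mathcal{X})$;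 $(\mathcal{X})_{\boldsymbol i}$: entry at multi-index $\boldsymbol i$; Kronecker products over an index set are taken in descending index order; $p_m=\prod_kp_{m,k}$, $p_{m,\text{-}k}=p_m/p_{m,k}$, $r_m=\prod_kr_{m,k}$; $\|\cdot\|$ spectral norm, $\|\cdot\|_F$ Frobenius norm, $\|\cdot\|_{\max}$ largest absolute entry; $\sigma_j$ is the $j$th largest singular value; $a\asymp b$ means $a=O(b)$ and $b=O(a)$. $M$, all $K_m$, $r_{m,k}$, $u_{m,k}$ are fixed; asymptotics are as $T$ and all $p_{m,k}$ tend to infinity; constants $c$ do not depend on $T$ or the $p_{m,k}$. Identification condition. For all $t,m$: (a) elements of $\mathcal{G}_t^{(m)},\mathcal{F}_t^{(m)}$ have zero mean; (b) elements of $\mathcal{G}_t^{(m)},\mathcal{F}_t^{(m)}$ are uncorrelated with those of $\mathcal{F}_t^{(n)}$ for all $n\ne m$; (c) $\mathcal{G}_t^{(m)}$ cannot be decomposed as $\mathcal{G}_{t,1}^{(m)}+\mathcal{G}_{t,2}^{(m)}$ with nonzero $\mathcal{G}_{t,2}^{(m)}$ whose elements are uncorrelated with all elements of $\mathcal{G}_t^{(n)}$ for all $n\ne m$. Loading condition. For all $m,k$ there is a constant $c$ with (a) $\|\mathbf{A}_{m,k}\|_{\max},\|\mathbf{B}_{m,k}\|_{\max}\le c<\infty$; (b) $\|p_{m,k}^{-1}(\mathbf{A}_{m,k},\mathbf{B}_{m,k})^\top(\mathbf{A}_{m,k},\mathbf{B}_{m,k})-\mathbf{I}_{r_{m,k}+u_{m,k}}\|\le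 c\,p_{m,k}^{-1/2}$ for all $p_{m,k}\in\mathbb{N}$. Core-factor condition. For all $m$: (a) elements of $\mathcal{G}_t^{(m)},\mathcal{F}_t^{(m)}$ have bounded fourth moment; (b) for any $k$, $T^{-1}\sum_{t=1}^T\mathrm{mat}_k(\mathcal{F}_t^{(m)})\mathrm{mat}_k(\mathcal{F}_t^{(m)})^\top\to\boldsymbol\Sigma_{F,m,k}$ in probability as $T\to\infty$, with $\boldsymbol\Sigma_{F,m,k}$ positive definite with finite eigenvalues; (c) for any $n\in[M]$, $k\in[K_m]$ and any matrices $\mathbf{A}_1,\dots,\mathbf{A}_{K_n}$ with $\mathbf{A}_i\in\mathbb{R}^{p_{n,i}\times r_{n,i}}$ of full column rank with all singular values bounded away from zero and infinity, there is a positive constant $c$ such that as $T\to\infty$, for any $j\in[r_{m,k}]$, $\sigma_j\big(\mathbb{E}[\mathrm{mat}_k(\mathcal{G}_t^{(m)})\otimes\{\mathrm{vec}(\mathcal{G}_t^{(n)})^\top(\otimes_{h=1}^{K_n}\mathbf{A}_h)^\top\}]\big)\asymp c$. Noise condition. For all $m,t$, writing $\mathbf{E}_t=\mathrm{mat}_k(\mathcal{E}_t^{(m)})$: (a) elements of $\mathcal{E}_t^{(m)}$ have zero mean and bounded fourth moment; (b) for all $k,t$, $i\in[p_{m,k}]$, $j\in[p_{m,\text{-}k}]$ there is a constant $c$ with $\sum_{s=1}^T\sum_{l=1}^{p_{m,k}}\sum_{h=1}^{p_{m,\text{-}k}}|\mathbb{E}\{E_{t,ij}E_{s,lh}\}|\le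 c$; (c) for all $k$, $i,l_1\in[p_{m,k}]$, $j,h_1\in[p_{m,\text{-}k}]$ there is a constant $c$ bounding each of the four sums $\sum_{s=1}^T\sum_{l_2=1}^{p_{m,k}}\sum_{h_2=1}^{p_{m,\text{-}k}}|\mathrm{Cov}\{\cdot,\cdot\}|$ with covariances $\mathrm{Cov}\{E_{t,ij}E_{t,l_1j},E_{s,ih_2}E_{s,l_2h_2}\}$, $\mathrm{Cov}\{E_{t,ij}E_{t,ih_1},E_{s,l_2j}E_{s,l_2h_2}\}$, $\mathrm{Cov}\{E_{t,ij}E_{t,l_1h_1},E_{s,ij}E_{s,l_2h_2}\}$, $\mathrm{Cov}\{E_{t,l_1j}E_{t,ih_1},E_{s,l_2j}E_{s,ih_2}\}$. Cross-thread condition. For all $m$: (a) elements of $\mathcal{X}_t^{(m)}$ are uncorrelated with those of $\mathcal{E}_t^{(n)}$ for all $t$, $n\ne m$; (b) for all $n\ne m$ there is a constant $c<\infty$ with $\|\mathrm{Var}\{T^{-1/2}\sum_{t=1}^T\mathrm{vec}(\mathcal{P}_t)\otimes\mathrm{vec}(\mathcal{Q}_t)\}\|_{\max}\le c$ for each of $(\mathcal{P}_t,\mathcal{Q}_t)=(\mathcal{X}_t^{(m)},\mathcal{E}_t^{(n)}),(\mathcal{G}_t^{(m)},\mathcal{F}_t^{(n)}),(\mathcal{F}_t^{(m)},\mathcal{F}_t^{(n)}),(\mathcal{G}_t^{(m)},\mathcal{G}_t^{(n)})$.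
   Formalization: The error is measured against AH (H sample-dependent, (AH)ᵀAH = pI), not A; loadings and noise are nested infinite arrays, factors free of p; the core-factor cross-moment is averaged over t; S_n is nonempty, its σ_j bounds hold a.s.; splits in identification (c) are linear. *)

theory Defs
  imports
    "HOL-Probability.Probability"
    "Jordan_Normal_Form.Char_Poly"
    "Jordan_Normal_Form.DL_Submatrix"
begin

text \<open>
  All index sets \<open>[n]\<close> are rendered as \<open>{..<n}\<close>, so threads, modes, times and coordinates are
  counted from 0.  Matrices are those of \<open>Jordan_Normal_Form\<close>.
\<close>


section \<open>Tensors\<close>

text \<open>
  A multi-index of order \<open>K\<close> is an extensional function on \<open>{..<K}\<close>, and a tensor is a function on
  multi-indices, read only on the index set of its shape.
\<close>

type_synonym midx = "nat \<Rightarrow> nat"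
type_synonym tensor = "midx \<Rightarrow> real"

definition idx :: "nat \<Rightarrow> (nat \<Rightarrow> nat) \<Rightarrow> midx set" where
  "idx K d = PiE {..<K} (\<lambda>k. {..<d k})"

definition all_idx :: "nat \<Rightarrow> midx set" where
  "all_idx K = PiE {..<K} (\<lambda>_. UNIV)"

text \<open>
  Linearisation of the modes in \<open>I\<close>, the lowest mode running fastest, and its inverse.  With this
  order \<open>vec (X \<times>\<^sub>1 A\<^sub>1 \<dots> \<times>\<^sub>K A\<^sub>K) = (A\<^sub>K \<otimes> \<dots> \<otimes> A\<^sub>1) vec X\<close>, i.e. Kronecker products come in
  descending order.
\<close>

definition lin :: "nat set \<Rightarrow> (nat \<Rightarrow> nat) \<Rightarrow> midx \<Rightarrow> nat" where
  "lin I d i = (\<Sum>k\<in>I. i k * (\<Prod>h\<in>{h\<in>I. h < k}. d h))"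

definition digits :: "nat set \<Rightarrow> (nat \<Rightarrow> nat) \<Rightarrow> nat \<Rightarrow> midx" where
  "digits I d c = (\<lambda>k\<in>I. (c div (\<Prod>h\<in>{h\<in>I. h < k}. d h)) mod d k)"

definition vect :: "nat \<Rightarrow> (nat \<Rightarrow> nat) \<Rightarrow> tensor \<Rightarrow> real vec" where
  "vect K d Y = vec (\<Prod>k<K. d k) (\<lambda>c. Y (digits {..<K} d c))"

definition mode_mat :: "nat \<Rightarrow> (nat \<Rightarrow> nat) \<Rightarrow> nat \<Rightarrow> tensor \<Rightarrow> real mat" where
  "mode_mat K d k Y = mat (d k) (\<Prod>h\<in>{..<K} - {k}. d h)
     (\<lambda>(a, c). Y ((digits ({..<K} - {k}) d c)(k := a)))"

text \<open>
  Mode-\<open>k\<close> product with a matrix having \<open>d\<close> columns; the matrix is given by its entries, so that it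
  may have infinitely many rows.
\<close>

definition mode_prod :: "nat \<Rightarrow> nat \<Rightarrow> (nat \<Rightarrow> nat \<Rightarrow> real) \<Rightarrow> tensor \<Rightarrow> tensor" where
  "mode_prod d k a Y = (\<lambda>i. \<Sum>j<d. a (i k) j * Y (i(k := j)))"

primrec multi_prod ::
  "nat \<Rightarrow> (nat \<Rightarrow> nat) \<Rightarrow> (nat \<Rightarrow> nat \<Rightarrow> nat \<Rightarrow> real) \<Rightarrow> tensor \<Rightarrow> tensor" where
  "multi_prod 0 d a Y = Y"
| "multi_prod (Suc k) d a Y = mode_prod (d k) k (a k) (multi_prod k d a Y)"


section \<open>Matrices\<close>

definition kron :: "real mat \<Rightarrow> real mat \<Rightarrow> real mat" where
  "kron A B = mat (dim_row A * dim_row B) (dim_col A * dim_col B)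
     (\<lambda>(i, j). A $$ (i div dim_row B, j div dim_col B) * B $$ (i mod dim_row B, j mod dim_col B))"

primrec kron_desc :: "(nat \<Rightarrow> real mat) \<Rightarrow> nat \<Rightarrow> real mat" where
  "kron_desc A 0 = 1\<^sub>m 1"
| "kron_desc A (Suc k) = kron (A k) (kron_desc A k)"

definition mat_sum :: "nat \<Rightarrow> nat \<Rightarrow> ('i \<Rightarrow> real mat) \<Rightarrow> 'i set \<Rightarrow> real mat" where
  "mat_sum nr nc f I = mat nr nc (\<lambda>ij. \<Sum>x\<in>I. f x $$ ij)"

text \<open>
  For symmetric \<open>S\<close>, \<open>eigval S j\<close> is the \<open>(j+1)\<close>-st largest eigenvalue, counted with multiplicity;
  it is 0 beyond the dimension.
\<close>

definition eigval :: "real mat \<Rightarrow> nat \<Rightarrow> real" where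
  "eigval S j = (let es = rev (sorted_list_of_multiset (proots (char_poly S)))
                 in if j < length es then es ! j else 0)"

definition sing_val :: "real mat \<Rightarrow> nat \<Rightarrow> real" where
  "sing_val A j = sqrt (eigval (transpose_mat A * A) j)"

definition spectral_norm :: "real mat \<Rightarrow> real" where
  "spectral_norm A = sing_val A 0"

definition frob_norm :: "real mat \<Rightarrow> real" where
  "frob_norm A = sqrt (\<Sum>i<dim_row A. \<Sum>j<dim_col A. (A $$ (i, j))\<^sup>2)"

definition pos_def :: "nat \<Rightarrow> real mat \<Rightarrow> bool" where
  "pos_def d S \<longleftrightarrow> S \<in> carrier_mat d d \<and> transpose_mat S = S \<and>
     (\<forall>v\<in>carrier_vec d. v \<noteq> 0\<^sub>v d \<longrightarrow> scalar_prod v (S *\<^sub>v v) > 0)"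

definition leading_eigenvectors :: "real mat \<Rightarrow> nat \<Rightarrow> real mat \<Rightarrow> bool" where
  "leading_eigenvectors S r V \<longleftrightarrow> V \<in> carrier_mat (dim_row S) r \<and>
     transpose_mat V * V = 1\<^sub>m r \<and> (\<forall>j<r. S *\<^sub>v col V j = eigval S j \<cdot>\<^sub>v col V j)"


section \<open>Probability and asymptotics\<close>

definition cov :: "'w measure \<Rightarrow> ('w \<Rightarrow> real) \<Rightarrow> ('w \<Rightarrow> real) \<Rightarrow> real" where
  "cov P Y Z = (\<integral>\<omega>. (Y \<omega> - (\<integral>\<omega>'. Y \<omega>' \<partial>P)) * (Z \<omega> - (\<integral>\<omega>'. Z \<omega>' \<partial>P)) \<partial>P)"

definition mean_zero :: "'w measure \<Rightarrow> ('w \<Rightarrow> real) \<Rightarrow> bool" where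
  "mean_zero P Y \<longleftrightarrow> integrable P Y \<and> (\<integral>\<omega>. Y \<omega> \<partial>P) = 0"

definition fourth_moment_le :: "'w measure \<Rightarrow> real \<Rightarrow> ('w \<Rightarrow> real) \<Rightarrow> bool" where
  "fourth_moment_le P c Y \<longleftrightarrow> integrable P (\<lambda>\<omega>. Y \<omega> ^ 4) \<and> (\<integral>\<omega>. Y \<omega> ^ 4 \<partial>P) \<le> c"

definition mat_expectation ::
  "'w measure \<Rightarrow> nat \<Rightarrow> nat \<Rightarrow> ('w \<Rightarrow> real mat) \<Rightarrow> real mat" where
  "mat_expectation P nr nc Y = mat nr nc (\<lambda>ij. \<integral>\<omega>. Y \<omega> $$ ij \<partial>P)"

definition tendsto_in_prob :: "'w measure \<Rightarrow> (nat \<Rightarrow> 'w \<Rightarrow> real) \<Rightarrow> real \<Rightarrow> bool" where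
  "tendsto_in_prob P Y l \<longleftrightarrow>
     (\<forall>e>0. (\<lambda>T. measure P {\<omega> \<in> space P. \<bar>Y T \<omega> - l\<bar> > e}) \<longlonglongrightarrow> 0)"

text \<open>
  \<open>Y = O\<^sub>P(a)\<close> along a filter.  The exceptional event is only required to contain the set where the
  bound fails, so that \<open>Y\<close> need not be measurable; for measurable \<open>Y\<close> this is the usual notion.
\<close>

definition bigOP ::
  "'w measure \<Rightarrow> 'i filter \<Rightarrow> ('i \<Rightarrow> 'w \<Rightarrow> real) \<Rightarrow> ('i \<Rightarrow> real) \<Rightarrow> bool" where
  "bigOP P \<FF> Y a \<longleftrightarrow> (\<forall>e>0. \<exists>C>0. \<forall>\<^sub>F x in \<FF>. \<exists>B\<in>sets P.
     measure P B \<ge> 1 - e \<and> (\<forall>\<omega>\<in>B. \<bar>Y x \<omega>\<bar> \<le> C * a x))"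

text \<open>
  The joint limit in which \<open>T\<close> and all \<open>p\<^bsub>m,k\<^esub>\<close> tend to infinity, without any restriction on the
  relative rates.
\<close>

type_synonym dims = "nat \<Rightarrow> nat \<Rightarrow> nat"

definition large :: "nat \<Rightarrow> (nat \<Rightarrow> nat) \<Rightarrow> (nat \<times> dims) filter" where
  "large M K = (INF N. principal {(T, p). N \<le> T \<and> (\<forall>m<M. \<forall>k<K m. N \<le> p m k)})"

lemma eventually_large:
  "eventually Q (large M K) \<longleftrightarrow>
     (\<exists>N. \<forall>T p. N \<le> T \<longrightarrow> (\<forall>m<M. \<forall>k<K m. N \<le> p m k) \<longrightarrow> Q (T, p))"
  unfolding large_def
proof (subst eventually_INF_base, goal_cases)
  case (2 a b)
  show ?case
    by (rule bexI[of _ "max a b"]) auto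
qed (auto simp: eventually_principal)


section \<open>The model\<close>

text \<open>
  The loadings and the noise are infinite arrays: \<open>a m k i j\<close> and \<open>b m k i j\<close> are the entries of
  \<open>A\<^bsub>m,k\<^esub>\<close> and \<open>B\<^bsub>m,k\<^esub>\<close>, and \<open>E m t i\<close> is defined for all multi-indices \<open>i\<close>.  For given
  dimensions \<open>p\<close> one observes the corner with indices below \<open>p\<close>.  Thus a larger sample extends a
  smaller one, and bounds that are uniform in \<open>T\<close> and \<open>p\<close> are bounds on these arrays.
\<close>

type_synonym 'w process = "nat \<Rightarrow> nat \<Rightarrow> midx \<Rightarrow> 'w \<Rightarrow> real"
type_synonym loadings = "nat \<Rightarrow> nat \<Rightarrow> nat \<Rightarrow> nat \<Rightarrow> real"

definition loading_mat :: "nat \<Rightarrow> nat \<Rightarrow> (nat \<Rightarrow> nat \<Rightarrow> real) \<Rightarrow> real mat" where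
  "loading_mat p r a = mat p r (\<lambda>(i, j). a i j)"

definition tensor_factor_model ::
  "'w measure \<Rightarrow> nat \<Rightarrow> (nat \<Rightarrow> nat) \<Rightarrow> dims \<Rightarrow> dims \<Rightarrow> loadings \<Rightarrow> loadings \<Rightarrow>
   'w process \<Rightarrow> 'w process \<Rightarrow> 'w process \<Rightarrow> 'w process \<Rightarrow> bool" where
  "tensor_factor_model P M K r u a b G F E X \<longleftrightarrow>
     prob_space P \<and> 2 \<le> M \<and> (\<forall>m<M. 1 \<le> K m) \<and> (\<forall>m<M. \<forall>k<K m. 1 \<le> r m k) \<and>
     (\<forall>m<M. \<forall>t.
        (\<forall>i\<in>idx (K m) (r m). G m t i \<in> borel_measurable P) \<and>
        (\<forall>i\<in>idx (K m) (u m). F m t i \<in> borel_measurable P) \<and>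
        (\<forall>i\<in>all_idx (K m). E m t i \<in> borel_measurable P \<and> mean_zero P (X m t i) \<and>
           (\<forall>\<omega>\<in>space P. X m t i \<omega> =
              multi_prod (K m) (r m) (a m) (\<lambda>j. G m t j \<omega>) i +
              multi_prod (K m) (u m) (b m) (\<lambda>j. F m t j \<omega>) i + E m t i \<omega>)))"

text \<open>
  In the third clause the summands \<open>G\<^sub>1, G\<^sub>2\<close> are fixed linear images of the factor tensor.  If they
  were arbitrary random tensors then the split \<open>G = (G - Z) + Z\<close> would exist for every \<open>Z\<close>
  uncorrelated with the other threads (a constant, or local factors of thread \<open>m\<close>), and no model
  would satisfy the condition.
\<close>

definition linear_image :: "midx set \<Rightarrow> (midx \<Rightarrow> midx \<Rightarrow> real) \<Rightarrow> (midx \<Rightarrow> 'w \<Rightarrow> real) \<Rightarrow>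
    midx \<Rightarrow> 'w \<Rightarrow> real" where
  "linear_image I L Y i \<omega> = (\<Sum>j\<in>I. L i j * Y j \<omega>)"

definition identification_condition ::
  "'w measure \<Rightarrow> nat \<Rightarrow> (nat \<Rightarrow> nat) \<Rightarrow> dims \<Rightarrow> dims \<Rightarrow> 'w process \<Rightarrow> 'w process \<Rightarrow> bool" where
  "identification_condition P M K r u G F \<longleftrightarrow> (\<forall>t. \<forall>m<M.
     (\<forall>i\<in>idx (K m) (r m). mean_zero P (G m t i)) \<and>
     (\<forall>i\<in>idx (K m) (u m). mean_zero P (F m t i)) \<and>
     (\<forall>n<M. n \<noteq> m \<longrightarrow> (\<forall>j\<in>idx (K n) (u n).
        (\<forall>i\<in>idx (K m) (r m). cov P (G m t i) (F n t j) = 0) \<and>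
        (\<forall>i\<in>idx (K m) (u m). cov P (F m t i) (F n t j) = 0))) \<and>
     \<not> (\<exists>L\<^sub>1 L\<^sub>2. let I = idx (K m) (r m);
                    G\<^sub>1 = linear_image I L\<^sub>1 (G m t); G\<^sub>2 = linear_image I L\<^sub>2 (G m t) in
          (\<forall>i\<in>I. AE \<omega> in P. G m t i \<omega> = G\<^sub>1 i \<omega> + G\<^sub>2 i \<omega>) \<and>
          (\<exists>i\<in>I. \<not> (AE \<omega> in P. G\<^sub>2 i \<omega> = 0)) \<and>
          (\<forall>i\<in>I. \<forall>n<M. n \<noteq> m \<longrightarrow> (\<forall>j\<in>idx (K n) (r n). cov P (G\<^sub>2 i) (G n t j) = 0))))"

definition loading_condition ::
  "nat \<Rightarrow> (nat \<Rightarrow> nat) \<Rightarrow> dims \<Rightarrow> dims \<Rightarrow> loadings \<Rightarrow> loadings \<Rightarrow> bool" where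
  "loading_condition M K r u a b \<longleftrightarrow> (\<forall>m<M. \<forall>k<K m. \<exists>c.
     (\<forall>i. (\<forall>j<r m k. \<bar>a m k i j\<bar> \<le> c) \<and> (\<forall>j<u m k. \<bar>b m k i j\<bar> \<le> c)) \<and>
     (\<forall>p\<ge>1. let AB = loading_mat p (r m k + u m k)
                       (\<lambda>i j. if j < r m k then a m k i j else b m k i (j - r m k)) in
        spectral_norm ((1 / real p) \<cdot>\<^sub>m (transpose_mat AB * AB) - 1\<^sub>m (r m k + u m k))
          \<le> c / sqrt (real p)))"

text \<open>
  The time index in the cross-moment of the third clause is free; the moment is read as its average
  over \<open>t < T\<close>, which is the moment itself when it does not depend on \<open>t\<close>.
\<close>

definition cross_moment ::
  "'w measure \<Rightarrow> (nat \<Rightarrow> nat) \<Rightarrow> dims \<Rightarrow> 'w process \<Rightarrow> nat \<Rightarrow> dims \<Rightarrow> nat \<Rightarrow> nat \<Rightarrow> nat \<Rightarrow>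
   (nat \<Rightarrow> real mat) \<Rightarrow> real mat" where
  "cross_moment P K r G T p m k n As =
     (let nr = r m k; nc = (\<Prod>h\<in>{..<K m} - {k}. r m h) * (\<Prod>h<K n. p n h) in
      (1 / real T) \<cdot>\<^sub>m mat_sum nr nc (\<lambda>t. mat_expectation P nr nc (\<lambda>\<omega>.
        kron (mode_mat (K m) (r m) k (\<lambda>i. G m t i \<omega>))
          (mat_of_row (vect (K n) (r n) (\<lambda>i. G n t i \<omega>))
             * transpose_mat (kron_desc As (K n))))) {..<T})"

definition core_factor_condition ::
  "'w measure \<Rightarrow> nat \<Rightarrow> (nat \<Rightarrow> nat) \<Rightarrow> dims \<Rightarrow> dims \<Rightarrow> 'w process \<Rightarrow> 'w process \<Rightarrow> bool" where
  "core_factor_condition P M K r u G F \<longleftrightarrow> (\<forall>m<M.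
     (\<exists>c. \<forall>t. (\<forall>i\<in>idx (K m) (r m). fourth_moment_le P c (G m t i)) \<and>
              (\<forall>i\<in>idx (K m) (u m). fourth_moment_le P c (F m t i))) \<and>
     (\<forall>k<K m. \<exists>S. pos_def (u m k) S \<and> (\<forall>i<u m k. \<forall>j<u m k.
        tendsto_in_prob P (\<lambda>T \<omega>. (1 / real T) * (\<Sum>t<T.
          (mode_mat (K m) (u m) k (\<lambda>i. F m t i \<omega>)
             * transpose_mat (mode_mat (K m) (u m) k (\<lambda>i. F m t i \<omega>))) $$ (i, j)))
          (S $$ (i, j)))) \<and>
     (\<forall>n<M. \<forall>k<K m. \<forall>s\<^sub>1>0. \<forall>s\<^sub>2. \<exists>c\<^sub>1>0. \<exists>c\<^sub>2. \<forall>\<^sub>F (T, p) in large M K. \<forall>As.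
        (\<forall>h<K n. As h \<in> carrier_mat (p n h) (r n h) \<and>
           (\<forall>j<r n h. s\<^sub>1 \<le> sing_val (As h) j \<and> sing_val (As h) j \<le> s\<^sub>2)) \<longrightarrow>
        (\<forall>j<r m k. c\<^sub>1 \<le> sing_val (cross_moment P K r G T p m k n As) j \<and>
                   sing_val (cross_moment P K r G T p m k n As) j \<le> c\<^sub>2)))"

definition noise_condition ::
  "'w measure \<Rightarrow> nat \<Rightarrow> (nat \<Rightarrow> nat) \<Rightarrow> 'w process \<Rightarrow> bool" where
  "noise_condition P M K E \<longleftrightarrow> (\<forall>m<M.
     (\<forall>t. \<forall>i\<in>all_idx (K m). mean_zero P (E m t i)) \<and>
     (\<exists>c. \<forall>t. \<forall>i\<in>all_idx (K m). fourth_moment_le P c (E m t i)) \<and>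
     (\<exists>c. \<forall>T (d :: nat \<Rightarrow> nat). \<forall>k<K m.
        let q = (\<Prod>h\<in>{..<K m} - {k}. d h);
            e = (\<lambda>t i j \<omega>. mode_mat (K m) d k (\<lambda>x. E m t x \<omega>) $$ (i, j)) in
        \<forall>t<T. \<forall>i<d k. \<forall>j<q.
          (\<Sum>s<T. \<Sum>l<d k. \<Sum>h<q. \<bar>\<integral>\<omega>. e t i j \<omega> * e s l h \<omega> \<partial>P\<bar>) \<le> c) \<and>
     (\<exists>c. \<forall>T (d :: nat \<Rightarrow> nat). \<forall>k<K m.
        let q = (\<Prod>h\<in>{..<K m} - {k}. d h);
            e = (\<lambda>t i j \<omega>. mode_mat (K m) d k (\<lambda>x. E m t x \<omega>) $$ (i, j)) in
        \<forall>t<T. \<forall>i<d k. \<forall>l\<^sub>1<d k. \<forall>j<q. \<forall>h\<^sub>1<q.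
          (\<Sum>s<T. \<Sum>l\<^sub>2<d k. \<Sum>h\<^sub>2<q.
             \<bar>cov P (\<lambda>\<omega>. e t i j \<omega> * e t l\<^sub>1 j \<omega>) (\<lambda>\<omega>. e s i h\<^sub>2 \<omega> * e s l\<^sub>2 h\<^sub>2 \<omega>)\<bar>) \<le> c \<and>
          (\<Sum>s<T. \<Sum>l\<^sub>2<d k. \<Sum>h\<^sub>2<q.
             \<bar>cov P (\<lambda>\<omega>. e t i j \<omega> * e t i h\<^sub>1 \<omega>) (\<lambda>\<omega>. e s l\<^sub>2 j \<omega> * e s l\<^sub>2 h\<^sub>2 \<omega>)\<bar>) \<le> c \<and>
          (\<Sum>s<T. \<Sum>l\<^sub>2<d k. \<Sum>h\<^sub>2<q.
             \<bar>cov P (\<lambda>\<omega>. e t i j \<omega> * e t l\<^sub>1 h\<^sub>1 \<omega>) (\<lambda>\<omega>. e s i j \<omega> * e s l\<^sub>2 h\<^sub>2 \<omega>)\<bar>) \<le> c \<and>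
          (\<Sum>s<T. \<Sum>l\<^sub>2<d k. \<Sum>h\<^sub>2<q.
             \<bar>cov P (\<lambda>\<omega>. e t l\<^sub>1 j \<omega> * e t i h\<^sub>1 \<omega>) (\<lambda>\<omega>. e s l\<^sub>2 j \<omega> * e s i h\<^sub>2 \<omega>)\<bar>) \<le> c))"

text \<open>
  The covariance matrix of \<open>T\<^bsup>-1/2\<^esup> \<Sum>\<^sub>t vec Y\<^sub>t \<otimes> vec Z\<^sub>t\<close> is bounded by \<open>c\<close> in max norm.  The entries of
  \<open>vec Y \<otimes> vec Z\<close> are the products \<open>Y\<^sub>i Z\<^sub>j\<close>.
\<close>

definition product_var_le ::
  "'w measure \<Rightarrow> real \<Rightarrow> midx set \<Rightarrow> (nat \<Rightarrow> midx \<Rightarrow> 'w \<Rightarrow> real) \<Rightarrow>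
   midx set \<Rightarrow> (nat \<Rightarrow> midx \<Rightarrow> 'w \<Rightarrow> real) \<Rightarrow> bool" where
  "product_var_le P c I Y J Z \<longleftrightarrow> (\<forall>T\<ge>1. \<forall>i\<in>I. \<forall>j\<in>J. \<forall>i'\<in>I. \<forall>j'\<in>J.
     \<bar>cov P (\<lambda>\<omega>. (1 / sqrt (real T)) * (\<Sum>t<T. Y t i \<omega> * Z t j \<omega>))
            (\<lambda>\<omega>. (1 / sqrt (real T)) * (\<Sum>t<T. Y t i' \<omega> * Z t j' \<omega>))\<bar> \<le> c)"

definition cross_thread_condition ::
  "'w measure \<Rightarrow> nat \<Rightarrow> (nat \<Rightarrow> nat) \<Rightarrow> dims \<Rightarrow> dims \<Rightarrow>
   'w process \<Rightarrow> 'w process \<Rightarrow> 'w process \<Rightarrow> 'w process \<Rightarrow> bool" where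
  "cross_thread_condition P M K r u G F E X \<longleftrightarrow> (\<forall>m<M. \<forall>n<M. n \<noteq> m \<longrightarrow>
     (\<forall>t. \<forall>i\<in>all_idx (K m). \<forall>j\<in>all_idx (K n). cov P (X m t i) (E n t j) = 0) \<and>
     (\<exists>c. product_var_le P c (all_idx (K m)) (X m) (all_idx (K n)) (E n) \<and>
          product_var_le P c (idx (K m) (r m)) (G m) (idx (K n) (u n)) (F n) \<and>
          product_var_le P c (idx (K m) (u m)) (F m) (idx (K n) (u n)) (F n) \<and>
          product_var_le P c (idx (K m) (r m)) (G m) (idx (K n) (r n)) (G n)))"


section \<open>The estimator\<close>

definition data :: "nat \<Rightarrow> (nat \<Rightarrow> nat) \<Rightarrow> nat \<Rightarrow> dims \<Rightarrow> (nat \<times> nat \<times> midx) set" where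
  "data M K T p = {(m, t, i). m < M \<and> t < T \<and> i \<in> idx (K m) (p m)}"

text \<open>
  Independence is stated on the generated sigma-algebras, since \<open>indep_var\<close> needs both variables to
  have the same type.  Empty sets are excluded: if all sets drawn were empty, the estimator would
  be computed from a zero matrix.
\<close>

definition independent_index_set ::
  "'w measure \<Rightarrow> nat \<Rightarrow> (nat \<Rightarrow> nat) \<Rightarrow> 'w process \<Rightarrow> nat \<Rightarrow> dims \<Rightarrow> nat \<Rightarrow>
   ('w \<Rightarrow> midx set) \<Rightarrow> bool" where
  "independent_index_set P M K X T p n S \<longleftrightarrow>
     (let NS = count_space (Pow (idx (K n) (p n)));
          NX = PiM (data M K T p) (\<lambda>_. borel);
          Y = (\<lambda>\<omega>. \<lambda>(m, t, i)\<in>data M K T p. X m t i \<omega>) in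
      S \<in> measurable P NS \<and> (\<forall>\<omega>\<in>space P. S \<omega> \<noteq> {}) \<and>
      prob_space.indep_set P {S -` A \<inter> space P | A. A \<in> sets NS}
                             {Y -` A \<inter> space P | A. A \<in> sets NX})"

text \<open>
  Row \<open>lin {..<K} d i\<close> of \<open>kron_desc A K\<close> is the product of the rows \<open>i k\<close> of the factors \<open>A k\<close>.
\<close>

definition rows_of :: "nat \<Rightarrow> (nat \<Rightarrow> nat) \<Rightarrow> midx set \<Rightarrow> nat set" where
  "rows_of K d S = lin {..<K} d ` S"

definition Omega_hat ::
  "(nat \<Rightarrow> nat) \<Rightarrow> 'w process \<Rightarrow> nat \<Rightarrow> dims \<Rightarrow> nat \<Rightarrow> nat \<Rightarrow> nat \<Rightarrow> midx \<Rightarrow> 'w \<Rightarrow> real mat" where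
  "Omega_hat K X T p m k n i \<omega> = (1 / real T) \<cdot>\<^sub>m
     mat_sum (p m k) (\<Prod>h\<in>{..<K m} - {k}. p m h)
       (\<lambda>t. X n t i \<omega> \<cdot>\<^sub>m mode_mat (K m) (p m) k (\<lambda>x. X m t x \<omega>)) {..<T}"

definition Sigma_hat ::
  "nat \<Rightarrow> (nat \<Rightarrow> nat) \<Rightarrow> 'w process \<Rightarrow> (nat \<Rightarrow> midx set) \<Rightarrow>
   nat \<Rightarrow> dims \<Rightarrow> nat \<Rightarrow> nat \<Rightarrow> 'w \<Rightarrow> real mat" where
  "Sigma_hat M K X S T p m k \<omega> =
     mat_sum (p m k) (p m k) (\<lambda>n. mat_sum (p m k) (p m k)
       (\<lambda>i. Omega_hat K X T p m k n i \<omega> * transpose_mat (Omega_hat K X T p m k n i \<omega>)) (S n))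
       ({..<M} - {m})"

text \<open>
  Eigenvectors have no preferred sign (nor, for repeated eigenvalues, basis), and the model
  determines \<open>A\<^bsub>m,k\<^esub>\<close> only up to an invertible right factor, which the loading condition restricts
  to be orthogonal up to order \<open>p\<^bsup>-1/2\<^esup>\<close>.  Therefore every admissible choice is an estimator here, and
  an error of the estimator is to be measured against \<open>A H\<close>, where \<open>H\<close> may depend on the sample and
  gives \<open>A H\<close> the normalisation \<open>(A H)\<^sup>T (A H) = p I\<close> of the estimator.
\<close>

definition loading_estimator :: "real mat \<Rightarrow> nat \<Rightarrow> real mat \<Rightarrow> bool" where
  "loading_estimator S r Ah \<longleftrightarrow>
     (\<exists>V. leading_eigenvectors S r V \<and> Ah = sqrt (real (dim_row S)) \<cdot>\<^sub>m V)"

end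

theory Submission
  imports
    Defs
    "Jordan_Normal_Form.Schur_Decomposition"
    "HOL-Real_Asymp.Real_Asymp"
begin

text \<open>
  The cross moment of \<open>X\<^bsub>m,x\<^esub>\<close> and \<open>X\<^bsub>n,i\<^esub>\<close> equals a deterministic signal plus a deviation.  The signal
  comes from the global factors alone, has its columns in the range of \<open>A\<^bsub>m,k\<^esub>\<close>, and its Gram matrix
  is of order \<open>p\<^sub>m |S|\<close> on that range; the deviation has mean square \<open>O(1/T)\<close> uniformly in all
  indices.  The deviation is a function of the data, so a selection independent of the data picks up
  a total squared deviation \<open>O\<^sub>P(p\<^sub>m |S| / T)\<close>.  For an eigenvector \<open>v\<close> of \<open>\<Omega>\<Omega>\<^sup>T\<close> with eigenvalue \<open>e\<close>,
  the squared distance of \<open>v\<close> from the range of the signal is at most the total squared deviation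
  divided by \<open>e\<close>, hence \<open>O\<^sub>P(1/T)\<close>.  The polar factor of the projected eigenvectors gives \<open>H\<close>.

  The products of factors and noise of different threads are not controlled directly by the
  cross-thread condition.  They are limits of products of data and noise: averaging the data of a
  thread against its loadings over larger and larger dimensions recovers the factors in \<open>L\<^sup>2\<close>.
\<close>

section \<open>The spectral theorem\<close>

text \<open>No ideal version of \<open>Sigma_hat\<close> is used. Comparing eigenspaces of two such
  matrices would need an eigengap and would mix signal and deviation in cross terms, whereas the
  range of the loadings contains the signal exactly, so that a lower bound on the leading
  eigenvalues suffices. Signal strength and squared deviation carry the same factor p_m |S|; it
  cancels, which is why T and the dimensions may grow at unrelated rates. The lower bound of the
  signal is a product of three: loadings of thread m (nearly orthonormal), core moments (core-factor
  condition tested on truncated identities) and selected rows of the other thread. The polar factor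
  is close to the projection only when the distance of the ranges is below one, which holds once T
  exceeds a constant. Eigenvectors are arbitrary choices and need not be measurable, so chance is
  confined to one measurable event on which every estimate is deterministic. As
  \<open>eigval\<close> is read off the characteristic polynomial, the spectral theorem has to
  deliver the eigenvalues with multiplicity and in that order.\<close>

lemma orthogonal_completion:
  fixes v :: "real vec"
  assumes v: "v \<in> carrier_vec n" and v0: "v \<noteq> 0\<^sub>v n"
  obtains W where "W \<in> carrier_mat n n" "transpose_mat W * W = 1\<^sub>m n"
    "\<exists>c. col W 0 = c \<cdot>\<^sub>v v"
proof -
  interpret cof_vec_space n "TYPE(real)" .
  have n: "n > 0"
    using v v0 by (cases n) auto
  define b where "b = basis_completion v"
  from basis_completion[OF v v0, folded b_def]
  have dist_b: "distinct b" and indep: "\<not> lin_dep (set b)" and b: "set b \<subseteq> carrier_vec n"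
    and hdb: "hd b = v" and len_b: "length b = n" by auto
  from hdb len_b n obtain vs where bv: "b = v # vs" by (cases b) auto
  define ws where "ws = gram_schmidt n b"
  from gram_schmidt_result[OF b dist_b indep refl, folded ws_def]
  have ws: "set ws \<subseteq> carrier_vec n" "corthogonal ws" "length ws = n"
    by (auto simp: len_b)
  from gram_schmidt_hd[OF v, of vs, folded bv] have hdws: "hd ws = v" unfolding ws_def .
  define g where "g i = ws ! i" for i
  have g: "g i \<in> carrier_vec n" if "i < n" for i
    using ws that by (auto simp: g_def)
  have orth: "scalar_prod (g i) (g j) = 0 \<longleftrightarrow> i \<noteq> j" if "i < n" "j < n" for i j
    using corthogonalD[OF ws(2), of i j] ws(3) that by (simp add: g_def conjugate_vec_def)
  define q where "q i = sqrt (scalar_prod (g i) (g i))" for i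
  have q_pos: "scalar_prod (g i) (g i) > 0" if "i < n" for i
  proof -
    have "scalar_prod (g i) (g i) \<ge> 0"
      by (auto simp: scalar_prod_def intro!: sum_nonneg)
    with orth[OF that that] show ?thesis by simp
  qed
  define W where "W = mat n n (\<lambda>(i, j). (g j $ i) / q j)"
  have W: "W \<in> carrier_mat n n" by (simp add: W_def)
  have col: "col W j = (1 / q j) \<cdot>\<^sub>v g j" if "j < n" for j
    using that g[OF that] by (intro eq_vecI) (auto simp: W_def)
  have "transpose_mat W * W = 1\<^sub>m n"
  proof (rule eq_matI, goal_cases)
    case (1 i j)
    then have ij: "i < n" "j < n" by auto
    have "(transpose_mat W * W) $$ (i, j) = scalar_prod (col W i) (col W j)"
      using ij W by simp
    also have "\<dots> = (1 / q i) * ((1 / q j) * scalar_prod (g i) (g j))"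
      using g[OF ij(1)] g[OF ij(2)] by (simp add: col ij)
    also have "\<dots> = (if i = j then 1 else 0)"
      using orth[OF ij] q_pos[OF ij(1)] by (auto simp: q_def)
    finally show ?case using ij by simp
  qed (use W in auto)
  moreover have "col W 0 = (1 / q 0) \<cdot>\<^sub>v v"
    using hdws ws(3) n by (subst col) (auto simp: g_def hd_conv_nth)
  ultimately show ?thesis using W that by blast
qed

text \<open>Deflation. A rotation that moves an eigenvector for the head of \<open>es\<close> to the
  first coordinate clears the first column, and by symmetry the first row; the remaining block is
  symmetric and keeps the remaining linear factors. The order of \<open>es\<close> is free, so the
  diagonal can follow the order used by \<open>eigval\<close>.\<close>

lemma symmetric_diagonalization:
  fixes A :: "real mat"
  assumes "A \<in> carrier_mat n n" "transpose_mat A = A" "char_poly A = (\<Prod>e\<leftarrow>es. [:- e, 1:])"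
  shows "\<exists>U\<in>carrier_mat n n. transpose_mat U * U = 1\<^sub>m n \<and>
    transpose_mat U * A * U = mat n n (\<lambda>(i, j). if i = j then es ! i else 0)"
  using assms
proof (induction es arbitrary: n A)
  case Nil
  with degree_monic_char_poly[of A n] have "n = 0" by auto
  with Nil show ?case
    by (intro bexI[of _ "1\<^sub>m 0"]) auto
next
  case (Cons e es n A)
  note A = Cons.prems(1) and sym = Cons.prems(2)
  let ?n1 = "n - 1"
  have cp: "char_poly A = [:-e, 1:] * (\<Prod>e\<leftarrow>es. [:- e, 1:])"
    using Cons.prems(3) by simp
  have mon: "monic (\<Prod>e\<leftarrow>es. [:- e, 1:])" by (rule monic_prod_list) auto
  have "degree (char_poly A) = Suc (degree (\<Prod>e\<leftarrow>es. [:- e, 1:]))"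
    unfolding cp by (subst degree_mult_eq, insert mon, auto)
  with degree_monic_char_poly[OF A] have n: "n \<noteq> 0" by auto
  have "eigenvalue A e"
    unfolding eigenvalue_root_char_poly[OF A] cp by simp
  then obtain v where v: "v \<in> carrier_vec n" "v \<noteq> 0\<^sub>v n" and ev: "A *\<^sub>v v = e \<cdot>\<^sub>v v"
    using A by (auto simp: eigenvalue_def eigenvector_def)
  obtain W c where W: "W \<in> carrier_mat n n" and WW: "transpose_mat W * W = 1\<^sub>m n"
    and col0: "col W 0 = c \<cdot>\<^sub>v v"
    using orthogonal_completion[OF v] by metis
  define A' where "A' = transpose_mat W * A * W"
  have A': "A' \<in> carrier_mat n n" using A W by (auto simp: A'_def)
  have WW': "W * transpose_mat W = 1\<^sub>m n"
    using mat_mult_left_right_inverse[OF _ W WW] W by auto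
  have sym': "transpose_mat A' = A'"
    using A W sym by (simp add: A'_def transpose_mult[of _ n n _ n] assoc_mult_mat[of _ n n _ n _ n])
  have "similar_mat_wit A' A (transpose_mat W) W"
    by (rule similar_mat_witI[of _ _ n]) (use W A A' WW WW' in \<open>auto simp: A'_def\<close>)
  then have sim: "similar_mat A' A" unfolding similar_mat_def by blast
  \<comment> \<open>Column 0 of \<open>W\<close> is a multiple of the eigenvector, so
    \<open>A * W\<close> has \<open>e\<close> times that column, and W^T W = I leaves
    \<open>e\<close> in the corner and zeros below.\<close>
  have A'0: "A' $$ (i, 0) = (if i = 0 then e else 0)" if i: "i < n" for i
  proof -
    have "A' $$ (i, 0) = (transpose_mat W * (A * W)) $$ (i, 0)"
      using A W by (simp add: A'_def assoc_mult_mat[of _ n n _ n _ n])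
    also have "\<dots> = scalar_prod (col W i) (col (A * W) 0)"
      using A W i n by simp
    also have "col (A * W) 0 = A *\<^sub>v col W 0"
      using A W n by auto
    also have "\<dots> = e \<cdot>\<^sub>v col W 0"
      using A v ev by (simp add: col0 mult_mat_vec smult_smult_assoc mult.commute)
    also have "scalar_prod (col W i) (e \<cdot>\<^sub>v col W 0) = e * (transpose_mat W * W) $$ (i, 0)"
      using W i n by simp
    also have "\<dots> = (if i = 0 then e else 0)"
      unfolding WW using i n by simp
    finally show ?thesis .
  qed
  have A'0': "A' $$ (0, i) = (if i = 0 then e else 0)" if i: "i < n" for i
    using A'0[OF i] arg_cong[OF sym', of "\<lambda>B. B $$ (0, i)"] A' i n by auto
  define A3 where "A3 = mat ?n1 ?n1 (\<lambda>(i, j). A' $$ (Suc i, Suc j))"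
  have A3: "A3 \<in> carrier_mat ?n1 ?n1" by (simp add: A3_def)
  define E :: "real mat" where "E = mat 1 1 (\<lambda>_. e)"
  have E: "E \<in> carrier_mat 1 1" by (simp add: E_def)
  have A'block: "A' = four_block_mat E (0\<^sub>m 1 ?n1) (0\<^sub>m ?n1 1) A3"
    using A' n A'0 A'0' by (intro eq_matI) (auto simp: E_def A3_def)
  have sym3: "transpose_mat A3 = A3"
  proof (rule eq_matI, goal_cases)
    case (1 i j)
    then show ?case
      using arg_cong[OF sym', of "\<lambda>B. B $$ (Suc i, Suc j)"] A' by (auto simp: A3_def)
  qed (auto simp: A3_def)
  have "[: -e, 1 :] * (\<Prod>e\<leftarrow>es. [:- e, 1:]) = char_poly A'"
    using cp char_poly_similar[OF sim] by simp
  also have "char_poly A' = char_poly E * char_poly A3"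
    unfolding A'block by (rule char_poly_four_block_zeros_col[OF E _ A3]) simp
  also have "char_poly E = [: -e, 1 :]"
    by (simp add: E_def char_poly_defs det_def sign_def)
  finally have "char_poly A3 = (\<Prod>e\<leftarrow>es. [:- e, 1:])"
    by (metis mult_cancel_left pCons_eq_0_iff zero_neq_one)
  from Cons.IH[OF A3 sym3 this] obtain U3 where U3: "U3 \<in> carrier_mat ?n1 ?n1"
    and UU3: "transpose_mat U3 * U3 = 1\<^sub>m ?n1"
    and D3: "transpose_mat U3 * A3 * U3 = mat ?n1 ?n1 (\<lambda>(i, j). if i = j then es ! i else 0)"
    by blast
  define B where "B = four_block_mat (1\<^sub>m 1) (0\<^sub>m 1 ?n1) (0\<^sub>m ?n1 1) U3"
  have BT: "transpose_mat B = four_block_mat (1\<^sub>m 1) (0\<^sub>m 1 ?n1) (0\<^sub>m ?n1 1) (transpose_mat U3)"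
    unfolding B_def by (subst transpose_four_block_mat[of _ 1 1 _ ?n1 _ ?n1]) (use U3 in auto)
  have B: "B \<in> carrier_mat n n"
    using four_block_carrier_mat[of "1\<^sub>m 1" 1 1 U3 ?n1 ?n1] U3 n by (simp add: B_def)
  have BB: "transpose_mat B * B = 1\<^sub>m n"
  proof -
    have "transpose_mat B * B = four_block_mat (1\<^sub>m 1) (0\<^sub>m 1 ?n1) (0\<^sub>m ?n1 1) (1\<^sub>m ?n1)"
      unfolding BT unfolding B_def
      by (subst mult_four_block_mat[of _ 1 1 _ ?n1 _ ?n1]) (use U3 UU3 in auto)
    also have "\<dots> = 1\<^sub>m n"
      using n by (intro eq_matI) auto
    finally show ?thesis .
  qed
  have BAB: "transpose_mat B * A' * B = mat n n (\<lambda>(i, j). if i = j then (e # es) ! i else 0)"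
  proof -
    have "transpose_mat B * A' = four_block_mat E (0\<^sub>m 1 ?n1) (0\<^sub>m ?n1 1) (transpose_mat U3 * A3)"
      unfolding BT A'block
      by (subst mult_four_block_mat[of _ 1 1 _ ?n1 _ ?n1]) (use U3 A3 E in auto)
    then have "transpose_mat B * A' * B =
        four_block_mat E (0\<^sub>m 1 ?n1) (0\<^sub>m ?n1 1) (transpose_mat U3 * A3 * U3)"
      unfolding B_def
      by (simp, subst mult_four_block_mat[of _ 1 1 _ ?n1 _ ?n1]) (use U3 A3 E in auto)
    also have "\<dots> = mat n n (\<lambda>(i, j). if i = j then (e # es) ! i else 0)"
      unfolding D3 using n by (intro eq_matI) (auto simp: E_def nth_Cons')
    finally show ?thesis .
  qed
  have "transpose_mat (W * B) * (W * B) = transpose_mat B * (transpose_mat W * W) * B"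
    using W B by (simp add: transpose_mult[of _ n n _ n] assoc_mult_mat[of _ n n _ n _ n])
  also have "\<dots> = 1\<^sub>m n"
    unfolding WW using B BB by simp
  finally have 1: "transpose_mat (W * B) * (W * B) = 1\<^sub>m n" .
  have "transpose_mat (W * B) * A * (W * B) = transpose_mat B * A' * B"
    using W B A by (simp add: A'_def transpose_mult[of _ n n _ n] assoc_mult_mat[of _ n n _ n _ n])
  with 1 BAB W B show ?case
    by (intro bexI[of _ "W * B"]) auto
qed

text \<open>The fundamental theorem of algebra supplies a complex root, the hypothesis makes it
  real, and its linear factor splits off over the reals; the quotient inherits the
  hypothesis.\<close>

lemma real_rooted_factorization:
  fixes p :: "real poly"
  assumes "p \<noteq> 0" "\<And>z. poly (map_poly complex_of_real p) z = 0 \<Longrightarrow> Im z = 0"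
  shows "\<exists>R. p = Polynomial.smult (lead_coeff p) (\<Prod>x\<in>#R. [:- x, 1:])"
  using assms
proof (induction "degree p" arbitrary: p)
  case 0
  then obtain c where "p = [:c:]" using degree_0_id[of p] by metis
  then show ?case by (intro exI[of _ "{#}"]) auto
next
  case (Suc n)
  let ?q = "map_poly complex_of_real p"
  have "degree ?q = Suc n"
    using Suc.hyps(2) by (simp add: degree_map_poly)
  then have "\<not> constant (poly ?q)"
    by (simp add: constant_degree)
  then obtain z where z: "poly ?q z = 0"
    using fundamental_theorem_of_algebra by blast
  then have "z = complex_of_real (Re z)"
    using Suc.prems(2) by (simp add: complex_eq_iff)
  then have "poly ?q (complex_of_real (Re z)) = 0" using z by simp
  then have "poly p (Re z) = 0"
    by (simp add: of_real_hom.poly_map_poly)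
  then obtain s where s: "p = [:- Re z, 1:] * s"
    by (auto simp: poly_eq_0_iff_dvd elim: dvdE)
  have s0: "s \<noteq> 0" using s Suc.prems(1) by auto
  have deg: "degree p = Suc (degree s)"
    using s0 unfolding s by (subst degree_mult_eq) auto
  interpret hom: map_poly_comm_ring_hom complex_of_real ..
  have "Im w = 0" if "poly (map_poly complex_of_real s) w = 0" for w
    using that Suc.prems(2)[of w] by (simp add: s hom.hom_mult del: mult_pCons_left)
  with Suc.hyps(1)[of s] Suc.hyps(2) deg s0
  obtain R where R: "s = Polynomial.smult (lead_coeff s) (\<Prod>x\<in>#R. [:- x, 1:])" by auto
  have "lead_coeff p = lead_coeff [:- Re z, 1:] * lead_coeff s"
    unfolding s by (rule lead_coeff_mult)
  then have "lead_coeff p = lead_coeff s" by simp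
  then have "p = Polynomial.smult (lead_coeff p) (\<Prod>x\<in>#add_mset (Re z) R. [:- x, 1:])"
    by (subst s, subst R) (simp del: mult_pCons_left)
  then show ?case by blast
qed

text \<open>The Hermitian form of \<open>A\<close> at a complex eigenvector equals z N with N > 0,
  and it is its own conjugate because \<open>A\<close> is real and symmetric.\<close>

lemma symmetric_eigenvalue_real:
  fixes A :: "real mat"
  assumes A: "A \<in> carrier_mat n n" and sym: "transpose_mat A = A"
    and z: "eigenvalue (map_mat complex_of_real A) z"
  shows "Im z = 0"
proof -
  obtain v where v: "v \<in> carrier_vec n" "v \<noteq> 0\<^sub>v n"
    and ev: "map_mat complex_of_real A *\<^sub>v v = z \<cdot>\<^sub>v v"
    using z A by (auto simp: eigenvalue_def eigenvector_def)
  have row: "(\<Sum>j<n. complex_of_real (A $$ (i, j)) * v $ j) = z * v $ i" if "i < n" for i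
    using arg_cong[OF ev, of "\<lambda>w. w $ i"] A v that
    by (simp add: scalar_prod_def atLeast0LessThan)
  have Aij: "A $$ (i, j) = A $$ (j, i)" if "i < n" "j < n" for i j
    using arg_cong[OF sym, of "\<lambda>B. B $$ (i, j)"] A that by simp
  define N where "N = (\<Sum>i<n. (cmod (v $ i))\<^sup>2)"
  have "N > 0"
  proof -
    obtain i where "i < n" "v $ i \<noteq> 0"
      using v by (metis eq_vecI carrier_vecD index_zero_vec)
    then show ?thesis
      unfolding N_def by (intro sum_pos2[of _ i]) auto
  qed
  define q where "q = (\<Sum>i<n. \<Sum>j<n. cnj (v $ i) * complex_of_real (A $$ (i, j)) * v $ j)"
  have "q = (\<Sum>i<n. cnj (v $ i) * (\<Sum>j<n. complex_of_real (A $$ (i, j)) * v $ j))"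
    by (simp add: q_def sum_distrib_left mult.assoc)
  also have "\<dots> = (\<Sum>i<n. z * (v $ i * cnj (v $ i)))"
    using row by (intro sum.cong refl) (metis lessThan_iff mult.commute mult.left_commute)
  also have "\<dots> = z * of_real N"
    by (simp add: N_def sum_distrib_left complex_norm_square[symmetric] mult_ac)
  finally have q: "q = z * of_real N" .
  have "cnj q = (\<Sum>i<n. \<Sum>j<n. v $ i * complex_of_real (A $$ (i, j)) * cnj (v $ j))"
    by (simp add: q_def)
  also have "\<dots> = (\<Sum>i<n. \<Sum>j<n. cnj (v $ j) * complex_of_real (A $$ (j, i)) * v $ i)"
    by (intro sum.cong) (simp_all add: Aij mult_ac)
  also have "\<dots> = q"
    unfolding q_def by (rule sum.swap)
  finally have "cnj z * of_real N = z * of_real N" using q by simp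
  with \<open>N > 0\<close> have "cnj z = z" by simp
  then show ?thesis by (simp add: complex_eq_iff)
qed

text \<open>Guarantees that the list of real roots behind \<open>eigval\<close> has full length: no
  eigenvalue is lost, and the default value 0 is never met below the dimension.\<close>

lemma symmetric_char_poly_factorization:
  fixes A :: "real mat"
  assumes A: "A \<in> carrier_mat n n" and sym: "transpose_mat A = A"
  defines "es \<equiv> rev (sorted_list_of_multiset (proots (char_poly A)))"
  shows "char_poly A = (\<Prod>e\<leftarrow>es. [:- e, 1:])" "length es = n"
proof -
  have monic: "monic (char_poly A)" and deg: "degree (char_poly A) = n"
    using degree_monic_char_poly[OF A] by auto
  have "char_poly (map_mat complex_of_real A) = map_poly complex_of_real (char_poly A)"
    by (rule of_real_hom.char_poly_hom[OF A])
  then have "Im z = 0" if "poly (map_poly complex_of_real (char_poly A)) z = 0" for z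
    using that symmetric_eigenvalue_real[OF A sym, of z]
      eigenvalue_root_char_poly[of "map_mat complex_of_real A" n z] A by simp
  then obtain R where R: "char_poly A = (\<Prod>x\<in>#R. [:- x, 1:])"
    using real_rooted_factorization[of "char_poly A"] monic by force
  have "proots (char_poly A) = (\<Sum>x\<in>#R. {#x#})"
    unfolding R
  proof (induction R)
    case (add x R)
    have "(\<Prod>x\<in>#R. [:- x, 1:]) \<noteq> 0"
      by (auto simp: prod_mset_zero_iff)
    then have "proots ([:- x, 1:] * (\<Prod>x\<in>#R. [:- x, 1:])) = {#x#} + proots (\<Prod>x\<in>#R. [:- x, 1:])"
      by (subst proots_mult) auto
    with add show ?case
      by (simp del: mult_pCons_left)
  qed simp
  then have "proots (char_poly A) = R" by simp
  then have es: "mset es = R" by (simp add: es_def)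
  then show 1: "char_poly A = (\<Prod>e\<leftarrow>es. [:- e, 1:])"
    by (metis R mset_map prod_mset_prod_list)
  have "degree (\<Prod>e\<leftarrow>es. [:- e, 1:]) = length es"
    by (rule degree_linear_factors)
  with 1 deg show "length es = n" by simp
qed

text \<open>Entries instead of matrices, since the later estimates are about finite sums. The second
  relation (completeness) stands beside the first because it is the one behind Parseval's identity.
  Row \<open>u l\<close> belongs to \<open>eigval S l\<close>, so the basis is sorted.\<close>

definition orthonormal_eigenbasis :: "nat \<Rightarrow> real mat \<Rightarrow> (nat \<Rightarrow> nat \<Rightarrow> real) \<Rightarrow> bool" where
  "orthonormal_eigenbasis n S u \<longleftrightarrow>
     (\<forall>l<n. \<forall>l'<n. (\<Sum>a<n. u l a * u l' a) = (if l = l' then 1 else 0)) \<and>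
     (\<forall>a<n. \<forall>b<n. (\<Sum>l<n. u l a * u l b) = (if a = b then 1 else 0)) \<and>
     (\<forall>a<n. \<forall>b<n. S $$ (a, b) = (\<Sum>l<n. eigval S l * u l a * u l b))"

lemma orthonormal_eigenbasisD:
  assumes "orthonormal_eigenbasis n S u"
  shows "\<And>l l'. l < n \<Longrightarrow> l' < n \<Longrightarrow> (\<Sum>a<n. u l a * u l' a) = (if l = l' then 1 else 0)"
    "\<And>a b. a < n \<Longrightarrow> b < n \<Longrightarrow> (\<Sum>l<n. u l a * u l b) = (if a = b then 1 else 0)"
    "\<And>a b. a < n \<Longrightarrow> b < n \<Longrightarrow> S $$ (a, b) = (\<Sum>l<n. eigval S l * u l a * u l b)"
  using assms unfolding orthonormal_eigenbasis_def by auto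

lemma spectral_theorem:
  fixes S :: "real mat"
  assumes S: "S \<in> carrier_mat n n" and sym: "transpose_mat S = S"
  shows "\<exists>u. orthonormal_eigenbasis n S u"
proof -
  define es where "es = rev (sorted_list_of_multiset (proots (char_poly S)))"
  note es = symmetric_char_poly_factorization[OF S sym, folded es_def]
  have eigval: "eigval S l = es ! l" if "l < n" for l
    using that es(2) by (simp add: eigval_def es_def Let_def)
  define D where "D = mat n n (\<lambda>(i, j). if i = j then es ! i else 0)"
  obtain U where U: "U \<in> carrier_mat n n" and UU: "transpose_mat U * U = 1\<^sub>m n"
    and D: "transpose_mat U * S * U = D"
    using symmetric_diagonalization[OF S sym es(1)] D_def by blast
  have UU': "U * transpose_mat U = 1\<^sub>m n"
    using mat_mult_left_right_inverse[OF _ U UU] U by auto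
  have Dc: "D \<in> carrier_mat n n" by (simp add: D_def)
  have "S = (U * transpose_mat U) * S * (U * transpose_mat U)"
    using S UU' by simp
  also have "\<dots> = U * D * transpose_mat U"
    using U S by (simp add: D[symmetric] assoc_mult_mat[of _ n n _ n _ n])
  finally have SD: "S = U * D * transpose_mat U" .
  show ?thesis
    unfolding orthonormal_eigenbasis_def
  proof (intro exI[of _ "\<lambda>l a. U $$ (a, l)"] conjI allI impI)
    fix l l' assume "l < n" "l' < n"
    then show "(\<Sum>a<n. U $$ (a, l) * U $$ (a, l')) = (if l = l' then 1 else 0)"
      using arg_cong[OF UU, of "\<lambda>B. B $$ (l, l')"] U
      by (simp add: scalar_prod_def atLeast0LessThan)
  next
    fix a b assume "a < n" "b < n"
    then show "(\<Sum>l<n. U $$ (a, l) * U $$ (b, l)) = (if a = b then 1 else 0)"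
      using arg_cong[OF UU', of "\<lambda>B. B $$ (a, b)"] U
      by (simp add: scalar_prod_def atLeast0LessThan)
  next
    fix a b assume ab: "a < n" "b < n"
    have "(U * D) $$ (a, l) = es ! l * U $$ (a, l)" if "l < n" for l
    proof -
      have "(U * D) $$ (a, l) = (\<Sum>j<n. U $$ (a, j) * (if j = l then es ! j else 0))"
        using ab that U by (simp add: D_def scalar_prod_def atLeast0LessThan)
      also have "\<dots> = (\<Sum>j<n. if j = l then es ! j * U $$ (a, j) else 0)"
        by (intro sum.cong) auto
      also have "\<dots> = es ! l * U $$ (a, l)"
        using that by simp
      finally show ?thesis .
    qed
    moreover have "S $$ (a, b) = (\<Sum>l<n. (U * D) $$ (a, l) * U $$ (b, l))"
    proof -
      have UD: "(U * D) $$ (a, l) = (\<Sum>j<n. U $$ (a, j) * D $$ (j, l))" if "l < n" for l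
        using ab that U Dc by (simp add: scalar_prod_def atLeast0LessThan)
      have "S $$ (a, b) = scalar_prod (row (U * D) a) (col (transpose_mat U) b)"
        unfolding SD using ab U Dc by (subst index_mult_mat) auto
      then show ?thesis
        using ab U Dc UD by (simp add: scalar_prod_def atLeast0LessThan)
    qed
    ultimately show "S $$ (a, b) = (\<Sum>l<n. eigval S l * U $$ (a, l) * U $$ (b, l))"
      by (simp add: eigval)
  qed
qed

lemma eigval_antimono:
  fixes S :: "real mat"
  assumes S: "S \<in> carrier_mat n n" and sym: "transpose_mat S = S"
    and le: "l \<le> l'" "l' < n"
  shows "eigval S l' \<le> eigval S l"
proof -
  define es where "es = sorted_list_of_multiset (proots (char_poly S))"
  have len: "length es = n"
    using symmetric_char_poly_factorization[OF S sym] by (simp add: es_def)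
  have "sorted es" unfolding es_def by simp
  then have "es ! (n - Suc l') \<le> es ! (n - Suc l)"
    using le len by (intro sorted_nth_mono) auto
  then show ?thesis
    using le len by (simp add: eigval_def Let_def es_def[symmetric] rev_nth)
qed

lemma eigval_out_of_range:
  fixes S :: "real mat"
  assumes S: "S \<in> carrier_mat n n" and sym: "transpose_mat S = S" and "n \<le> l"
  shows "eigval S l = 0"
  using symmetric_char_poly_factorization(2)[OF S sym] assms(3) by (auto simp: eigval_def Let_def)

section \<open>Quadratic forms, singular values and perturbation\<close>

text \<open>Exchanging sums leaves the Gram matrix of the columns of \<open>u\<close>. For N = n
  this is Parseval's identity, for larger N it says that orthonormal columns act
  isometrically.\<close>

lemma sum_mult_gram:
  fixes u :: "nat \<Rightarrow> nat \<Rightarrow> real"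
  assumes "\<And>a b. a < n \<Longrightarrow> b < n \<Longrightarrow> (\<Sum>l<N. u l a * u l b) = (if a = b then 1 else 0)"
  shows "(\<Sum>l<N. (\<Sum>a<n. u l a * x a) * (\<Sum>b<n. u l b * y b)) = (\<Sum>a<n. x a * y a)"
proof -
  have "(\<Sum>l<N. (\<Sum>a<n. u l a * x a) * (\<Sum>b<n. u l b * y b)) =
      (\<Sum>l<N. \<Sum>a<n. \<Sum>b<n. x a * y b * (u l a * u l b))"
    by (simp add: sum_product mult_ac)
  also have "\<dots> = (\<Sum>a<n. \<Sum>l<N. \<Sum>b<n. x a * y b * (u l a * u l b))"
    by (rule sum.swap)
  also have "\<dots> = (\<Sum>a<n. \<Sum>b<n. x a * y b * (\<Sum>l<N. u l a * u l b))"
    by (rule sum.cong[OF refl], subst sum.swap) (simp add: sum_distrib_left)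
  also have "\<dots> = (\<Sum>a<n. \<Sum>b<n. if b = a then x a * y b else 0)"
    by (intro sum.cong refl) (auto simp: assms)
  also have "\<dots> = (\<Sum>a<n. x a * y a)"
    by simp
  finally show ?thesis .
qed

lemma sum_square_gram:
  fixes u :: "nat \<Rightarrow> nat \<Rightarrow> real"
  assumes "\<And>a b. a < n \<Longrightarrow> b < n \<Longrightarrow> (\<Sum>l<N. u l a * u l b) = (if a = b then 1 else 0)"
  shows "(\<Sum>l<N. (\<Sum>a<n. u l a * x a)\<^sup>2) = (\<Sum>a<n. (x a)\<^sup>2)"
  using sum_mult_gram[where x = x and y = x, OF assms] by (simp add: power2_eq_square)

text \<open>The coefficients \<open>y\<close> are arbitrary rather than those of the projection,
  because the polar factor below is compared with the projection through this formula.\<close>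

lemma dist_to_range:
  fixes Q :: "nat \<Rightarrow> nat \<Rightarrow> real"
  assumes "\<And>i j. i < r \<Longrightarrow> j < r \<Longrightarrow> (\<Sum>a<p. Q a i * Q a j) = (if i = j then 1 else 0)"
  shows "(\<Sum>a<p. (x a - (\<Sum>i<r. Q a i * y i))\<^sup>2) =
    (\<Sum>a<p. (x a)\<^sup>2) - 2 * (\<Sum>i<r. y i * (\<Sum>a<p. Q a i * x a)) + (\<Sum>i<r. (y i)\<^sup>2)"
proof -
  have "(\<Sum>a<p. (x a - (\<Sum>i<r. Q a i * y i))\<^sup>2) =
     (\<Sum>a<p. (x a)\<^sup>2) - 2 * (\<Sum>a<p. x a * (\<Sum>i<r. Q a i * y i)) + (\<Sum>a<p. (\<Sum>i<r. Q a i * y i)\<^sup>2)"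
    by (simp add: power2_diff sum.distrib sum_subtractf sum_distrib_left mult_ac)
  also have "(\<Sum>a<p. x a * (\<Sum>i<r. Q a i * y i)) = (\<Sum>i<r. y i * (\<Sum>a<p. Q a i * x a))"
    unfolding sum_distrib_left by (subst sum.swap) (simp add: mult_ac)
  also have "(\<Sum>a<p. (\<Sum>i<r. Q a i * y i)\<^sup>2) = (\<Sum>i<r. (y i)\<^sup>2)"
    by (rule sum_square_gram[OF assms])
  finally show ?thesis .
qed

lemma quadratic_form_spectral:
  fixes S :: "real mat"
  assumes S: "\<And>a b. a < n \<Longrightarrow> b < n \<Longrightarrow> S $$ (a, b) = (\<Sum>l<n. e l * u l a * u l b)"
  shows "(\<Sum>a<n. \<Sum>b<n. x a * S $$ (a, b) * x b) = (\<Sum>l<n. e l * (\<Sum>a<n. u l a * x a)\<^sup>2)"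
proof -
  have "(\<Sum>l<n. e l * (\<Sum>a<n. u l a * x a)\<^sup>2) =
      (\<Sum>l<n. \<Sum>a<n. \<Sum>b<n. x a * (e l * u l a * u l b) * x b)"
    by (simp add: power2_eq_square sum_product sum_distrib_left mult_ac)
  also have "\<dots> = (\<Sum>a<n. \<Sum>l<n. \<Sum>b<n. x a * (e l * u l a * u l b) * x b)"
    by (rule sum.swap)
  also have "\<dots> = (\<Sum>a<n. \<Sum>b<n. \<Sum>l<n. x a * (e l * u l a * u l b) * x b)"
    by (rule sum.cong[OF refl], rule sum.swap)
  also have "\<dots> = (\<Sum>a<n. \<Sum>b<n. x a * S $$ (a, b) * x b)"
    by (intro sum.cong refl) (simp add: S sum_distrib_left sum_distrib_right)
  finally show ?thesis by simp
qed

text \<open>The lower half of Courant-Fischer: an r-dimensional space meets the orthogonal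
  complement of the first r - 1 eigenvectors, and on that complement the form is at most
  \<open>eigval S (r - 1)\<close> times the squared length.\<close>

lemma eigval_ge_quadratic_form:
  fixes S :: "real mat" and Q :: "nat \<Rightarrow> nat \<Rightarrow> real"
  assumes S: "S \<in> carrier_mat p p" "transpose_mat S = S" and r: "0 < r" "r \<le> p"
    and Q: "\<And>i j. i < r \<Longrightarrow> j < r \<Longrightarrow> (\<Sum>a<p. Q a i * Q a j) = (if i = j then 1 else 0)"
    and \<kappa>: "\<And>z. \<kappa> * (\<Sum>j<r. (z j)\<^sup>2) \<le>
      (\<Sum>a<p. \<Sum>b<p. (\<Sum>j<r. Q a j * z j) * S $$ (a, b) * (\<Sum>j<r. Q b j * z j))"
  shows "\<kappa> \<le> eigval S (r - 1)"
proof -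
  obtain u where "orthonormal_eigenbasis p S u"
    using spectral_theorem[OF S] by blast
  note u = orthonormal_eigenbasisD[OF this]
  \<comment> \<open>Row r - 1 is zero: it pads the r - 1 orthogonality conditions to a square
    singular matrix, whose kernel vector gives the coordinates of the required point.\<close>
  define B where "B = mat r r (\<lambda>(l, j). if l = r - 1 then 0 else \<Sum>a<p. u l a * Q a j)"
  have B: "B \<in> carrier_mat r r" by (simp add: B_def)
  have "det B = 0"
  proof -
    have "B = mat\<^sub>r r r (\<lambda>i. if i = r - 1 then 0\<^sub>v r else row B i)"
      using r by (intro eq_matI) (auto simp: B_def)
    moreover have "det (mat\<^sub>r r r (\<lambda>i. if i = r - 1 then 0\<^sub>v r else row B i)) = 0"
      using r B by (intro det_row_0) auto
    ultimately show ?thesis by simp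
  qed
  then obtain v where v: "v \<in> carrier_vec r" "v \<noteq> 0\<^sub>v r" "B *\<^sub>v v = 0\<^sub>v r"
    using det_0_iff_vec_prod_zero_field[OF B] by blast
  define x where "x a = (\<Sum>j<r. Q a j * v $ j)" for a
  define N where "N = (\<Sum>j<r. (v $ j)\<^sup>2)"
  have "N > 0"
  proof -
    obtain i where "i < r" "v $ i \<noteq> 0"
      using v by (metis eq_vecI carrier_vecD index_zero_vec)
    then show ?thesis
      unfolding N_def by (intro sum_pos2[of _ i]) auto
  qed
  have 0: "(\<Sum>a<p. u l a * x a) = 0" if "l < r - 1" for l
  proof -
    have "0 = (B *\<^sub>v v) $ l" using v that by simp
    also have "\<dots> = (\<Sum>j<r. (\<Sum>a<p. u l a * Q a j) * v $ j)"
      using that v(1) B r by (simp add: scalar_prod_def atLeast0LessThan) (simp add: B_def)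
    also have "\<dots> = (\<Sum>a<p. u l a * x a)"
      unfolding x_def sum_distrib_left sum_distrib_right by (subst sum.swap) (simp add: mult_ac)
    finally show ?thesis by simp
  qed
  have "\<kappa> * N \<le> (\<Sum>l<p. eigval S l * (\<Sum>a<p. u l a * x a)\<^sup>2)"
    using \<kappa>[of "\<lambda>j. v $ j"] quadratic_form_spectral[of p S "eigval S" u x, OF u(3)]
    by (simp add: N_def x_def)
  also have "\<dots> \<le> (\<Sum>l<p. eigval S (r - 1) * (\<Sum>a<p. u l a * x a)\<^sup>2)"
  proof (intro sum_mono)
    fix l assume "l \<in> {..<p}"
    then show "eigval S l * (\<Sum>a<p. u l a * x a)\<^sup>2 \<le> eigval S (r - 1) * (\<Sum>a<p. u l a * x a)\<^sup>2"
      using 0[of l] eigval_antimono[OF S, of "r - 1" l]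
      by (cases "l < r - 1") (auto intro!: mult_right_mono)
  qed
  also have "\<dots> = eigval S (r - 1) * (\<Sum>a<p. (x a)\<^sup>2)"
    using sum_square_gram[where x = x, OF u(2)] by (simp add: sum_distrib_left[symmetric])
  also have "(\<Sum>a<p. (x a)\<^sup>2) = N"
    unfolding x_def N_def by (rule sum_square_gram[OF Q])
  finally show ?thesis using \<open>N > 0\<close> by simp
qed

lemma gram_mat:
  fixes A :: "real mat"
  assumes A: "A \<in> carrier_mat n d"
  shows "transpose_mat A * A \<in> carrier_mat d d"
    "transpose_mat (transpose_mat A * A) = transpose_mat A * A"
    "\<And>a b. a < d \<Longrightarrow> b < d \<Longrightarrow> (transpose_mat A * A) $$ (a, b) = (\<Sum>i<n. A $$ (i, a) * A $$ (i, b))"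
    "\<And>x. (\<Sum>a<d. \<Sum>b<d. x a * (transpose_mat A * A) $$ (a, b) * x b) =
      (\<Sum>i<n. (\<Sum>j<d. A $$ (i, j) * x j)\<^sup>2)"
proof -
  show "transpose_mat A * A \<in> carrier_mat d d"
    "transpose_mat (transpose_mat A * A) = transpose_mat A * A"
    using A by (auto simp: transpose_mult[of _ d n])
  show 1: "\<And>a b. a < d \<Longrightarrow> b < d \<Longrightarrow>
      (transpose_mat A * A) $$ (a, b) = (\<Sum>i<n. A $$ (i, a) * A $$ (i, b))"
    using A by (simp add: scalar_prod_def atLeast0LessThan)
  fix x :: "nat \<Rightarrow> real"
  have "(\<Sum>a<d. \<Sum>b<d. x a * (transpose_mat A * A) $$ (a, b) * x b) =
      (\<Sum>a<d. \<Sum>b<d. \<Sum>i<n. x a * (A $$ (i, a) * A $$ (i, b)) * x b)"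
    by (intro sum.cong refl) (simp add: 1 sum_distrib_left sum_distrib_right del: index_mult_mat(1))
  also have "\<dots> = (\<Sum>a<d. \<Sum>i<n. \<Sum>b<d. x a * (A $$ (i, a) * A $$ (i, b)) * x b)"
    by (rule sum.cong[OF refl], rule sum.swap)
  also have "\<dots> = (\<Sum>i<n. \<Sum>a<d. \<Sum>b<d. x a * (A $$ (i, a) * A $$ (i, b)) * x b)"
    by (rule sum.swap)
  also have "\<dots> = (\<Sum>i<n. (\<Sum>j<d. A $$ (i, j) * x j)\<^sup>2)"
    by (simp add: power2_eq_square sum_product mult_ac)
  finally show "(\<Sum>a<d. \<Sum>b<d. x a * (transpose_mat A * A) $$ (a, b) * x b) =
      (\<Sum>i<n. (\<Sum>j<d. A $$ (i, j) * x j)\<^sup>2)" .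
qed

text \<open>With d columns, index d - 1 is the smallest singular value, so every term in the
  spectral expansion of A^T A has weight at least s^2. For s = 0 the eigenvalue is still known to be
  nonnegative, since \<open>sqrt\<close> is negative on negative reals.\<close>

lemma sing_val_le_cols:
  fixes A :: "real mat"
  assumes A: "A \<in> carrier_mat n d" and d: "0 < d" and s: "0 \<le> s" "s \<le> sing_val A (d - 1)"
  shows "s\<^sup>2 * (\<Sum>j<d. (z j)\<^sup>2) \<le> (\<Sum>i<n. (\<Sum>j<d. A $$ (i, j) * z j)\<^sup>2)"
proof -
  let ?S = "transpose_mat A * A"
  note S = gram_mat(1,2)[OF A]
  obtain u where "orthonormal_eigenbasis d ?S u"
    using spectral_theorem[OF S] by blast
  note u = orthonormal_eigenbasisD[OF this]
  have "s\<^sup>2 \<le> eigval ?S (d - 1)" if "s > 0"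
  proof -
    have "0 < sqrt (eigval ?S (d - 1))" using s that unfolding sing_val_def by linarith
    then have "0 \<le> eigval ?S (d - 1)" by simp
    moreover have "s\<^sup>2 \<le> (sqrt (eigval ?S (d - 1)))\<^sup>2"
      using s by (intro power_mono) (auto simp: sing_val_def)
    ultimately show ?thesis by simp
  qed
  moreover have "eigval ?S (d - 1) \<ge> 0" if "s = 0"
    using s that by (simp add: sing_val_def)
  ultimately have le: "s\<^sup>2 \<le> eigval ?S (d - 1)" using s by (cases "s = 0") auto
  have "s\<^sup>2 * (\<Sum>j<d. (z j)\<^sup>2) = (\<Sum>l<d. s\<^sup>2 * (\<Sum>a<d. u l a * z a)\<^sup>2)"
    using sum_square_gram[where x = z, OF u(2)] by (simp add: sum_distrib_left[symmetric])
  also have "\<dots> \<le> (\<Sum>l<d. eigval ?S l * (\<Sum>a<d. u l a * z a)\<^sup>2)"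
  proof (intro sum_mono mult_right_mono)
    fix l assume "l \<in> {..<d}"
    then have "l \<le> d - 1" "d - 1 < d" by auto
    then show "s\<^sup>2 \<le> eigval ?S l"
      using eigval_antimono[OF S, of l "d - 1"] le by linarith
  qed auto
  also have "\<dots> = (\<Sum>i<n. (\<Sum>j<d. A $$ (i, j) * z j)\<^sup>2)"
    using quadratic_form_spectral[of d ?S "eigval ?S" u z, OF u(3)] gram_mat(4)[OF A, of z] by simp
  finally show ?thesis .
qed

text \<open>The images of the eigenbasis of a Gram matrix are the left singular vectors up to
  length. Dividing them by the square roots of the eigenvalues yields the orthonormal systems needed
  for row bounds, for the polar factor and for a basis of the range of the loadings.\<close>

lemma gram_of_eigenbasis:
  fixes a :: "nat \<Rightarrow> nat \<Rightarrow> real"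
  assumes S: "\<And>i j. i < d \<Longrightarrow> j < d \<Longrightarrow> S $$ (i, j) = (\<Sum>x<q. a x i * a x j)"
    and basis: "orthonormal_eigenbasis d S u" and l: "l < d" "l' < d"
  shows "(\<Sum>x<q. (\<Sum>j<d. a x j * u l j) * (\<Sum>j<d. a x j * u l' j)) = (if l = l' then eigval S l else 0)"
proof -
  note u = orthonormal_eigenbasisD[OF basis]
  have "(\<Sum>x<q. (\<Sum>j<d. a x j * u l j) * (\<Sum>j<d. a x j * u l' j)) =
      (\<Sum>x<q. \<Sum>i<d. \<Sum>j<d. u l i * (a x i * a x j) * u l' j)"
    unfolding sum_product by (intro sum.cong refl) (simp add: mult_ac)
  also have "\<dots> = (\<Sum>i<d. \<Sum>j<d. \<Sum>x<q. u l i * (a x i * a x j) * u l' j)"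
    by (subst sum.swap, rule sum.cong[OF refl], rule sum.swap)
  also have "\<dots> = (\<Sum>i<d. \<Sum>j<d. u l i * (\<Sum>k<d. eigval S k * u k i * u k j) * u l' j)"
  proof (intro sum.cong refl)
    fix i j assume "i \<in> {..<d}" "j \<in> {..<d}"
    then have "(\<Sum>k<d. eigval S k * u k i * u k j) = (\<Sum>x<q. a x i * a x j)"
      using u(3)[of i j] S[of i j] by simp
    then show "(\<Sum>x<q. u l i * (a x i * a x j) * u l' j) =
        u l i * (\<Sum>k<d. eigval S k * u k i * u k j) * u l' j"
      by (simp only: sum_distrib_left sum_distrib_right)
  qed
  also have "\<dots> = (\<Sum>i<d. \<Sum>j<d. \<Sum>k<d. eigval S k * (u k i * u l i) * (u k j * u l' j))"
    by (simp add: sum_distrib_left sum_distrib_right mult_ac)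
  also have "\<dots> = (\<Sum>i<d. \<Sum>k<d. \<Sum>j<d. eigval S k * (u k i * u l i) * (u k j * u l' j))"
    by (rule sum.cong[OF refl], rule sum.swap)
  also have "\<dots> = (\<Sum>k<d. \<Sum>i<d. \<Sum>j<d. eigval S k * (u k i * u l i) * (u k j * u l' j))"
    by (rule sum.swap)
  also have "\<dots> = (\<Sum>k<d. eigval S k * (\<Sum>i<d. u k i * u l i) * (\<Sum>j<d. u k j * u l' j))"
    by (simp add: sum_distrib_left sum_distrib_right mult_ac)
  also have "\<dots> = (\<Sum>k<d. if k = l then (if l = l' then eigval S l else 0) else 0)"
    using l by (intro sum.cong refl) (auto simp: u(1))
  also have "\<dots> = (if l = l' then eigval S l else 0)"
    using l by simp
  finally show ?thesis .
qed

text \<open>\<open>sing_val\<close> sees only A^T A, which is n by n, whereas the bound concerns the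
  d rows. The first d normalised images of the eigenvectors form an orthogonal d by d matrix, and
  expanding \<open>y\<close> in it transfers the bound.\<close>

lemma sing_val_le_rows:
  fixes A :: "real mat"
  assumes A: "A \<in> carrier_mat d n" and d: "0 < d" and s: "0 < s" "s \<le> sing_val A (d - 1)"
  shows "s\<^sup>2 * (\<Sum>i<d. (y i)\<^sup>2) \<le> (\<Sum>j<n. (\<Sum>i<d. y i * A $$ (i, j))\<^sup>2)"
proof -
  let ?S = "transpose_mat A * A"
  note S = gram_mat(1,2)[OF A]
  obtain u where basis: "orthonormal_eigenbasis n ?S u"
    using spectral_theorem[OF S] by blast
  note u = orthonormal_eigenbasisD[OF basis]
  have "0 < sqrt (eigval ?S (d - 1))"
    using s unfolding sing_val_def by linarith
  then have pos: "0 < eigval ?S (d - 1)" by simp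
  \<comment> \<open>A positive value at index d - 1 excludes the default 0 of \<open>eigval\<close>,
    so there are at least d columns.\<close>
  have dn: "d \<le> n"
    using eigval_out_of_range[OF S, of "d - 1"] pos by (cases "n \<le> d - 1") auto
  have "s\<^sup>2 \<le> (sqrt (eigval ?S (d - 1)))\<^sup>2"
    using s by (intro power_mono) (auto simp: sing_val_def)
  then have "s\<^sup>2 \<le> eigval ?S (d - 1)" using pos by simp
  then have le: "s\<^sup>2 \<le> eigval ?S l" "0 < eigval ?S l" if "l < d" for l
    using eigval_antimono[OF S, of l "d - 1"] that dn pos by force+
  define g where "g l i = (\<Sum>j<n. A $$ (i, j) * u l j)" for l i
  have g: "(\<Sum>i<d. g l i * g l' i) = (if l = l' then eigval ?S l else 0)" if l: "l < n" "l' < n" for l l'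
    unfolding g_def by (rule gram_of_eigenbasis[OF gram_mat(3)[OF A] basis l])
  define W where "W = mat d d (\<lambda>(i, l). g l i / sqrt (eigval ?S l))"
  have W: "W \<in> carrier_mat d d" by (simp add: W_def)
  have "transpose_mat W * W = 1\<^sub>m d"
  proof (rule eq_matI, goal_cases)
    case (1 l l')
    then have l: "l < d" "l' < d" by auto
    have "(transpose_mat W * W) $$ (l, l') = (\<Sum>i<d. g l i / sqrt (eigval ?S l) * (g l' i / sqrt (eigval ?S l')))"
      using l by (subst gram_mat(3)[OF W]) (auto simp: W_def)
    also have "\<dots> = (\<Sum>i<d. g l i * g l' i) / (sqrt (eigval ?S l) * sqrt (eigval ?S l'))"
      by (simp add: sum_divide_distrib)
    also have "\<dots> = (if l = l' then 1 else 0)"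
      using l dn le(2)[of l] by (subst g) auto
    finally show ?case using l by simp
  qed (use W in auto)
  then have WW: "W * transpose_mat W = 1\<^sub>m d"
    using mat_mult_left_right_inverse[of "transpose_mat W" d W] W by auto
  have w: "(\<Sum>l<d. W $$ (a, l) * W $$ (b, l)) = (if a = b then 1 else 0)" if "a < d" "b < d" for a b
    using arg_cong[OF WW, of "\<lambda>B. B $$ (a, b)"] that W
    by (simp add: scalar_prod_def atLeast0LessThan)
  have "s\<^sup>2 * (\<Sum>i<d. (y i)\<^sup>2) = (\<Sum>l<d. s\<^sup>2 * (\<Sum>i<d. W $$ (i, l) * y i)\<^sup>2)"
    using sum_square_gram[where u = "\<lambda>l i. W $$ (i, l)" and x = y, OF w] by (simp add: sum_distrib_left[symmetric])
  also have "\<dots> \<le> (\<Sum>l<d. eigval ?S l * (\<Sum>i<d. W $$ (i, l) * y i)\<^sup>2)"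
    using le by (intro sum_mono mult_right_mono) auto
  also have "\<dots> = (\<Sum>l<d. (\<Sum>i<d. g l i * y i)\<^sup>2)"
  proof (intro sum.cong refl)
    fix l assume "l \<in> {..<d}"
    then have l: "l < d" by simp
    have "(\<Sum>i<d. W $$ (i, l) * y i) = (\<Sum>i<d. g l i * y i) / sqrt (eigval ?S l)"
      using l by (simp add: W_def sum_divide_distrib)
    then show "eigval ?S l * (\<Sum>i<d. W $$ (i, l) * y i)\<^sup>2 = (\<Sum>i<d. g l i * y i)\<^sup>2"
      using le(2)[OF l] by (simp add: power_divide)
  qed
  also have "\<dots> \<le> (\<Sum>l<n. (\<Sum>i<d. g l i * y i)\<^sup>2)"
    using dn by (intro sum_mono2) auto
  also have "\<dots> = (\<Sum>l<n. (\<Sum>j<n. u l j * (\<Sum>i<d. y i * A $$ (i, j)))\<^sup>2)"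
  proof (rule sum.cong[OF refl])
    fix l
    have "(\<Sum>i<d. g l i * y i) = (\<Sum>j<n. u l j * (\<Sum>i<d. y i * A $$ (i, j)))"
      unfolding g_def sum_distrib_left sum_distrib_right by (subst sum.swap) (simp add: mult_ac)
    then show "(\<Sum>i<d. g l i * y i)\<^sup>2 = (\<Sum>j<n. u l j * (\<Sum>i<d. y i * A $$ (i, j)))\<^sup>2"
      by simp
  qed
  also have "\<dots> = (\<Sum>j<n. (\<Sum>i<d. y i * A $$ (i, j))\<^sup>2)"
    by (rule sum_square_gram[OF u(2)])
  finally show ?thesis .
qed

text \<open>The square of an entry is at most a diagonal entry of the Gram matrix, which is a convex
  combination of its eigenvalues.\<close>

lemma entry_le_spectral_norm:
  fixes A :: "real mat"
  assumes A: "A \<in> carrier_mat n d" and ij: "i < n" "j < d"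
  shows "\<bar>A $$ (i, j)\<bar> \<le> spectral_norm A"
proof -
  let ?S = "transpose_mat A * A"
  note S = gram_mat(1,2)[OF A]
  obtain u where "orthonormal_eigenbasis d ?S u"
    using spectral_theorem[OF S] by blast
  note u = orthonormal_eigenbasisD[OF this]
  have "(A $$ (i, j))\<^sup>2 \<le> (\<Sum>i<n. (A $$ (i, j))\<^sup>2)"
    using ij by (intro member_le_sum) auto
  also have "\<dots> = ?S $$ (j, j)"
    using gram_mat(3)[OF A ij(2) ij(2)] by (simp add: power2_eq_square)
  also have "\<dots> = (\<Sum>l<d. eigval ?S l * (u l j * u l j))"
    using u(3)[OF ij(2) ij(2)] by (simp add: mult_ac)
  also have "\<dots> \<le> (\<Sum>l<d. eigval ?S 0 * (u l j * u l j))"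
    using eigval_antimono[OF S] by (intro sum_mono mult_right_mono) auto
  also have "\<dots> = eigval ?S 0"
    using u(2)[OF ij(2) ij(2)] by (simp add: sum_distrib_left[symmetric])
  finally have "sqrt ((A $$ (i, j))\<^sup>2) \<le> sqrt (eigval ?S 0)"
    by (rule real_sqrt_le_mono)
  then show ?thesis by (simp add: spectral_norm_def sing_val_def)
qed

lemma sing_val_orthonormal:
  fixes A :: "real mat"
  assumes AA: "transpose_mat A * A = 1\<^sub>m d" and j: "j < d"
  shows "sing_val A j = 1"
proof -
  have S: "(1\<^sub>m d :: real mat) \<in> carrier_mat d d" "transpose_mat (1\<^sub>m d :: real mat) = 1\<^sub>m d" by auto
  obtain u where "orthonormal_eigenbasis d (1\<^sub>m d) u"
    using spectral_theorem[OF S] by blast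
  note u = orthonormal_eigenbasisD[OF this]
  have "1 = (\<Sum>a<d. (u j a)\<^sup>2)"
    using u(1)[OF j j] by (simp add: power2_eq_square)
  also have "\<dots> = (\<Sum>a<d. \<Sum>b<d. if b = a then u j a * u j b else 0)"
    by (simp add: power2_eq_square)
  also have "\<dots> = (\<Sum>a<d. \<Sum>b<d. u j a * (1\<^sub>m d :: real mat) $$ (a, b) * u j b)"
    by (intro sum.cong refl) auto
  also have "\<dots> = (\<Sum>l<d. eigval (1\<^sub>m d) l * (\<Sum>a<d. u l a * u j a)\<^sup>2)"
    by (rule quadratic_form_spectral[OF u(3)])
  also have "\<dots> = (\<Sum>l<d. if l = j then eigval (1\<^sub>m d) l else 0)"
    using j by (intro sum.cong refl) (auto simp: u(1))
  also have "\<dots> = eigval (1\<^sub>m d) j"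
    using j by simp
  finally show ?thesis by (simp add: sing_val_def AA)
qed

text \<open>The witness is the orthogonal polar factor of B = Q^T V. With w the squared singular
  values of \<open>B\<close>, all in [0, 1], the squared distance of \<open>V\<close> to its
  projection is the sum of 1 - w, and to Q Z it is twice the sum of 1 - sqrt w; the factor 2 remains
  because w <= sqrt w.\<close>

lemma procrustes:
  fixes Q V :: "nat \<Rightarrow> nat \<Rightarrow> real"
  assumes Q: "\<And>i j. i < r \<Longrightarrow> j < r \<Longrightarrow> (\<Sum>a<p. Q a i * Q a j) = (if i = j then 1 else 0)"
    and V: "\<And>i j. i < r \<Longrightarrow> j < r \<Longrightarrow> (\<Sum>a<p. V a i * V a j) = (if i = j then 1 else 0)"
  defines "B \<equiv> \<lambda>i j. \<Sum>a<p. Q a i * V a j"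
  assumes lt: "(\<Sum>j<r. \<Sum>a<p. (V a j - (\<Sum>i<r. Q a i * B i j))\<^sup>2) < 1"
  shows "\<exists>Z. (\<forall>j<r. \<forall>j'<r. (\<Sum>i<r. Z i j * Z i j') = (if j = j' then 1 else (0::real))) \<and>
    (\<Sum>j<r. \<Sum>a<p. (V a j - (\<Sum>i<r. Q a i * Z i j))\<^sup>2) \<le>
      2 * (\<Sum>j<r. \<Sum>a<p. (V a j - (\<Sum>i<r. Q a i * B i j))\<^sup>2)"
proof -
  define \<epsilon> where "\<epsilon> = (\<Sum>j<r. \<Sum>a<p. (V a j - (\<Sum>i<r. Q a i * B i j))\<^sup>2)"
  have dist: "(\<Sum>j<r. \<Sum>a<p. (V a j - (\<Sum>i<r. Q a i * Z i j))\<^sup>2) =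
      real r - 2 * (\<Sum>j<r. \<Sum>i<r. Z i j * B i j) + (\<Sum>j<r. \<Sum>i<r. (Z i j)\<^sup>2)" for Z
  proof -
    have "(\<Sum>j<r. \<Sum>a<p. (V a j - (\<Sum>i<r. Q a i * Z i j))\<^sup>2) =
      (\<Sum>j<r. 1 - 2 * (\<Sum>i<r. Z i j * B i j) + (\<Sum>i<r. (Z i j)\<^sup>2))"
    proof (rule sum.cong[OF refl])
      fix j assume "j \<in> {..<r}"
      then have "(\<Sum>a<p. (V a j)\<^sup>2) = 1"
        using V[of j j] by (simp add: power2_eq_square)
      then show "(\<Sum>a<p. (V a j - (\<Sum>i<r. Q a i * Z i j))\<^sup>2) =
          1 - 2 * (\<Sum>i<r. Z i j * B i j) + (\<Sum>i<r. (Z i j)\<^sup>2)"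
        using dist_to_range[where x = "\<lambda>a. V a j" and y = "\<lambda>i. Z i j" and r = r, OF Q] by (simp add: B_def)
    qed
    then show ?thesis
      by (simp add: sum.distrib sum_subtractf sum_distrib_left)
  qed
  have eps: "\<epsilon> = real r - (\<Sum>j<r. \<Sum>i<r. (B i j)\<^sup>2)"
    unfolding \<epsilon>_def by (subst dist) (simp add: power2_eq_square)
  define S where "S = mat r r (\<lambda>(j, j'). \<Sum>i<r. B i j * B i j')"
  have S: "S \<in> carrier_mat r r" "transpose_mat S = S"
    by (auto simp: S_def mult.commute)
  obtain u where basis: "orthonormal_eigenbasis r S u"
    using spectral_theorem[OF S] by blast
  note u = orthonormal_eigenbasisD[OF basis]
  define w where "w l = eigval S l" for l
  define g where "g l i = (\<Sum>j<r. B i j * u l j)" for l i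
  have g: "(\<Sum>i<r. g l i * g l' i) = (if l = l' then w l else 0)" if l: "l < r" "l' < r" for l l'
    unfolding g_def w_def by (rule gram_of_eigenbasis[OF _ basis l]) (simp add: S_def)
  have w0: "0 \<le> w l" if "l < r" for l
    using g[OF that that] by (metis sum_nonneg zero_le_square)
  \<comment> \<open>\<open>B\<close> is a contraction: w is the squared length of the projection of
    the unit vector \<open>f\<close>.\<close>
  have w1: "w l \<le> 1" if l: "l < r" for l
  proof -
    define f where "f a = (\<Sum>j<r. V a j * u l j)" for a
    have "g l i = (\<Sum>a<p. Q a i * f a)" for i
      unfolding g_def f_def B_def sum_distrib_left sum_distrib_right
      by (subst sum.swap) (simp add: mult_ac)
    moreover have "0 \<le> (\<Sum>a<p. (f a - (\<Sum>i<r. Q a i * g l i))\<^sup>2)"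
      by (intro sum_nonneg) auto
    ultimately have "0 \<le> (\<Sum>a<p. (f a)\<^sup>2) - 2 * (\<Sum>i<r. g l i * g l i) + (\<Sum>i<r. (g l i)\<^sup>2)"
      using dist_to_range[where x = f and y = "g l" and r = r, OF Q] by simp
    also have "(\<Sum>a<p. (f a)\<^sup>2) = (\<Sum>j<r. (u l j)\<^sup>2)"
      unfolding f_def by (rule sum_square_gram[OF V])
    also have "\<dots> = 1"
      using u(1)[OF l l] by (simp add: power2_eq_square)
    finally show ?thesis
      using g[OF l l] by (simp add: power2_eq_square)
  qed
  have trace: "(\<Sum>l<r. w l) = (\<Sum>j<r. \<Sum>i<r. (B i j)\<^sup>2)"
  proof -
    have "(\<Sum>j<r. \<Sum>i<r. (B i j)\<^sup>2) = (\<Sum>i<r. \<Sum>j<r. (B i j)\<^sup>2)"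
      by (rule sum.swap)
    also have "\<dots> = (\<Sum>i<r. \<Sum>l<r. (g l i)\<^sup>2)"
      by (rule sum.cong[OF refl])
        (simp add: g_def sum_square_gram[where n = r, OF u(2)] mult.commute[of "B _ _"])
    also have "\<dots> = (\<Sum>l<r. \<Sum>i<r. (g l i)\<^sup>2)"
      by (rule sum.swap)
    also have "\<dots> = (\<Sum>l<r. w l)"
      by (intro sum.cong refl) (simp add: power2_eq_square g)
    finally show ?thesis by simp
  qed
  \<comment> \<open>A vanishing w would contribute a full unit to \<epsilon>, which is below
    one.\<close>
  have wpos: "0 < w l" if l: "l < r" for l
  proof (rule ccontr)
    assume "\<not> 0 < w l"
    then have "w l = 0" using w0[OF l] by simp
    then have "(\<Sum>l'<r. w l') = (\<Sum>l'\<in>{..<r} - {l}. w l')"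
      using l by (subst sum.remove[of _ l]) auto
    also have "\<dots> \<le> (\<Sum>l'\<in>{..<r} - {l}. 1)"
      using w1 by (intro sum_mono) auto
    also have "\<dots> = real r - 1"
      using l by (simp add: of_nat_diff)
    finally show False
      using eps lt trace unfolding \<epsilon>_def by linarith
  qed
  \<comment> \<open>In matrix terms Z = B (B^T B)^(-1/2), written through the eigenbasis of B^T
    B.\<close>
  define Z where "Z i j = (\<Sum>l<r. g l i / sqrt (w l) * u l j)" for i j
  have h: "(\<Sum>i<r. (g l i / sqrt (w l)) * (g l' i / sqrt (w l'))) = (if l = l' then 1 else 0)"
    if l: "l < r" "l' < r" for l l'
  proof -
    have "(\<Sum>i<r. (g l i / sqrt (w l)) * (g l' i / sqrt (w l'))) =
        (\<Sum>i<r. g l i * g l' i) / (sqrt (w l) * sqrt (w l'))"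
      by (simp add: sum_divide_distrib)
    then show ?thesis
      using g[OF l] wpos[OF l(1)] by auto
  qed
  have ZZ: "(\<Sum>i<r. Z i j * Z i j') = (if j = j' then 1 else 0)" if "j < r" "j' < r" for j j'
  proof -
    have "(\<Sum>i<r. Z i j * Z i j') = (\<Sum>l<r. u l j * u l j')"
      unfolding Z_def by (rule sum_mult_gram) (rule h)
    then show ?thesis using u(2)[OF that] by simp
  qed
  have ZB: "(\<Sum>j<r. \<Sum>i<r. Z i j * B i j) = (\<Sum>l<r. sqrt (w l))"
  proof -
    have "(\<Sum>j<r. \<Sum>i<r. Z i j * B i j) = (\<Sum>j<r. \<Sum>i<r. \<Sum>l<r. g l i / sqrt (w l) * (B i j * u l j))"
      by (simp add: Z_def sum_distrib_left sum_distrib_right mult_ac)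
    also have "\<dots> = (\<Sum>i<r. \<Sum>j<r. \<Sum>l<r. g l i / sqrt (w l) * (B i j * u l j))"
      by (rule sum.swap)
    also have "\<dots> = (\<Sum>i<r. \<Sum>l<r. \<Sum>j<r. g l i / sqrt (w l) * (B i j * u l j))"
      by (rule sum.cong[OF refl], rule sum.swap)
    also have "\<dots> = (\<Sum>i<r. \<Sum>l<r. g l i / sqrt (w l) * g l i)"
      by (simp add: g_def sum_distrib_left)
    also have "\<dots> = (\<Sum>l<r. \<Sum>i<r. g l i / sqrt (w l) * g l i)"
      by (rule sum.swap)
    also have "\<dots> = (\<Sum>l<r. (\<Sum>i<r. g l i * g l i) / sqrt (w l))"
      by (simp add: sum_divide_distrib)
    also have "\<dots> = (\<Sum>l<r. sqrt (w l))"
      by (intro sum.cong refl) (use wpos in \<open>auto simp: g real_div_sqrt less_imp_le\<close>)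
    finally show ?thesis .
  qed
  have "(\<Sum>j<r. \<Sum>a<p. (V a j - (\<Sum>i<r. Q a i * Z i j))\<^sup>2) = 2 * (real r - (\<Sum>l<r. sqrt (w l)))"
    unfolding dist ZB by (simp add: power2_eq_square ZZ)
  also have "\<dots> \<le> 2 * (real r - (\<Sum>l<r. w l))"
  proof -
    have "w l \<le> sqrt (w l)" if "l < r" for l
      using w0[OF that] w1[OF that] by (metis mult_left_le_one_le real_sqrt_ge_zero real_sqrt_le_1_iff real_sqrt_mult_self abs_of_nonneg)
    then show ?thesis by (auto intro!: sum_mono)
  qed
  also have "\<dots> = 2 * \<epsilon>" unfolding eps trace ..
  finally show ?thesis
    using ZZ unfolding \<epsilon>_def by blast
qed

text \<open>
  The distance of an eigenvector of \<open>\<Omega> \<Omega>\<^sup>T\<close> from the range of \<open>Q\<close> is controlled by the part of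
  \<open>\<Omega>\<close> outside that range, which is a part of \<open>\<Omega> - L\<close> because the columns of \<open>L\<close> lie in it.
\<close>

lemma eigenvector_perturbation:
  fixes \<Omega> L :: "nat \<Rightarrow> 's \<Rightarrow> real" and Q :: "nat \<Rightarrow> nat \<Rightarrow> real"
  assumes Q: "\<And>i j. i < r \<Longrightarrow> j < r \<Longrightarrow> (\<Sum>a<p. Q a i * Q a j) = (if i = j then 1 else (0::real))"
    and L: "\<And>s a. s \<in> J \<Longrightarrow> a < p \<Longrightarrow> L a s = (\<Sum>i<r. Q a i * y i s)"
    and v: "(\<Sum>a<p. (v a)\<^sup>2) = 1"
    and ev: "\<And>a. a < p \<Longrightarrow> (\<Sum>b<p. (\<Sum>s\<in>J. \<Omega> a s * \<Omega> b s) * v b) = e * v a"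
    and e: "0 < e"
  shows "(\<Sum>a<p. (v a - (\<Sum>i<r. Q a i * (\<Sum>b<p. Q b i * v b)))\<^sup>2) \<le>
    (\<Sum>s\<in>J. \<Sum>a<p. (\<Omega> a s - L a s)\<^sup>2) / e"
proof -
  define c where "c i = (\<Sum>b<p. Q b i * v b)" for i
  define x where "x a = v a - (\<Sum>i<r. Q a i * c i)" for a
  define N where "N = (\<Sum>a<p. (x a)\<^sup>2)"
  define \<zeta> where "\<zeta> = (\<Sum>s\<in>J. \<Sum>a<p. (\<Omega> a s - L a s)\<^sup>2)"
  have \<zeta>0: "0 \<le> \<zeta>" by (auto simp: \<zeta>_def intro!: sum_nonneg)
  have N0: "0 \<le> N" by (auto simp: N_def intro!: sum_nonneg)
  have Qx: "(\<Sum>a<p. Q a i * x a) = 0" if "i < r" for i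
  proof -
    have "(\<Sum>a<p. Q a i * (\<Sum>j<r. Q a j * c j)) = (\<Sum>a<p. \<Sum>j<r. Q a i * Q a j * c j)"
      by (simp add: sum_distrib_left mult_ac)
    also have "\<dots> = (\<Sum>j<r. \<Sum>a<p. Q a i * Q a j * c j)"
      by (rule sum.swap)
    also have "\<dots> = (\<Sum>j<r. (\<Sum>a<p. Q a i * Q a j) * c j)"
      by (simp add: sum_distrib_right)
    also have "\<dots> = (\<Sum>j<r. if j = i then c j else 0)"
      using that by (intro sum.cong refl) (auto simp: Q)
    also have "\<dots> = c i" using that by simp
    finally show ?thesis
      by (simp add: x_def c_def algebra_simps sum_subtractf)
  qed
  have N: "N = (\<Sum>a<p. x a * v a)"
  proof -
    have "(\<Sum>a<p. x a * (\<Sum>i<r. Q a i * c i)) = (\<Sum>i<r. c i * (\<Sum>a<p. Q a i * x a))"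
      unfolding sum_distrib_left by (subst sum.swap) (simp add: mult_ac)
    then have "(\<Sum>a<p. x a * (\<Sum>i<r. Q a i * c i)) = 0" using Qx by simp
    moreover have "N = (\<Sum>a<p. x a * (v a - (\<Sum>i<r. Q a i * c i)))"
      by (simp add: N_def power2_eq_square x_def)
    then have "N = (\<Sum>a<p. x a * v a) - (\<Sum>a<p. x a * (\<Sum>i<r. Q a i * c i))"
      by (simp add: right_diff_distrib sum_subtractf)
    ultimately show ?thesis by simp
  qed
  have swap: "(\<Sum>a<p. z a * (\<Sum>b<p. (\<Sum>s\<in>J. \<Omega> a s * \<Omega> b s) * v b)) =
      (\<Sum>s\<in>J. (\<Sum>a<p. z a * \<Omega> a s) * (\<Sum>b<p. \<Omega> b s * v b))" for z
  proof -
    have "(\<Sum>a<p. z a * (\<Sum>b<p. (\<Sum>s\<in>J. \<Omega> a s * \<Omega> b s) * v b)) =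
        (\<Sum>a<p. \<Sum>b<p. \<Sum>s\<in>J. z a * \<Omega> a s * (\<Omega> b s * v b))"
      by (simp add: sum_distrib_left sum_distrib_right mult_ac)
    also have "\<dots> = (\<Sum>a<p. \<Sum>s\<in>J. \<Sum>b<p. z a * \<Omega> a s * (\<Omega> b s * v b))"
      by (rule sum.cong[OF refl], rule sum.swap)
    also have "\<dots> = (\<Sum>s\<in>J. \<Sum>a<p. \<Sum>b<p. z a * \<Omega> a s * (\<Omega> b s * v b))"
      by (rule sum.swap)
    finally show ?thesis by (simp add: sum_product)
  qed
  have ev': "(\<Sum>a<p. z a * (\<Sum>b<p. (\<Sum>s\<in>J. \<Omega> a s * \<Omega> b s) * v b)) = e * (\<Sum>a<p. z a * v a)" for z
  proof -
    have "(\<Sum>a<p. z a * (\<Sum>b<p. (\<Sum>s\<in>J. \<Omega> a s * \<Omega> b s) * v b)) = (\<Sum>a<p. z a * (e * v a))"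
      by (rule sum.cong[OF refl]) (simp only: ev lessThan_iff)
    then show ?thesis
      by (simp add: sum_distrib_left mult_ac)
  qed
  have "e * N = (\<Sum>s\<in>J. (\<Sum>a<p. x a * \<Omega> a s) * (\<Sum>b<p. \<Omega> b s * v b))"
    using swap[of x] ev'[of x] N by simp
  \<comment> \<open>The residual \<open>x\<close> is orthogonal to the range of \<open>Q\<close>,
    hence to every column of \<open>L\<close>, so \<Omega> may be replaced by \<Omega> - L in the
    first factor.\<close>
  also have "\<dots> = (\<Sum>s\<in>J. (\<Sum>a<p. x a * (\<Omega> a s - L a s)) * (\<Sum>b<p. \<Omega> b s * v b))"
  proof (rule sum.cong[OF refl])
    fix s assume s: "s \<in> J"
    have "(\<Sum>a<p. x a * L a s) = (\<Sum>a<p. x a * (\<Sum>i<r. Q a i * y i s))"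
      using L[OF s] by simp
    also have "\<dots> = (\<Sum>i<r. y i s * (\<Sum>a<p. Q a i * x a))"
      unfolding sum_distrib_left by (subst sum.swap) (simp add: mult_ac)
    also have "\<dots> = 0" using Qx by simp
    finally show "(\<Sum>a<p. x a * \<Omega> a s) * (\<Sum>b<p. \<Omega> b s * v b) =
        (\<Sum>a<p. x a * (\<Omega> a s - L a s)) * (\<Sum>b<p. \<Omega> b s * v b)"
      by (simp add: algebra_simps sum_subtractf)
  qed
  finally have "(e * N)\<^sup>2 = (\<Sum>s\<in>J. (\<Sum>a<p. x a * (\<Omega> a s - L a s)) * (\<Sum>b<p. \<Omega> b s * v b))\<^sup>2"
    by simp
  also have "\<dots> \<le> (\<Sum>s\<in>J. (\<Sum>a<p. x a * (\<Omega> a s - L a s))\<^sup>2) * (\<Sum>s\<in>J. (\<Sum>b<p. \<Omega> b s * v b)\<^sup>2)"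
    by (rule Cauchy_Schwarz_ineq_sum)
  \<comment> \<open>This factor is v^T \<Omega> \<Omega>^T v = e. The estimate thus becomes (e N)^2
    <= N \<zeta> e, from which one factor e N cancels.\<close>
  also have "(\<Sum>s\<in>J. (\<Sum>b<p. \<Omega> b s * v b)\<^sup>2) = e"
  proof -
    have "(\<Sum>s\<in>J. (\<Sum>b<p. \<Omega> b s * v b)\<^sup>2) = (\<Sum>s\<in>J. (\<Sum>a<p. v a * \<Omega> a s) * (\<Sum>b<p. \<Omega> b s * v b))"
      by (simp add: power2_eq_square mult.commute)
    also have "\<dots> = e * (\<Sum>a<p. v a * v a)"
      using swap[of v] ev'[of v] by simp
    also have "\<dots> = e"
      using v by (simp add: power2_eq_square)
    finally show ?thesis .
  qed
  also have "(\<Sum>s\<in>J. (\<Sum>a<p. x a * (\<Omega> a s - L a s))\<^sup>2) * e \<le> (N * \<zeta>) * e"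
  proof -
    have "(\<Sum>s\<in>J. (\<Sum>a<p. x a * (\<Omega> a s - L a s))\<^sup>2) \<le> (\<Sum>s\<in>J. N * (\<Sum>a<p. (\<Omega> a s - L a s)\<^sup>2))"
      unfolding N_def by (intro sum_mono Cauchy_Schwarz_ineq_sum)
    then show ?thesis
      using e by (simp add: \<zeta>_def sum_distrib_left)
  qed
  finally have le: "(e * N)\<^sup>2 \<le> N * \<zeta> * e" .
  have "N \<le> \<zeta> / e"
  proof (cases "N = 0")
    case True
    then show ?thesis using \<zeta>0 e by simp
  next
    case False
    then have "0 < e * N" using N0 e by simp
    moreover have "(e * N) * (e * N) \<le> (e * N) * \<zeta>"
      using le by (simp add: power2_eq_square mult_ac)
    ultimately have "e * N \<le> \<zeta>" by (simp only: mult_le_cancel_left_pos)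
    then show ?thesis using e by (simp add: field_simps)
  qed
  then show ?thesis
    by (simp add: N_def \<zeta>_def x_def c_def)
qed

section \<open>Multi-indices and Kronecker products\<close>

lemma lin_insert_max:
  assumes "finite I" "\<forall>h\<in>I. h < k"
  shows "lin (insert k I) d i = lin I d i + i k * (\<Prod>h\<in>I. d h)"
proof -
  have k: "k \<notin> I" using assms by auto
  have "{h \<in> insert k I. h < k} = I" using assms by auto
  moreover have "{h \<in> insert k I. h < l} = {h \<in> I. h < l}" if "l \<in> I" for l
    using assms that by auto
  ultimately show ?thesis
    using assms k by (simp add: lin_def add.commute)
qed

text \<open>Uniqueness of mixed-radix digits, for an arbitrary finite set of modes because
  unfoldings leave one mode out. The induction adds the most significant mode: its contribution is a
  multiple of place value times radix of every earlier mode and leaves that digit alone.\<close>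

lemma lin_digits:
  assumes "finite I" "\<forall>k\<in>I. i k < d k"
  shows "lin I d i < (\<Prod>k\<in>I. d k)"
    "\<And>k. k \<in> I \<Longrightarrow> (lin I d i div (\<Prod>h\<in>{h\<in>I. h < k}. d h)) mod d k = i k"
proof -
  have "lin I d i < (\<Prod>k\<in>I. d k) \<and>
      (\<forall>k\<in>I. (lin I d i div (\<Prod>h\<in>{h\<in>I. h < k}. d h)) mod d k = i k)"
    using assms
  proof (induction I rule: finite_linorder_max_induct)
    case empty
    then show ?case by (simp add: lin_def)
  next
    case (insert b A)
    define Q where "Q = (\<Prod>h\<in>A. d h)"
    define l where "l = lin A d i"
    have lQ: "l < Q" and IH: "\<And>k. k \<in> A \<Longrightarrow> (l div (\<Prod>h\<in>{h\<in>A. h < k}. d h)) mod d k = i k"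
      using insert by (auto simp: Q_def l_def)
    have lin: "lin (insert b A) d i = l + i b * Q"
      using insert by (simp add: lin_insert_max Q_def l_def)
    have b: "b \<notin> A" "i b < d b" using insert by auto
    have "l + i b * Q < Q + i b * Q" using lQ by simp
    also have "\<dots> = (i b + 1) * Q" by simp
    also have "\<dots> \<le> d b * Q" using b by (intro mult_right_mono) auto
    finally have 1: "l + i b * Q < (\<Prod>k\<in>insert b A. d k)"
      using insert b by (simp add: Q_def)
    have "((l + i b * Q) div (\<Prod>h\<in>{h \<in> insert b A. h < k}. d h)) mod d k = i k" if k: "k \<in> insert b A" for k
    proof (cases "k = b")
      case True
      have "{h \<in> insert b A. h < k} = A" using True insert by auto
      then show ?thesis
        using True lQ b by (simp add: Q_def[symmetric])
    next
      case False
      then have kA: "k \<in> A" using k by simp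
      define q where "q = (\<Prod>h\<in>{h \<in> A. h < k}. d h)"
      define q' where "q' = (\<Prod>h\<in>{h \<in> A. h > k}. d h)"
      have "A = {h \<in> A. h < k} \<union> insert k {h \<in> A. h > k}" using kA by auto
      then have "Q = (\<Prod>h\<in>{h \<in> A. h < k} \<union> insert k {h \<in> A. h > k}. d h)"
        by (simp add: Q_def)
      also have "\<dots> = q * (d k * q')"
        using insert.hyps(1) by (subst prod.union_disjoint) (auto simp: q_def q'_def)
      finally have Q: "Q = q * (d k * q')" .
      have "q > 0" using lQ Q by (cases "q = 0") auto
      have set_eq: "{h \<in> insert b A. h < k} = {h \<in> A. h < k}"
        using insert kA by auto
      have "(l + i b * Q) div q = l div q + i b * (d k * q')"
        using \<open>q > 0\<close> by (simp add: Q mult.left_commute[of "i b" q] div_mult_self2)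
      also have "\<dots> mod d k = (l div q) mod d k"
        by (simp add: mult.left_commute[of "i b" "d k"])
      finally show ?thesis
        unfolding set_eq q_def[symmetric] using IH[OF kA] by (simp add: q_def)
    qed
    with 1 lin show ?case by auto
  qed
  then show "lin I d i < (\<Prod>k\<in>I. d k)"
    "\<And>k. k \<in> I \<Longrightarrow> (lin I d i div (\<Prod>h\<in>{h\<in>I. h < k}. d h)) mod d k = i k"
    by auto
qed

lemma digits_lin:
  assumes "finite I" "i \<in> PiE I (\<lambda>k. {..<d k})"
  shows "digits I d (lin I d i) = i"
proof
  fix k
  show "digits I d (lin I d i) k = i k"
    using assms lin_digits(2)[of I i d k] by (cases "k \<in> I") (auto simp: digits_def PiE_iff extensional_def)
qed

lemma bij_betw_lin:
  assumes "finite I"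
  shows "bij_betw (lin I d) (PiE I (\<lambda>k. {..<d k})) {..<\<Prod>k\<in>I. d k}"
proof -
  have inj: "inj_on (lin I d) (PiE I (\<lambda>k. {..<d k}))"
    by (rule inj_on_inverseI[where g = "digits I d"]) (rule digits_lin[OF assms])
  have "lin I d ` PiE I (\<lambda>k. {..<d k}) \<subseteq> {..<\<Prod>k\<in>I. d k}"
    using lin_digits(1)[OF assms] by (auto simp: PiE_iff)
  moreover have "card (lin I d ` PiE I (\<lambda>k. {..<d k})) = card {..<\<Prod>k\<in>I. d k}"
    using inj assms by (simp add: card_image card_PiE)
  ultimately have "lin I d ` PiE I (\<lambda>k. {..<d k}) = {..<\<Prod>k\<in>I. d k}"
    by (intro card_subset_eq) auto
  with inj show ?thesis by (simp add: bij_betw_def)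
qed

lemma bij_betw_digits:
  assumes "finite I"
  shows "bij_betw (digits I d) {..<\<Prod>k\<in>I. d k} (PiE I (\<lambda>k. {..<d k}))"
proof (rule bij_betw_byWitness[where f' = "lin I d"])
  note bij = bij_betw_lin[OF assms, of d]
  show "\<forall>c\<in>{..<\<Prod>k\<in>I. d k}. lin I d (digits I d c) = c"
  proof
    fix c assume "c \<in> {..<\<Prod>k\<in>I. d k}"
    then obtain i where "i \<in> PiE I (\<lambda>k. {..<d k})" "c = lin I d i"
      using bij by (auto simp: bij_betw_def)
    then show "lin I d (digits I d c) = c"
      using digits_lin[OF assms] by simp
  qed
  show "\<forall>i\<in>PiE I (\<lambda>k. {..<d k}). digits I d (lin I d i) = i"
    using digits_lin[OF assms] by blast
  show "digits I d ` {..<\<Prod>k\<in>I. d k} \<subseteq> PiE I (\<lambda>k. {..<d k})"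
  proof
    fix i assume "i \<in> digits I d ` {..<\<Prod>k\<in>I. d k}"
    then obtain c where c: "c < (\<Prod>k\<in>I. d k)" "i = digits I d c" by auto
    then obtain j where "j \<in> PiE I (\<lambda>k. {..<d k})" "c = lin I d j"
      using bij by (auto simp: bij_betw_def)
    then show "i \<in> PiE I (\<lambda>k. {..<d k})"
      using digits_lin[OF assms] c by simp
  qed
  show "lin I d ` PiE I (\<lambda>k. {..<d k}) \<subseteq> {..<\<Prod>k\<in>I. d k}"
    using bij by (auto simp: bij_betw_def)
qed

lemma sum_digits:
  assumes "finite I"
  shows "(\<Sum>c<(\<Prod>k\<in>I. d k). f (digits I d c)) = (\<Sum>i\<in>PiE I (\<lambda>k. {..<d k}). f i)"
  using sum.reindex_bij_betw[OF bij_betw_digits[OF assms]] by blast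

lemma sum_lin:
  assumes "finite I"
  shows "(\<Sum>c<(\<Prod>k\<in>I. d k). f c) = (\<Sum>i\<in>PiE I (\<lambda>k. {..<d k}). f (lin I d i))"
  using sum.reindex_bij_betw[OF bij_betw_lin[OF assms]] by metis

lemma sum_PiE_insert:
  assumes "k \<notin> I"
  shows "(\<Sum>i\<in>PiE (insert k I) B. f i) = (\<Sum>c\<in>PiE I B. \<Sum>a\<in>B k. f (c(k := a)))"
proof -
  have "(\<Sum>i\<in>PiE (insert k I) B. f i) = (\<Sum>(a, c)\<in>B k \<times> PiE I B. f (c(k := a)))"
    unfolding PiE_insert_eq
    by (subst sum.reindex[OF inj_combinator[OF assms]]) (simp add: case_prod_unfold)
  also have "\<dots> = (\<Sum>a\<in>B k. \<Sum>c\<in>PiE I B. f (c(k := a)))"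
    by (rule sum.cartesian_product[symmetric])
  also have "\<dots> = (\<Sum>c\<in>PiE I B. \<Sum>a\<in>B k. f (c(k := a)))"
    by (rule sum.swap)
  finally show ?thesis .
qed

lemma sum_idx_remove:
  assumes "k < K"
  shows "(\<Sum>i\<in>idx K d. f i) = (\<Sum>c\<in>PiE ({..<K} - {k}) (\<lambda>h. {..<d h}). \<Sum>a<d k. f (c(k := a)))"
  using sum_PiE_insert[of k "{..<K} - {k}" f "\<lambda>h. {..<d h}"] assms
  by (simp add: idx_def insert_absorb)

lemma finite_idx [simp]: "finite (idx K d)"
  by (auto simp: idx_def intro!: finite_PiE)

lemma card_idx: "card (idx K d) = (\<Prod>k<K. d k)"
  by (simp add: idx_def card_PiE)

lemma idx_subset_all_idx: "idx K d \<subseteq> all_idx K"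
  by (auto simp: idx_def all_idx_def PiE_iff)

text \<open>Coordinates of \<open>i\<close> beyond the modes already multiplied survive in the
  intermediate tensors. \<open>override_on\<close> keeps track of them, which makes the formula
  inductive in the number of modes.\<close>

lemma multi_prod_override:
  "multi_prod K d a Y i =
    (\<Sum>j\<in>idx K d. (\<Prod>h<K. a h (i h) (j h)) * Y (override_on i j {..<K}))"
proof (induction K arbitrary: i)
  case 0
  then show ?case by (simp add: idx_def override_on_def)
next
  case (Suc k)
  have "multi_prod (Suc k) d a Y i = (\<Sum>l<d k. a k (i k) l *
      (\<Sum>j\<in>idx k d. (\<Prod>h<k. a h ((i(k := l)) h) (j h)) * Y (override_on (i(k := l)) j {..<k})))"
    unfolding multi_prod.simps mode_prod_def Suc.IH ..
  also have "\<dots> = (\<Sum>l<d k. \<Sum>j\<in>idx k d. (\<Prod>h<Suc k. a h (i h) ((j(k := l)) h)) *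
      Y (override_on i (j(k := l)) {..<Suc k}))"
  proof (rule sum.cong[OF refl])
    fix l
    have "override_on (i(k := l)) j {..<k} = override_on i (j(k := l)) {..<Suc k}" for j
      by (auto simp: override_on_def fun_eq_iff)
    then show "a k (i k) l * (\<Sum>j\<in>idx k d. (\<Prod>h<k. a h ((i(k := l)) h) (j h)) *
        Y (override_on (i(k := l)) j {..<k})) =
      (\<Sum>j\<in>idx k d. (\<Prod>h<Suc k. a h (i h) ((j(k := l)) h)) * Y (override_on i (j(k := l)) {..<Suc k}))"
      by (simp add: sum_distrib_left mult_ac)
  qed
  also have "\<dots> = (\<Sum>j\<in>idx k d. \<Sum>l<d k. (\<Prod>h<Suc k. a h (i h) ((j(k := l)) h)) *
      Y (override_on i (j(k := l)) {..<Suc k}))"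
    by (rule sum.swap)
  also have "\<dots> = (\<Sum>j\<in>idx (Suc k) d. (\<Prod>h<Suc k. a h (i h) (j h)) * Y (override_on i j {..<Suc k}))"
    unfolding idx_def lessThan_Suc by (subst sum_PiE_insert) auto
  finally show ?case .
qed

lemma multi_prod_eq:
  assumes "i \<in> all_idx K"
  shows "multi_prod K d a Y i = (\<Sum>j\<in>idx K d. (\<Prod>h<K. a h (i h) (j h)) * Y j)"
proof -
  have "override_on i j {..<K} = j" if "j \<in> idx K d" for j
    using assms that by (auto simp: override_on_def fun_eq_iff idx_def all_idx_def PiE_iff extensional_def)
  then show ?thesis unfolding multi_prod_override by (intro sum.cong) auto
qed

section \<open>Kronecker products, mode by mode\<close>

lemma kron_desc_index:
  assumes "\<And>h. h < K \<Longrightarrow> A h \<in> carrier_mat (p h) (r h)"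
  shows "kron_desc A K \<in> carrier_mat (\<Prod>h<K. p h) (\<Prod>h<K. r h)"
    "\<And>i j. i \<in> idx K p \<Longrightarrow> j \<in> idx K r \<Longrightarrow>
      kron_desc A K $$ (lin {..<K} p i, lin {..<K} r j) = (\<Prod>h<K. A h $$ (i h, j h))"
proof -
  \<comment> \<open>For the induction the indices are only bounded below K, not extensional, so that
    the same \<open>i\<close> and \<open>j\<close> serve every prefix of the modes.\<close>
  have "kron_desc A K \<in> carrier_mat (\<Prod>h<K. p h) (\<Prod>h<K. r h) \<and>
    (\<forall>i j. (\<forall>h<K. i h < p h) \<longrightarrow> (\<forall>h<K. j h < r h) \<longrightarrow>
      kron_desc A K $$ (lin {..<K} p i, lin {..<K} r j) = (\<Prod>h<K. A h $$ (i h, j h)))"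
    using assms
  proof (induction K)
    case 0
    then show ?case by (simp add: lin_def)
  next
    case (Suc k)
    let ?B = "kron_desc A k"
    have B: "?B \<in> carrier_mat (\<Prod>h<k. p h) (\<Prod>h<k. r h)"
      and IH: "\<And>i j. (\<forall>h<k. i h < p h) \<Longrightarrow> (\<forall>h<k. j h < r h) \<Longrightarrow>
        ?B $$ (lin {..<k} p i, lin {..<k} r j) = (\<Prod>h<k. A h $$ (i h, j h))"
      using Suc by auto
    have Ak: "A k \<in> carrier_mat (p k) (r k)" using Suc by simp
    have 1: "kron_desc A (Suc k) \<in> carrier_mat (\<Prod>h<Suc k. p h) (\<Prod>h<Suc k. r h)"
      using B Ak by (simp add: kron_def mult.commute)
    have "kron_desc A (Suc k) $$ (lin {..<Suc k} p i, lin {..<Suc k} r j) = (\<Prod>h<Suc k. A h $$ (i h, j h))"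
      if i: "\<forall>h<Suc k. i h < p h" and j: "\<forall>h<Suc k. j h < r h" for i j
    proof -
      have l: "lin {..<k} p i < (\<Prod>h<k. p h)" "lin {..<k} r j < (\<Prod>h<k. r h)"
        using lin_digits(1)[of "{..<k}" i p] lin_digits(1)[of "{..<k}" j r] i j by auto
      have b: "lin {..<Suc k} p i < (\<Prod>h<Suc k. p h)" "lin {..<Suc k} r j < (\<Prod>h<Suc k. r h)"
        using lin_digits(1)[of "{..<Suc k}" i p] lin_digits(1)[of "{..<Suc k}" j r] i j by auto
      have e: "lin {..<Suc k} p i = lin {..<k} p i + i k * (\<Prod>h<k. p h)"
        "lin {..<Suc k} r j = lin {..<k} r j + j k * (\<Prod>h<k. r h)"
        unfolding lessThan_Suc by (auto intro!: lin_insert_max)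
      have aux: "(l + i * P) div P = i \<and> (l + i * P) mod P = l" if "l < P" for l i P :: nat
        using that by simp
      have dm: "(lin {..<k} p i + i k * (\<Prod>h<k. p h)) div (\<Prod>h<k. p h) = i k"
        "(lin {..<k} r j + j k * (\<Prod>h<k. r h)) div (\<Prod>h<k. r h) = j k"
        "(lin {..<k} p i + i k * (\<Prod>h<k. p h)) mod (\<Prod>h<k. p h) = lin {..<k} p i"
        "(lin {..<k} r j + j k * (\<Prod>h<k. r h)) mod (\<Prod>h<k. r h) = lin {..<k} r j"
        using aux[OF l(1)] aux[OF l(2)] by blast+
      have "kron_desc A (Suc k) $$ (lin {..<Suc k} p i, lin {..<Suc k} r j) =
          A k $$ (i k, j k) * ?B $$ (lin {..<k} p i, lin {..<k} r j)"
        using B Ak b l by (simp add: kron_def e dm mult.commute)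
      also have "\<dots> = (\<Prod>h<Suc k. A h $$ (i h, j h))"
        using IH[of i j] i j by (simp add: mult.commute)
      finally show ?thesis .
    qed
    with 1 show ?case by blast
  qed
  then show "kron_desc A K \<in> carrier_mat (\<Prod>h<K. p h) (\<Prod>h<K. r h)"
    "\<And>i j. i \<in> idx K p \<Longrightarrow> j \<in> idx K r \<Longrightarrow>
      kron_desc A K $$ (lin {..<K} p i, lin {..<K} r j) = (\<Prod>h<K. A h $$ (i h, j h))"
    by (auto simp: idx_def PiE_iff)
qed

text \<open>Entries are products over the modes, so the sum of squares factors. This will bound the
  Kronecker product of the test matrices independently of the dimensions.\<close>

lemma kron_desc_frobenius:
  assumes A: "\<And>h. h < K \<Longrightarrow> A h \<in> carrier_mat (p h) (r h)"
  shows "(\<Sum>i<(\<Prod>h<K. p h). \<Sum>j<(\<Prod>h<K. r h). (kron_desc A K $$ (i, j))\<^sup>2) =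
    (\<Prod>h<K. \<Sum>i<p h. \<Sum>j<r h. (A h $$ (i, j))\<^sup>2)"
proof -
  have "(\<Sum>i<(\<Prod>h<K. p h). \<Sum>j<(\<Prod>h<K. r h). (kron_desc A K $$ (i, j))\<^sup>2) =
      (\<Sum>i\<in>idx K p. \<Sum>j\<in>idx K r. (kron_desc A K $$ (lin {..<K} p i, lin {..<K} r j))\<^sup>2)"
    by (simp add: sum_lin idx_def)
  also have "\<dots> = (\<Sum>i\<in>idx K p. \<Sum>j\<in>idx K r. \<Prod>h<K. (A h $$ (i h, j h))\<^sup>2)"
    by (intro sum.cong refl) (simp add: kron_desc_index(2)[OF A] prod_power_distrib)
  also have "\<dots> = (\<Sum>i\<in>idx K p. \<Prod>h<K. \<Sum>j<r h. (A h $$ (i h, j))\<^sup>2)"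
    unfolding idx_def by (rule sum.cong[OF refl], rule prod_sum_PiE[symmetric]) auto
  also have "\<dots> = (\<Prod>h<K. \<Sum>i<p h. \<Sum>j<r h. (A h $$ (i, j))\<^sup>2)"
    unfolding idx_def by (rule prod_sum_PiE[symmetric]) auto
  finally show ?thesis .
qed

text \<open>Lower bounds of the modes multiply: the induction hypothesis is applied to every slice
  in the new mode, and the bound of that mode to the vector of slices. The set of modes is arbitrary
  because mode \<open>k\<close> will be treated apart.\<close>

lemma tensor_product_lower_bound:
  fixes a :: "nat \<Rightarrow> nat \<Rightarrow> nat \<Rightarrow> real"
  assumes "finite I" "\<And>h. h \<in> I \<Longrightarrow> 0 \<le> \<kappa> h"
    "\<And>h z. h \<in> I \<Longrightarrow> \<kappa> h * (\<Sum>j<r h. (z j)\<^sup>2) \<le> (\<Sum>x<p h. (\<Sum>j<r h. a h x j * z j)\<^sup>2)"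
  shows "(\<Prod>h\<in>I. \<kappa> h) * (\<Sum>j\<in>PiE I (\<lambda>h. {..<r h}). (Y j)\<^sup>2) \<le>
    (\<Sum>x\<in>PiE I (\<lambda>h. {..<p h}). (\<Sum>j\<in>PiE I (\<lambda>h. {..<r h}). (\<Prod>h\<in>I. a h (x h) (j h)) * Y j)\<^sup>2)"
  using assms
proof (induction I arbitrary: Y)
  case empty
  then show ?case by simp
next
  case (insert k I)
  let ?R = "PiE I (\<lambda>h. {..<r h})" and ?P = "PiE I (\<lambda>h. {..<p h})"
  define W where "W x l = (\<Sum>j\<in>?R. (\<Prod>h\<in>I. a h (x h) (j h)) * Y (j(k := l)))" for x l
  have fin: "finite ?R" using insert.hyps by (intro finite_PiE) auto
  have \<kappa>: "0 \<le> \<kappa> k" "0 \<le> (\<Prod>h\<in>I. \<kappa> h)"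
    using insert.prems by (auto intro!: prod_nonneg)
  have "(\<Prod>h\<in>insert k I. \<kappa> h) * (\<Sum>j\<in>PiE (insert k I) (\<lambda>h. {..<r h}). (Y j)\<^sup>2) =
      \<kappa> k * (\<Sum>l<r k. (\<Prod>h\<in>I. \<kappa> h) * (\<Sum>j\<in>?R. (Y (j(k := l)))\<^sup>2))"
    using insert.hyps
    by (simp add: sum_PiE_insert sum.swap[of _ "{..<r k}" ?R] sum_distrib_left mult_ac)
  also have "\<dots> \<le> \<kappa> k * (\<Sum>l<r k. \<Sum>x\<in>?P. (W x l)\<^sup>2)"
    unfolding W_def
    by (intro mult_left_mono[OF _ \<kappa>(1)] sum_mono insert.IH) (use insert.prems in auto)
  also have "\<dots> = (\<Sum>x\<in>?P. \<kappa> k * (\<Sum>l<r k. (W x l)\<^sup>2))"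
    by (subst sum.swap) (simp add: sum_distrib_left)
  also have "\<dots> \<le> (\<Sum>x\<in>?P. \<Sum>x'<p k. (\<Sum>l<r k. a k x' l * W x l)\<^sup>2)"
    using insert.prems(2)[of k] by (intro sum_mono) auto
  also have "\<dots> = (\<Sum>x\<in>?P. \<Sum>x'<p k. (\<Sum>j\<in>PiE (insert k I) (\<lambda>h. {..<r h}).
      (\<Prod>h\<in>insert k I. a h ((x(k := x')) h) (j h)) * Y j)\<^sup>2)"
  proof (intro sum.cong refl, goal_cases)
    case (1 x x')
    have "(\<Sum>j\<in>PiE (insert k I) (\<lambda>h. {..<r h}). (\<Prod>h\<in>insert k I. a h ((x(k := x')) h) (j h)) * Y j) =
      (\<Sum>j\<in>?R. \<Sum>l<r k. (\<Prod>h\<in>insert k I. a h ((x(k := x')) h) ((j(k := l)) h)) * Y (j(k := l)))"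
      using insert.hyps by (simp add: sum_PiE_insert)
    also have "\<dots> = (\<Sum>j\<in>?R. \<Sum>l<r k. a k x' l * ((\<Prod>h\<in>I. a h (x h) (j h)) * Y (j(k := l))))"
    proof (intro sum.cong refl)
      fix j l
      have "(\<Prod>h\<in>I. a h ((x(k := x')) h) ((j(k := l)) h)) = (\<Prod>h\<in>I. a h (x h) (j h))"
        using insert.hyps by (intro prod.cong) auto
      then show "(\<Prod>h\<in>insert k I. a h ((x(k := x')) h) ((j(k := l)) h)) * Y (j(k := l)) =
          a k x' l * ((\<Prod>h\<in>I. a h (x h) (j h)) * Y (j(k := l)))"
        using insert.hyps by simp
    qed
    also have "\<dots> = (\<Sum>l<r k. a k x' l * W x l)"
      by (subst sum.swap) (simp add: W_def sum_distrib_left)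
    finally show ?case by simp
  qed
  also have "\<dots> = (\<Sum>x\<in>PiE (insert k I) (\<lambda>h. {..<p h}). (\<Sum>j\<in>PiE (insert k I) (\<lambda>h. {..<r h}).
      (\<Prod>h\<in>insert k I. a h (x h) (j h)) * Y j)\<^sup>2)"
    by (subst sum_PiE_insert[OF insert.hyps(2), where B = "\<lambda>h. {..<p h}"]) (rule refl)
  finally show ?case .
qed

section \<open>Second moments\<close>

text \<open>The constant bounds the L^2 norm, not the second moment, so that constants add and scale
  as in the triangle inequality.\<close>

definition L2le :: "'w measure \<Rightarrow> real \<Rightarrow> ('w \<Rightarrow> real) \<Rightarrow> bool" where
  "L2le P c Y \<longleftrightarrow> 0 \<le> c \<and> Y \<in> borel_measurable P \<and> integrable P (\<lambda>\<omega>. (Y \<omega>)\<^sup>2) \<and>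
     (\<integral>\<omega>. (Y \<omega>)\<^sup>2 \<partial>P) \<le> c\<^sup>2"

lemma L2leD:
  assumes "L2le P c Y"
  shows "0 \<le> c" "Y \<in> borel_measurable P" "integrable P (\<lambda>\<omega>. (Y \<omega>)\<^sup>2)" "(\<integral>\<omega>. (Y \<omega>)\<^sup>2 \<partial>P) \<le> c\<^sup>2"
  using assms by (auto simp: L2le_def)

lemma L2le_mono: "L2le P c Y \<Longrightarrow> c \<le> d \<Longrightarrow> L2le P d Y"
  unfolding L2le_def by (auto intro: order_trans power_mono)

lemma L2le_cong: "L2le P c Y \<Longrightarrow> (\<And>\<omega>. \<omega> \<in> space P \<Longrightarrow> Y \<omega> = Z \<omega>) \<Longrightarrow> L2le P c Z"
  unfolding L2le_def
  by (metis (no_types, lifting) Bochner_Integration.integrable_cong Bochner_Integration.integral_cong measurable_cong)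

lemma L2le_cmult:
  assumes "L2le P c Y"
  shows "L2le P (\<bar>k\<bar> * c) (\<lambda>\<omega>. k * Y \<omega>)"
  using assms unfolding L2le_def
  by (auto simp: power_mult_distrib mult_left_mono)

lemma integrable_mult_of_squares:
  fixes Y Z :: "'w \<Rightarrow> real"
  assumes "Y \<in> borel_measurable P" "Z \<in> borel_measurable P"
    "integrable P (\<lambda>\<omega>. (Y \<omega>)\<^sup>2)" "integrable P (\<lambda>\<omega>. (Z \<omega>)\<^sup>2)"
  shows "integrable P (\<lambda>\<omega>. Y \<omega> * Z \<omega>)"
proof (rule Bochner_Integration.integrable_bound)
  show "integrable P (\<lambda>\<omega>. (Y \<omega>)\<^sup>2 + (Z \<omega>)\<^sup>2)"
    using assms by auto
  show "AE \<omega> in P. norm (Y \<omega> * Z \<omega>) \<le> norm ((Y \<omega>)\<^sup>2 + (Z \<omega>)\<^sup>2)"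
  proof (rule AE_I2)
    fix \<omega>
    have "2 * (\<bar>Y \<omega>\<bar> * \<bar>Z \<omega>\<bar>) \<le> (Y \<omega>)\<^sup>2 + (Z \<omega>)\<^sup>2"
      using sum_squares_bound[of "\<bar>Y \<omega>\<bar>" "\<bar>Z \<omega>\<bar>"] by simp
    moreover have "0 \<le> \<bar>Y \<omega>\<bar> * \<bar>Z \<omega>\<bar>" by simp
    ultimately have "\<bar>Y \<omega>\<bar> * \<bar>Z \<omega>\<bar> \<le> (Y \<omega>)\<^sup>2 + (Z \<omega>)\<^sup>2" by linarith
    then show "norm (Y \<omega> * Z \<omega>) \<le> norm ((Y \<omega>)\<^sup>2 + (Z \<omega>)\<^sup>2)"
      by (simp add: abs_mult)
  qed
qed (use assms in measurable)

lemma L2le_mult: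
  assumes Y: "L2le P c Y" and Z: "L2le P d Z"
  shows "integrable P (\<lambda>\<omega>. Y \<omega> * Z \<omega>)" "(\<integral>\<omega>. \<bar>Y \<omega> * Z \<omega>\<bar> \<partial>P) \<le> c * d"
proof -
  note y = L2leD[OF Y] and z = L2leD[OF Z]
  show int: "integrable P (\<lambda>\<omega>. Y \<omega> * Z \<omega>)"
    using y z by (intro integrable_mult_of_squares)
  \<comment> \<open>Weighted arithmetic-geometric mean with strictly larger constants, so that
    division is safe when \<open>c\<close> or \<open>d\<close> is 0; the constants are lowered to
    the limit afterwards.\<close>
  have le: "(\<integral>\<omega>. \<bar>Y \<omega> * Z \<omega>\<bar> \<partial>P) \<le> c' * d'" if "c < c'" "d < d'" for c' d'
  proof -
    have pos: "0 < c'" "0 < d'" using that y(1) z(1) by auto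
    have "(\<integral>\<omega>. \<bar>Y \<omega> * Z \<omega>\<bar> \<partial>P) \<le> (\<integral>\<omega>. (d' / c' * (Y \<omega>)\<^sup>2 + c' / d' * (Z \<omega>)\<^sup>2) / 2 \<partial>P)"
    proof (rule integral_mono)
      fix \<omega>
      have "2 * (d' * \<bar>Y \<omega>\<bar>) * (c' * \<bar>Z \<omega>\<bar>) \<le> (d' * \<bar>Y \<omega>\<bar>)\<^sup>2 + (c' * \<bar>Z \<omega>\<bar>)\<^sup>2"
        by (rule sum_squares_bound)
      then have "\<bar>Y \<omega> * Z \<omega>\<bar> \<le> ((d' * \<bar>Y \<omega>\<bar>)\<^sup>2 + (c' * \<bar>Z \<omega>\<bar>)\<^sup>2) / (2 * (c' * d'))"
        using pos by (simp add: abs_mult pos_le_divide_eq mult_ac)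
      also have "\<dots> = (d' / c' * (Y \<omega>)\<^sup>2 + c' / d' * (Z \<omega>)\<^sup>2) / 2"
        using pos by (simp add: power_mult_distrib power2_eq_square field_simps)
      finally show "\<bar>Y \<omega> * Z \<omega>\<bar> \<le> (d' / c' * (Y \<omega>)\<^sup>2 + c' / d' * (Z \<omega>)\<^sup>2) / 2" .
    qed (use int y z in auto)
    also have "\<dots> = (d' / c' * (\<integral>\<omega>. (Y \<omega>)\<^sup>2 \<partial>P) + c' / d' * (\<integral>\<omega>. (Z \<omega>)\<^sup>2 \<partial>P)) / 2"
      using y z by simp
    also have "\<dots> \<le> (d' / c' * c'\<^sup>2 + c' / d' * d'\<^sup>2) / 2"
    proof -
      have "(\<integral>\<omega>. (Y \<omega>)\<^sup>2 \<partial>P) \<le> c'\<^sup>2" "(\<integral>\<omega>. (Z \<omega>)\<^sup>2 \<partial>P) \<le> d'\<^sup>2"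
        using y(1,4) z(1,4) that power_mono[of c c' 2] power_mono[of d d' 2] by linarith+
      then show ?thesis using pos
        by (intro divide_right_mono add_mono mult_left_mono) auto
    qed
    also have "\<dots> = c' * d'"
      using pos by (simp add: power2_eq_square field_simps)
    finally show ?thesis .
  qed
  have "((\<lambda>e. (c + e) * (d + e)) \<longlongrightarrow> (c + 0) * (d + 0)) (at_right 0)"
    by (intro tendsto_intros)
  then have "(\<integral>\<omega>. \<bar>Y \<omega> * Z \<omega>\<bar> \<partial>P) \<le> (c + 0) * (d + 0)"
  proof (rule tendsto_lowerbound)
    show "\<forall>\<^sub>F e in at_right 0. (\<integral>\<omega>. \<bar>Y \<omega> * Z \<omega>\<bar> \<partial>P) \<le> (c + e) * (d + e)"
      using eventually_at_right_less[of "0 :: real"] by eventually_elim (rule le, auto)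
  qed simp
  then show "(\<integral>\<omega>. \<bar>Y \<omega> * Z \<omega>\<bar> \<partial>P) \<le> c * d" by simp
qed

lemma L2le_add:
  assumes Y: "L2le P c Y" and Z: "L2le P d Z"
  shows "L2le P (c + d) (\<lambda>\<omega>. Y \<omega> + Z \<omega>)"
proof -
  note y = L2leD[OF Y] and z = L2leD[OF Z]
  note int = L2le_mult(1)[OF Y Z]
  have eq: "(Y \<omega> + Z \<omega>)\<^sup>2 = (Y \<omega>)\<^sup>2 + (2 * (Y \<omega> * Z \<omega>) + (Z \<omega>)\<^sup>2)" for \<omega>
    by (simp add: power2_sum)
  have "(\<integral>\<omega>. Y \<omega> * Z \<omega> \<partial>P) \<le> (\<integral>\<omega>. \<bar>Y \<omega> * Z \<omega>\<bar> \<partial>P)"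
    using int by (intro integral_mono) auto
  then have "(\<integral>\<omega>. Y \<omega> * Z \<omega> \<partial>P) \<le> c * d"
    using L2le_mult(2)[OF Y Z] by linarith
  moreover have "(\<integral>\<omega>. (Y \<omega> + Z \<omega>)\<^sup>2 \<partial>P) =
      (\<integral>\<omega>. (Y \<omega>)\<^sup>2 \<partial>P) + (2 * (\<integral>\<omega>. Y \<omega> * Z \<omega> \<partial>P) + (\<integral>\<omega>. (Z \<omega>)\<^sup>2 \<partial>P))"
    unfolding eq using y z int by simp
  ultimately have "(\<integral>\<omega>. (Y \<omega> + Z \<omega>)\<^sup>2 \<partial>P) \<le> (c + d)\<^sup>2"
    using y(4) z(4) by (simp add: power2_sum)
  moreover have "integrable P (\<lambda>\<omega>. (Y \<omega> + Z \<omega>)\<^sup>2)"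
    unfolding eq using y z int by simp
  ultimately show ?thesis
    using y z by (simp add: L2le_def)
qed

lemma L2le_zero: "L2le P 0 (\<lambda>_. 0)"
  by (simp add: L2le_def)

lemma L2le_sum:
  assumes "finite I" "\<And>i. i \<in> I \<Longrightarrow> L2le P (c i) (Y i)"
  shows "L2le P (\<Sum>i\<in>I. c i) (\<lambda>\<omega>. \<Sum>i\<in>I. Y i \<omega>)"
  using assms by (induction I) (auto intro: L2le_zero L2le_add)

lemma L2le_weighted_sum:
  assumes "finite I" "\<And>i. i \<in> I \<Longrightarrow> L2le P c (Y i)" "0 \<le> c" "(\<Sum>i\<in>I. \<bar>w i\<bar>) \<le> W"
  shows "L2le P (W * c) (\<lambda>\<omega>. \<Sum>i\<in>I. w i * Y i \<omega>)"
proof -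
  have "L2le P (\<Sum>i\<in>I. \<bar>w i\<bar> * c) (\<lambda>\<omega>. \<Sum>i\<in>I. w i * Y i \<omega>)"
    using assms by (intro L2le_sum L2le_cmult)
  moreover have "(\<Sum>i\<in>I. \<bar>w i\<bar> * c) \<le> W * c"
    using assms by (simp add: sum_distrib_right[symmetric] mult_right_mono)
  ultimately show ?thesis by (rule L2le_mono)
qed

text \<open>Fatou's lemma along an almost surely convergent subsequence.\<close>

lemma L2le_L1_limit:
  assumes Y: "\<And>q. L2le P c (Y q)" and Z: "Z \<in> borel_measurable P"
    and int: "\<And>q. integrable P (\<lambda>\<omega>. Y q \<omega> - Z \<omega>)"
    and lim: "(\<lambda>q. \<integral>\<omega>. \<bar>Y q \<omega> - Z \<omega>\<bar> \<partial>P) \<longlonglongrightarrow> 0"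
  shows "L2le P c Z"
proof -
  note y = L2leD[OF Y]
  obtain s where "strict_mono s" and ae: "AE \<omega> in P. (\<lambda>n. Y (s n) \<omega> - Z \<omega>) \<longlonglongrightarrow> 0"
    using tendsto_L1_AE_subseq[of P "\<lambda>q \<omega>. Y q \<omega> - Z \<omega>"] int lim by auto
  have "(\<integral>\<^sup>+\<omega>. ennreal ((Z \<omega>)\<^sup>2) \<partial>P) = (\<integral>\<^sup>+\<omega>. liminf (\<lambda>n. ennreal ((Y (s n) \<omega>)\<^sup>2)) \<partial>P)"
  proof (rule nn_integral_cong_AE, use ae in eventually_elim)
    case (elim \<omega>)
    then have "(\<lambda>n. Y (s n) \<omega>) \<longlonglongrightarrow> Z \<omega>"
      using Lim_null by blast
    then have "(\<lambda>n. ennreal ((Y (s n) \<omega>)\<^sup>2)) \<longlonglongrightarrow> ennreal ((Z \<omega>)\<^sup>2)"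
      by (intro tendsto_ennrealI tendsto_intros)
    from lim_imp_Liminf[OF trivial_limit_sequentially this] show ?case by simp
  qed
  also have "\<dots> \<le> liminf (\<lambda>n. \<integral>\<^sup>+\<omega>. ennreal ((Y (s n) \<omega>)\<^sup>2) \<partial>P)"
    using y by (intro nn_integral_liminf) measurable
  also have "\<dots> \<le> liminf (\<lambda>n. ennreal (c\<^sup>2))"
  proof (intro Liminf_mono always_eventually allI)
    fix n
    show "(\<integral>\<^sup>+\<omega>. ennreal ((Y (s n) \<omega>)\<^sup>2) \<partial>P) \<le> ennreal (c\<^sup>2)"
      using y by (subst nn_integral_eq_integral) (auto intro!: ennreal_leI)
  qed
  also have "\<dots> = ennreal (c\<^sup>2)"
    by (simp add: Liminf_const)
  finally have le: "(\<integral>\<^sup>+\<omega>. ennreal ((Z \<omega>)\<^sup>2) \<partial>P) \<le> ennreal (c\<^sup>2)" .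
  have "integrable P (\<lambda>\<omega>. (Z \<omega>)\<^sup>2)"
  proof (rule integrableI_bounded)
    show "(\<integral>\<^sup>+\<omega>. ennreal (norm ((Z \<omega>)\<^sup>2)) \<partial>P) < \<infinity>"
      using le by (simp add: le_less_trans)
  qed (use Z in measurable)
  moreover have "(\<integral>\<omega>. (Z \<omega>)\<^sup>2 \<partial>P) \<le> c\<^sup>2"
  proof -
    have "(\<integral>\<omega>. (Z \<omega>)\<^sup>2 \<partial>P) = enn2real (\<integral>\<^sup>+\<omega>. ennreal ((Z \<omega>)\<^sup>2) \<partial>P)"
      using Z by (intro integral_eq_nn_integral) auto
    also have "\<dots> \<le> enn2real (ennreal (c\<^sup>2))"
      using le by (intro enn2real_mono) auto
    finally show ?thesis by simp
  qed
  ultimately show ?thesis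
    using Z y(1) by (simp add: L2le_def)
qed

section \<open>Fourth moments, and averages of products\<close>

definition L4 :: "'w measure \<Rightarrow> ('w \<Rightarrow> real) \<Rightarrow> bool" where
  "L4 P Y \<longleftrightarrow> Y \<in> borel_measurable P \<and> integrable P (\<lambda>\<omega>. Y \<omega> ^ 4)"

lemma (in prob_space) L4_L2:
  assumes "L4 M Y" "expectation (\<lambda>\<omega>. Y \<omega> ^ 4) \<le> c"
  shows "L2le M (sqrt (1 + c)) Y"
proof -
  have Y: "Y \<in> borel_measurable M" "integrable M (\<lambda>\<omega>. Y \<omega> ^ 4)"
    using assms by (auto simp: L4_def)
  have le: "(Y \<omega>)\<^sup>2 \<le> 1 + Y \<omega> ^ 4" for \<omega>
  proof -
    have "(Y \<omega>)\<^sup>2 * 2 \<le> 1 + ((Y \<omega>)\<^sup>2)\<^sup>2"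
      using sum_squares_bound[of "(Y \<omega>)\<^sup>2" 1] by simp
    moreover have "((Y \<omega>)\<^sup>2)\<^sup>2 = Y \<omega> ^ 4" by (simp flip: power_mult)
    moreover have "0 \<le> (Y \<omega>)\<^sup>2" by simp
    ultimately show ?thesis by linarith
  qed
  have int: "integrable M (\<lambda>\<omega>. (Y \<omega>)\<^sup>2)"
  proof (rule Bochner_Integration.integrable_bound)
    show "integrable M (\<lambda>\<omega>. 1 + Y \<omega> ^ 4)" using Y by simp
    show "AE \<omega> in M. norm ((Y \<omega>)\<^sup>2) \<le> norm (1 + Y \<omega> ^ 4)"
      using le by (intro AE_I2) (simp add: order_trans[OF _ abs_ge_self])
  qed (use Y in measurable)
  have "expectation (\<lambda>\<omega>. (Y \<omega>)\<^sup>2) \<le> expectation (\<lambda>\<omega>. 1 + Y \<omega> ^ 4)"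
    using int Y le by (intro integral_mono) auto
  also have "\<dots> \<le> 1 + c"
    using Y assms(2) by (simp add: prob_space)
  finally have "expectation (\<lambda>\<omega>. (Y \<omega>)\<^sup>2) \<le> 1 + c" .
  moreover have "0 \<le> expectation (\<lambda>\<omega>. (Y \<omega>)\<^sup>2)"
    by (intro integral_nonneg_AE) auto
  moreover from calculation have "0 \<le> 1 + c" by linarith
  ultimately show ?thesis
    using Y int by (simp add: L2le_def)
qed

lemma L4_cong: "L4 P Y \<Longrightarrow> (\<And>\<omega>. \<omega> \<in> space P \<Longrightarrow> Y \<omega> = Z \<omega>) \<Longrightarrow> L4 P Z"
  unfolding L4_def
  by (metis (no_types, lifting) Bochner_Integration.integrable_cong measurable_cong)

lemma L4_add:
  assumes "L4 P Y" "L4 P Z"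
  shows "L4 P (\<lambda>\<omega>. Y \<omega> + Z \<omega>)"
proof -
  have Y: "Y \<in> borel_measurable P" "integrable P (\<lambda>\<omega>. Y \<omega> ^ 4)"
    and Z: "Z \<in> borel_measurable P" "integrable P (\<lambda>\<omega>. Z \<omega> ^ 4)"
    using assms by (auto simp: L4_def)
  have "integrable P (\<lambda>\<omega>. (Y \<omega> + Z \<omega>) ^ 4)"
  proof (rule Bochner_Integration.integrable_bound)
    show "integrable P (\<lambda>\<omega>. 8 * (Y \<omega> ^ 4 + Z \<omega> ^ 4))"
      using Y Z by auto
    show "AE \<omega> in P. norm ((Y \<omega> + Z \<omega>) ^ 4) \<le> norm (8 * (Y \<omega> ^ 4 + Z \<omega> ^ 4))"
    proof (rule AE_I2)
      fix \<omega>
      have sq: "(y + z)\<^sup>2 \<le> 2 * (y\<^sup>2 + z\<^sup>2)" for y z :: real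
        using sum_squares_bound[of y z] by (simp add: power2_sum)
      have "((Y \<omega> + Z \<omega>)\<^sup>2)\<^sup>2 \<le> (2 * ((Y \<omega>)\<^sup>2 + (Z \<omega>)\<^sup>2))\<^sup>2"
        using sq by (intro power_mono) auto
      also have "\<dots> = 4 * ((Y \<omega>)\<^sup>2 + (Z \<omega>)\<^sup>2)\<^sup>2"
        by (simp only: power_mult_distrib) simp
      also have "\<dots> \<le> 4 * (2 * (((Y \<omega>)\<^sup>2)\<^sup>2 + ((Z \<omega>)\<^sup>2)\<^sup>2))"
        by (intro mult_left_mono sq) auto
      finally have "(Y \<omega> + Z \<omega>) ^ 4 \<le> 8 * (Y \<omega> ^ 4 + Z \<omega> ^ 4)"
        by (simp flip: power_mult)
      then show "norm ((Y \<omega> + Z \<omega>) ^ 4) \<le> norm (8 * (Y \<omega> ^ 4 + Z \<omega> ^ 4))"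
        by simp
    qed
  qed (use Y Z in measurable)
  then show ?thesis using Y Z by (simp add: L4_def)
qed

lemma L4_cmult: "L4 P Y \<Longrightarrow> L4 P (\<lambda>\<omega>. k * Y \<omega>)"
  by (auto simp: L4_def power_mult_distrib)

lemma L4_sum: "finite I \<Longrightarrow> (\<And>i. i \<in> I \<Longrightarrow> L4 P (Y i)) \<Longrightarrow> L4 P (\<lambda>\<omega>. \<Sum>i\<in>I. Y i \<omega>)"
  by (induction I rule: finite_induct) (simp add: L4_def, simp add: L4_add)

lemma L4_mult:
  assumes "L4 P Y" "L4 P Z"
  shows "(\<lambda>\<omega>. Y \<omega> * Z \<omega>) \<in> borel_measurable P" "integrable P (\<lambda>\<omega>. (Y \<omega> * Z \<omega>)\<^sup>2)"
proof -
  have Y: "Y \<in> borel_measurable P" "integrable P (\<lambda>\<omega>. ((Y \<omega>)\<^sup>2)\<^sup>2)"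
    and Z: "Z \<in> borel_measurable P" "integrable P (\<lambda>\<omega>. ((Z \<omega>)\<^sup>2)\<^sup>2)"
    using assms by (auto simp: L4_def simp flip: power_mult)
  show "(\<lambda>\<omega>. Y \<omega> * Z \<omega>) \<in> borel_measurable P" using Y Z by simp
  show "integrable P (\<lambda>\<omega>. (Y \<omega> * Z \<omega>)\<^sup>2)"
    unfolding power_mult_distrib using Y Z by (intro integrable_mult_of_squares) auto
qed

context prob_space
begin

lemma L4_mult_L2:
  assumes "L4 M Y" "L4 M Z"
  shows "\<exists>c. L2le M c (\<lambda>\<omega>. Y \<omega> * Z \<omega>)"
  using L4_mult[OF assms]
  by (intro exI[of _ "sqrt (expectation (\<lambda>\<omega>. (Y \<omega> * Z \<omega>)\<^sup>2))"]) (simp add: L2le_def integral_nonneg_AE)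

lemma L2le_integrable: "L2le M c Y \<Longrightarrow> integrable M Y"
  using L2le_mult(1)[of M c Y 1 "\<lambda>_. 1"] by (simp add: L2le_def prob_space)

lemma L2le_const: "L2le M \<bar>k\<bar> (\<lambda>_. k)"
  by (simp add: L2le_def prob_space)

text \<open>The origin of the rate: \<open>product_var_le\<close> bounds the variance of the sum
  scaled by T^(-1/2), and the remaining factor T^(-1/2) turns this into a bound on the centred
  average.\<close>

lemma avg_product_L2le:
  assumes Y: "\<And>t. L4 M (Y t i)" and Z: "\<And>t. L4 M (Z t j)"
    and var: "product_var_le M c I Y J Z" and ij: "i \<in> I" "j \<in> J" and T: "1 \<le> T"
  shows "L2le M (sqrt c / sqrt (real T))
    (\<lambda>\<omega>. (1 / real T) * (\<Sum>t<T. Y t i \<omega> * Z t j \<omega> - expectation (\<lambda>\<omega>. Y t i \<omega> * Z t j \<omega>)))"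
proof -
  define W where "W \<omega> = (1 / sqrt (real T)) * (\<Sum>t<T. Y t i \<omega> * Z t j \<omega>)" for \<omega>
  have "\<exists>d. \<forall>t. L2le M (d t) (\<lambda>\<omega>. Y t i \<omega> * Z t j \<omega>)"
    by (intro choice allI L4_mult_L2 Y Z)
  then obtain d where d: "\<And>t. L2le M (d t) (\<lambda>\<omega>. Y t i \<omega> * Z t j \<omega>)" by blast
  have W: "L2le M (\<bar>1 / sqrt (real T)\<bar> * (\<Sum>t<T. d t)) W"
    unfolding W_def by (intro L2le_cmult L2le_sum d) auto
  define k where "k = expectation W"
  have WK: "L2le M (\<bar>1 / sqrt (real T)\<bar> * (\<Sum>t<T. d t) + \<bar>- k\<bar>) (\<lambda>\<omega>. W \<omega> + - k)"
    by (intro L2le_add W L2le_const)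
  \<comment> \<open>The covariance of \<open>W\<close> with itself is its variance; being
    nonnegative, it also shows 0 <= c.\<close>
  have "\<bar>cov M W W\<bar> \<le> c"
    using var ij T unfolding product_var_le_def W_def by blast
  then have le: "expectation (\<lambda>\<omega>. (W \<omega> + - k)\<^sup>2) \<le> c"
    by (simp add: cov_def k_def power2_eq_square)
  moreover have "0 \<le> expectation (\<lambda>\<omega>. (W \<omega> + - k)\<^sup>2)"
    by (intro integral_nonneg_AE) auto
  ultimately have c: "0 \<le> c" by linarith
  have "L2le M (sqrt c) (\<lambda>\<omega>. W \<omega> + - k)"
    using L2leD(2,3)[OF WK] le c by (simp add: L2le_def)
  then have "L2le M (\<bar>1 / sqrt (real T)\<bar> * sqrt c) (\<lambda>\<omega>. 1 / sqrt (real T) * (W \<omega> + - k))"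
    by (rule L2le_cmult)
  moreover have "1 / sqrt (real T) * (W \<omega> + - k) =
    (1 / real T) * (\<Sum>t<T. Y t i \<omega> * Z t j \<omega> - expectation (\<lambda>\<omega>. Y t i \<omega> * Z t j \<omega>))" for \<omega>
  proof -
    have k: "k = 1 / sqrt (real T) * (\<Sum>t<T. expectation (\<lambda>\<omega>. Y t i \<omega> * Z t j \<omega>))"
      unfolding k_def W_def using d[THEN L2le_integrable] by simp
    then show ?thesis
      unfolding W_def sum_subtractf by (simp add: diff_divide_distrib[symmetric])
  qed
  ultimately show ?thesis by simp
qed

end

section \<open>Moments in the factor model\<close>

lemma mode_mat_index:
  assumes "i < d k" "c < (\<Prod>h\<in>{..<K} - {k}. d h)"
  shows "mode_mat K d k Y $$ (i, c) = Y ((digits ({..<K} - {k}) d c)(k := i))"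
  using assms by (simp add: mode_mat_def)

lemma idx_less: "j \<in> idx K d \<Longrightarrow> h < K \<Longrightarrow> j h < d h"
  by (auto simp: idx_def PiE_iff)

locale factor_model =
  fixes P :: "'w measure" and M :: nat and K :: "nat \<Rightarrow> nat" and r u :: dims and a b :: loadings
    and G F E X :: "'w process"
  assumes model: "tensor_factor_model P M K r u a b G F E X"
    and identification: "identification_condition P M K r u G F"
    and loading: "loading_condition M K r u a b"
    and core_factor: "core_factor_condition P M K r u G F"
    and noise: "noise_condition P M K E"
    and cross_thread: "cross_thread_condition P M K r u G F E X"
begin

sublocale prob_space P
  using model by (simp add: tensor_factor_model_def)

lemma K_pos: "m < M \<Longrightarrow> 1 \<le> K m"
  using model by (simp add: tensor_factor_model_def)

lemma r_pos: "m < M \<Longrightarrow> h < K m \<Longrightarrow> 1 \<le> r m h"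
  using model by (simp add: tensor_factor_model_def)

text \<open>Global and local factors of a thread, with their loadings, are treated as one family.\<close>

definition facs :: "nat \<Rightarrow> (midx + midx) set" where
  "facs m = idx (K m) (r m) <+> idx (K m) (u m)"

definition fac :: "nat \<Rightarrow> nat \<Rightarrow> midx + midx \<Rightarrow> 'w \<Rightarrow> real" where
  "fac m t \<phi> = (case \<phi> of Inl j \<Rightarrow> G m t j | Inr j \<Rightarrow> F m t j)"

definition coef :: "nat \<Rightarrow> midx \<Rightarrow> midx + midx \<Rightarrow> real" where
  "coef m i \<phi> = (case \<phi> of Inl j \<Rightarrow> \<Prod>h<K m. a m h (i h) (j h) | Inr j \<Rightarrow> \<Prod>h<K m. b m h (i h) (j h))"

text \<open>The entries of the joint matrix (A, B) of the loading condition. Its near orthonormality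
  covers products of global with local loadings too, which is what separates the two kinds of
  factors.\<close>

definition ab :: "nat \<Rightarrow> nat \<Rightarrow> nat \<Rightarrow> nat \<Rightarrow> real" where
  "ab m h i j = (if j < r m h then a m h i j else b m h i (j - r m h))"

definition col_of :: "nat \<Rightarrow> midx + midx \<Rightarrow> nat \<Rightarrow> nat" where
  "col_of m \<phi> h = (case \<phi> of Inl j \<Rightarrow> j h | Inr j \<Rightarrow> r m h + j h)"

lemma finite_facs [simp]: "finite (facs m)"
  by (simp add: facs_def)

lemma facsE:
  assumes "\<phi> \<in> facs m"
  obtains j where "\<phi> = Inl j" "j \<in> idx (K m) (r m)" | j where "\<phi> = Inr j" "j \<in> idx (K m) (u m)"
  using assms by (auto simp: facs_def)

lemma col_of_less:
  assumes "\<phi> \<in> facs m" "h < K m"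
  shows "col_of m \<phi> h < r m h + u m h"
  using assms(1)
proof (cases rule: facsE)
  case (1 j)
  then show ?thesis using idx_less[OF 1(2) assms(2)] by (simp add: col_of_def)
next
  case (2 j)
  then show ?thesis using idx_less[OF 2(2) assms(2)] by (simp add: col_of_def)
qed

lemma coef_eq:
  assumes "\<phi> \<in> facs m"
  shows "coef m i \<phi> = (\<Prod>h<K m. ab m h (i h) (col_of m \<phi> h))"
  using assms
proof (cases rule: facsE)
  case (1 j)
  show ?thesis
    unfolding 1(1) coef_def col_of_def ab_def sum.case
    by (rule prod.cong[OF refl]) (use idx_less[OF 1(2)] in simp)
next
  case (2 j)
  show ?thesis
    unfolding 2(1) coef_def col_of_def ab_def sum.case by simp
qed

text \<open>A global and a local factor already differ in mode 0, where one column lies below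
  \<open>r m 0\<close> and the other does not; hence the appeal to \<open>K_pos\<close>. Factors of
  the same kind agree by extensionality.\<close>

lemma col_of_inj:
  assumes m: "m < M" and \<phi>: "\<phi> \<in> facs m" "\<phi>' \<in> facs m"
    and eq: "\<And>h. h < K m \<Longrightarrow> col_of m \<phi> h = col_of m \<phi>' h"
  shows "\<phi> = \<phi>'"
proof -
  have K0: "0 < K m" using K_pos[OF m] by simp
  have ext: "j = j'" if "j \<in> idx (K m) d" "j' \<in> idx (K m) d" "\<And>h. h < K m \<Longrightarrow> j h = j' h" for j j' d
    using that(1,2) unfolding idx_def by (rule PiE_ext) (use that(3) in simp)
  show ?thesis
    using \<phi>(1)
  proof (cases rule: facsE)
    case (1 j)
    show ?thesis
      using \<phi>(2)
    proof (cases rule: facsE)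
      case (1 j')
      then show ?thesis using \<open>\<phi> = Inl j\<close> \<open>j \<in> idx (K m) (r m)\<close> eq ext[of j "r m" j'] by (simp add: col_of_def)
    next
      case (2 j')
      then show ?thesis using \<open>\<phi> = Inl j\<close> idx_less[OF \<open>j \<in> idx (K m) (r m)\<close> K0] eq[OF K0] by (simp add: col_of_def)
    qed
  next
    case (2 j)
    show ?thesis
      using \<phi>(2)
    proof (cases rule: facsE)
      case (1 j')
      then show ?thesis using \<open>\<phi> = Inr j\<close> idx_less[OF \<open>j' \<in> idx (K m) (r m)\<close> K0] eq[OF K0] by (simp add: col_of_def)
    next
      case (2 j')
      then show ?thesis using \<open>\<phi> = Inr j\<close> \<open>j \<in> idx (K m) (u m)\<close> eq ext[of j "u m" j'] by (simp add: col_of_def)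
    qed
  qed
qed

section \<open>Near orthonormality of the loadings\<close>

lemma loading_gram:
  assumes m: "m < M"
  shows "\<exists>C\<ge>0. (\<forall>h<K m. \<forall>i. \<forall>j<r m h + u m h. \<bar>ab m h i j\<bar> \<le> C) \<and>
    (\<forall>h<K m. \<forall>q\<ge>1. \<forall>i<r m h + u m h. \<forall>j<r m h + u m h.
      \<bar>(1 / real q) * (\<Sum>x<q. ab m h x i * ab m h x j) - (if i = j then 1 else 0)\<bar> \<le> C / sqrt (real q))"
proof -
  let ?AB = "\<lambda>(h :: nat) (q :: nat). loading_mat q (r m h + u m h) (ab m h)"
  have "\<forall>h<K m. \<exists>c. (\<forall>i. (\<forall>j<r m h. \<bar>a m h i j\<bar> \<le> c) \<and> (\<forall>j<u m h. \<bar>b m h i j\<bar> \<le> c)) \<and>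
     (\<forall>q\<ge>1. spectral_norm ((1 / real q) \<cdot>\<^sub>m (transpose_mat (?AB h q) * ?AB h q) - 1\<^sub>m (r m h + u m h))
          \<le> c / sqrt (real q))"
    using loading m unfolding loading_condition_def Let_def ab_def[abs_def] by blast
  then obtain c where c: "\<And>h i j. h < K m \<Longrightarrow> j < r m h \<Longrightarrow> \<bar>a m h i j\<bar> \<le> c h"
    "\<And>h i j. h < K m \<Longrightarrow> j < u m h \<Longrightarrow> \<bar>b m h i j\<bar> \<le> c h"
    "\<And>h q. h < K m \<Longrightarrow> 1 \<le> q \<Longrightarrow> spectral_norm ((1 / real q) \<cdot>\<^sub>m (transpose_mat (?AB h q) * ?AB h q) -
        1\<^sub>m (r m h + u m h)) \<le> c h / sqrt (real q)"
    by metis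
  define C where "C = (\<Sum>h<K m. \<bar>c h\<bar>)"
  have cC: "c h \<le> C" if "h < K m" for h
  proof -
    have "\<bar>c h\<bar> \<le> C" unfolding C_def using that by (intro member_le_sum) auto
    then show ?thesis by simp
  qed
  show ?thesis
  proof (intro exI[of _ C] conjI allI impI)
    show "0 \<le> C" by (auto simp: C_def intro: sum_nonneg)
  next
    fix h i j assume h: "h < K m" and j: "j < r m h + u m h"
    show "\<bar>ab m h i j\<bar> \<le> C"
      using c(1)[OF h, of j i] c(2)[OF h, of "j - r m h" i] cC[OF h] j unfolding ab_def by force
  next
    fix h q i j :: nat assume h: "h < K m" and q: "1 \<le> q" and ij: "i < r m h + u m h" "j < r m h + u m h"
    let ?A = "?AB h q"
    have A: "?A \<in> carrier_mat q (r m h + u m h)" by (simp add: loading_mat_def)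
    define N where "N = (1 / real q) \<cdot>\<^sub>m (transpose_mat ?A * ?A) - 1\<^sub>m (r m h + u m h)"
    have N: "N \<in> carrier_mat (r m h + u m h) (r m h + u m h)"
      using A by (auto simp: N_def)
    have "(transpose_mat ?A * ?A) $$ (i, j) = (\<Sum>x<q. ?A $$ (x, i) * ?A $$ (x, j))"
      by (rule gram_mat(3)[OF A ij])
    also have "\<dots> = (\<Sum>x<q. ab m h x i * ab m h x j)"
      using ij by (simp add: loading_mat_def)
    finally have "N $$ (i, j) = (1 / real q) * (\<Sum>x<q. ab m h x i * ab m h x j) - (if i = j then 1 else 0)"
      using A ij by (simp add: N_def del: index_mult_mat(1))
    moreover have "\<bar>N $$ (i, j)\<bar> \<le> spectral_norm N"
      by (rule entry_le_spectral_norm[OF N ij])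
    moreover have "spectral_norm N \<le> c h / sqrt (real q)"
      using c(3)[OF h q] by (simp add: N_def)
    moreover have "c h / sqrt (real q) \<le> C / sqrt (real q)"
      using cC[OF h] by (simp add: divide_right_mono)
    ultimately show "\<bar>(1 / real q) * (\<Sum>x<q. ab m h x i * ab m h x j) - (if i = j then 1 else 0)\<bar> \<le> C / sqrt (real q)"
      by linarith
  qed
qed

lemma loading_gram_tendsto:
  assumes m: "m < M" and h: "h < K m" and ij: "i < r m h + u m h" "j < r m h + u m h"
  shows "(\<lambda>q. (1 / real q) * (\<Sum>x<q. ab m h x i * ab m h x j)) \<longlonglongrightarrow> (if i = j then 1 else 0)"
proof -
  obtain C where C0: "0 \<le> C"
    and C1: "\<forall>h<K m. \<forall>i. \<forall>j<r m h + u m h. \<bar>ab m h i j\<bar> \<le> C"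
    and C2: "\<forall>h<K m. \<forall>q\<ge>1. \<forall>i<r m h + u m h. \<forall>j<r m h + u m h.
      \<bar>(1 / real q) * (\<Sum>x<q. ab m h x i * ab m h x j) - (if i = j then 1 else 0)\<bar> \<le> C / sqrt (real q)"
    using loading_gram[OF m] by blast
  have "(\<lambda>q. C / sqrt (real q)) \<longlonglongrightarrow> 0"
    by real_asymp
  then have "(\<lambda>q. (1 / real q) * (\<Sum>x<q. ab m h x i * ab m h x j) - (if i = j then 1 else 0)) \<longlonglongrightarrow> 0"
  proof (rule Lim_null_comparison[rotated])
    have "\<bar>(1 / real q) * (\<Sum>x<q. ab m h x i * ab m h x j) - (if i = j then 1 else 0)\<bar> \<le> C / sqrt (real q)"
      if "1 \<le> q" for q
      using C2 h ij that by blast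
    then show "\<forall>\<^sub>F q in sequentially. norm ((1 / real q) * (\<Sum>x<q. ab m h x i * ab m h x j) -
        (if i = j then 1 else 0)) \<le> C / sqrt (real q)"
      by (intro eventually_sequentiallyI[of 1]) simp
  qed
  then show ?thesis by (simp add: LIM_zero_iff)
qed

lemma coef_bounded:
  assumes m: "m < M"
  shows "\<exists>C\<ge>0. \<forall>\<phi>\<in>facs m. \<forall>i. \<bar>coef m i \<phi>\<bar> \<le> C"
proof -
  obtain C where C0: "0 \<le> C"
    and C1: "\<forall>h<K m. \<forall>i. \<forall>j<r m h + u m h. \<bar>ab m h i j\<bar> \<le> C"
    and C2: "\<forall>h<K m. \<forall>q\<ge>1. \<forall>i<r m h + u m h. \<forall>j<r m h + u m h.
      \<bar>(1 / real q) * (\<Sum>x<q. ab m h x i * ab m h x j) - (if i = j then 1 else 0)\<bar> \<le> C / sqrt (real q)"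
    using loading_gram[OF m] by blast
  show ?thesis
  proof (intro exI[of _ "C ^ K m"] conjI ballI allI)
    fix \<phi> i assume \<phi>: "\<phi> \<in> facs m"
    have "\<bar>coef m i \<phi>\<bar> = (\<Prod>h<K m. \<bar>ab m h (i h) (col_of m \<phi> h)\<bar>)"
      by (simp add: coef_eq[OF \<phi>] abs_prod)
    also have "\<dots> \<le> (\<Prod>h<K m. C)"
      using col_of_less[OF \<phi>] C1 by (intro prod_mono) auto
    finally show "\<bar>coef m i \<phi>\<bar> \<le> C ^ K m" by simp
  qed (use C0 in auto)
qed

text \<open>All modes have one auxiliary dimension \<open>q\<close>, unrelated to the observed
  dimensions: the loadings are infinite arrays, so \<open>q\<close> can tend to infinity while T and
  the observed dimensions stay fixed. The Gram sum factors over the modes, and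
  \<open>col_of_inj\<close> turns the product of deltas into a single one.\<close>

lemma coef_gram_tendsto:
  assumes m: "m < M" and \<phi>: "\<phi> \<in> facs m" "\<phi>' \<in> facs m"
  shows "(\<lambda>q. (1 / real q ^ K m) * (\<Sum>x\<in>idx (K m) (\<lambda>_. q). coef m x \<phi> * coef m x \<phi>'))
    \<longlonglongrightarrow> (if \<phi> = \<phi>' then 1 else 0)"
proof -
  have "(1 / real q ^ K m) * (\<Sum>x\<in>idx (K m) (\<lambda>_. q). coef m x \<phi> * coef m x \<phi>') =
      (\<Prod>h<K m. (1 / real q) * (\<Sum>x<q. ab m h x (col_of m \<phi> h) * ab m h x (col_of m \<phi>' h)))" for q
  proof -
    have "(\<Sum>x\<in>idx (K m) (\<lambda>_. q). coef m x \<phi> * coef m x \<phi>') =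
        (\<Sum>x\<in>idx (K m) (\<lambda>_. q). \<Prod>h<K m. ab m h (x h) (col_of m \<phi> h) * ab m h (x h) (col_of m \<phi>' h))"
      by (simp add: coef_eq \<phi> prod.distrib)
    also have "\<dots> = (\<Prod>h<K m. \<Sum>x<q. ab m h x (col_of m \<phi> h) * ab m h x (col_of m \<phi>' h))"
      unfolding idx_def by (rule prod_sum_PiE[symmetric]) auto
    finally show ?thesis
      by (simp add: prod.distrib prod_dividef power_one_over)
  qed
  moreover have "(\<lambda>q. \<Prod>h<K m. (1 / real q) * (\<Sum>x<q. ab m h x (col_of m \<phi> h) * ab m h x (col_of m \<phi>' h)))
      \<longlonglongrightarrow> (\<Prod>h<K m. if col_of m \<phi> h = col_of m \<phi>' h then 1 else 0)"
    using m \<phi> by (intro tendsto_prod loading_gram_tendsto col_of_less) auto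
  moreover have "(\<Prod>h<K m. if col_of m \<phi> h = col_of m \<phi>' h then 1 else 0) = (if \<phi> = \<phi>' then 1 else 0 :: real)"
    using col_of_inj[OF m \<phi>] by (auto intro!: prod.neutral)
  ultimately show ?thesis by simp
qed

section \<open>Moments of factors, noise and data\<close>

lemma model_eq:
  assumes m: "m < M" and i: "i \<in> all_idx (K m)" and \<omega>: "\<omega> \<in> space P"
  shows "X m t i \<omega> = (\<Sum>\<phi>\<in>facs m. coef m i \<phi> * fac m t \<phi> \<omega>) + E m t i \<omega>"
proof -
  have "X m t i \<omega> = multi_prod (K m) (r m) (a m) (\<lambda>j. G m t j \<omega>) i +
      multi_prod (K m) (u m) (b m) (\<lambda>j. F m t j \<omega>) i + E m t i \<omega>"
    using model m i \<omega> by (simp add: tensor_factor_model_def)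
  then show ?thesis
    using i by (simp add: multi_prod_eq facs_def sum.Plus coef_def fac_def)
qed

lemma fac_mean_zero: "m < M \<Longrightarrow> \<phi> \<in> facs m \<Longrightarrow> mean_zero P (fac m t \<phi>)"
  using identification unfolding identification_condition_def facs_def fac_def by auto

lemma noise_mean_zero: "m < M \<Longrightarrow> i \<in> all_idx (K m) \<Longrightarrow> mean_zero P (E m t i)"
  using noise unfolding noise_condition_def by blast

lemma X_mean_zero: "m < M \<Longrightarrow> i \<in> all_idx (K m) \<Longrightarrow> mean_zero P (X m t i)"
  using model unfolding tensor_factor_model_def by blast

lemma fac_moments:
  assumes m: "m < M"
  shows "\<exists>c. \<forall>\<phi>\<in>facs m. \<forall>t. L4 P (fac m t \<phi>) \<and> L2le P c (fac m t \<phi>)"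
proof -
  obtain c where c: "\<forall>t. (\<forall>i\<in>idx (K m) (r m). fourth_moment_le P c (G m t i)) \<and>
      (\<forall>i\<in>idx (K m) (u m). fourth_moment_le P c (F m t i))"
    using core_factor[unfolded core_factor_condition_def, THEN spec, THEN mp, OF m, THEN conjunct1] ..
  have meas: "fac m t \<phi> \<in> borel_measurable P" if "\<phi> \<in> facs m" for t \<phi>
    using model m that unfolding tensor_factor_model_def facs_def fac_def by auto
  have mom: "fourth_moment_le P c (fac m t \<phi>)" if "\<phi> \<in> facs m" for t \<phi>
    using c that unfolding facs_def fac_def by auto
  have L4: "L4 P (fac m t \<phi>)" if "\<phi> \<in> facs m" for t \<phi>
    using meas[OF that] mom[OF that] by (simp add: L4_def fourth_moment_le_def)
  have "L2le P (sqrt (1 + c)) (fac m t \<phi>)" if "\<phi> \<in> facs m" for t \<phi>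
    using L4_L2[OF L4[OF that]] mom[OF that] by (simp add: fourth_moment_le_def)
  with L4 show ?thesis by blast
qed

lemma noise_moments:
  assumes m: "m < M"
  shows "\<exists>c. \<forall>i\<in>all_idx (K m). \<forall>t. L4 P (E m t i) \<and> L2le P c (E m t i)"
proof -
  obtain c where mom: "\<And>t i. i \<in> all_idx (K m) \<Longrightarrow> fourth_moment_le P c (E m t i)"
    using noise m unfolding noise_condition_def by metis
  have meas: "E m t i \<in> borel_measurable P" if "i \<in> all_idx (K m)" for t i
    using model m that unfolding tensor_factor_model_def by auto
  have L4: "L4 P (E m t i)" if "i \<in> all_idx (K m)" for t i
    using meas[OF that] mom[OF that] by (simp add: L4_def fourth_moment_le_def)
  have "L2le P (sqrt (1 + c)) (E m t i)" if "i \<in> all_idx (K m)" for t i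
    using L4_L2[OF L4[OF that]] mom[OF that] by (simp add: fourth_moment_le_def)
  with L4 show ?thesis by blast
qed

lemma X_L4:
  assumes m: "m < M" and i: "i \<in> all_idx (K m)"
  shows "L4 P (X m t i)"
proof -
  obtain c where fac: "\<And>t \<phi>. \<phi> \<in> facs m \<Longrightarrow> L4 P (fac m t \<phi>)" "\<And>t \<phi>. \<phi> \<in> facs m \<Longrightarrow> L2le P c (fac m t \<phi>)"
    using fac_moments[OF m] by blast
  obtain c' where noi: "\<And>t i. i \<in> all_idx (K m) \<Longrightarrow> L4 P (E m t i)" "\<And>t i. i \<in> all_idx (K m) \<Longrightarrow> L2le P c' (E m t i)"
    using noise_moments[OF m] by blast
  have "L4 P (\<lambda>\<omega>. (\<Sum>\<phi>\<in>facs m. coef m i \<phi> * fac m t \<phi> \<omega>) + E m t i \<omega>)"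
    by (intro L4_add L4_sum L4_cmult fac noi i) auto
  then show ?thesis
    by (rule L4_cong) (simp add: model_eq[OF m i])
qed

lemma cov_zero_product:
  "mean_zero P Y \<Longrightarrow> mean_zero P Z \<Longrightarrow> cov P Y Z = 0 \<Longrightarrow> expectation (\<lambda>\<omega>. Y \<omega> * Z \<omega>) = 0"
  by (simp add: cov_def mean_zero_def)

text \<open>The summability clause of the noise condition, read in the mode-0 unfolding with horizon
  \<open>Suc t\<close> and at the time s = t, bounds every row sum of the noise covariance
  matrix.\<close>

lemma noise_sum:
  assumes m: "m < M"
  shows "\<exists>c\<ge>0. \<forall>q t. \<forall>x\<in>idx (K m) (\<lambda>_. q).
    (\<Sum>x'\<in>idx (K m) (\<lambda>_. q). \<bar>expectation (\<lambda>\<omega>. E m t x \<omega> * E m t x' \<omega>)\<bar>) \<le> c"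
proof -
  let ?I = "{..<K m} - {0}"
  have K0: "0 < K m" using K_pos[OF m] by simp
  obtain c where c: "\<forall>T (d :: nat \<Rightarrow> nat). \<forall>k<K m.
        let q = (\<Prod>h\<in>{..<K m} - {k}. d h);
            e = (\<lambda>t i j \<omega>. mode_mat (K m) d k (\<lambda>x. E m t x \<omega>) $$ (i, j)) in
        \<forall>t<T. \<forall>i<d k. \<forall>j<q.
          (\<Sum>s<T. \<Sum>l<d k. \<Sum>h<q. \<bar>\<integral>\<omega>. e t i j \<omega> * e s l h \<omega> \<partial>P\<bar>) \<le> c"
    using noise[unfolded noise_condition_def, THEN spec, THEN mp, OF m, THEN conjunct2, THEN conjunct2, THEN conjunct1] ..
  have le: "(\<Sum>x'\<in>idx (K m) (\<lambda>_. q). \<bar>expectation (\<lambda>\<omega>. E m t x \<omega> * E m t x' \<omega>)\<bar>) \<le> max c 0"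
    if x: "x \<in> idx (K m) (\<lambda>_. q)" for q t x
  proof -
    define Q where "Q = (\<Prod>h\<in>?I. q)"
    define e where "e t i j \<omega> = mode_mat (K m) (\<lambda>_. q) 0 (\<lambda>x. E m t x \<omega>) $$ (i, j)" for t i j \<omega>
    have e: "e t i j \<omega> = E m t ((digits ?I (\<lambda>_. q) j)(0 := i)) \<omega>" if "i < q" "j < Q" for t i j \<omega>
      using that unfolding e_def Q_def by (intro mode_mat_index)
    \<comment> \<open>The column of the mode-0 unfolding that contains the entry
      \<open>x\<close>.\<close>
    define j where "j = lin ?I (\<lambda>_. q) (restrict x ?I)"
    have xI: "restrict x ?I \<in> PiE ?I (\<lambda>_. {..<q})"
      using x by (auto simp: idx_def PiE_iff)
    have jQ: "j < Q"
      unfolding j_def Q_def using xI by (intro lin_digits(1)) (auto simp: PiE_iff)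
    have x0: "x 0 < q" using idx_less[OF x K0] by simp
    have x_eq: "(digits ?I (\<lambda>_. q) j)(0 := x 0) = x"
    proof -
      have "digits ?I (\<lambda>_. q) j = restrict x ?I"
        unfolding j_def using xI by (intro digits_lin) auto
      then show ?thesis
        using x by (auto simp: fun_eq_iff idx_def PiE_iff extensional_def)
    qed
    have bound: "(\<Sum>s<Suc t. \<Sum>l<q. \<Sum>h<Q. \<bar>\<integral>\<omega>. e t (x 0) j \<omega> * e s l h \<omega> \<partial>P\<bar>) \<le> c"
      using c[THEN spec, of "Suc t", THEN spec, of "\<lambda>_. q", THEN spec, of 0] K0 x0 jQ
      unfolding Let_def Q_def e_def by blast
    have "(\<Sum>x'\<in>idx (K m) (\<lambda>_. q). \<bar>expectation (\<lambda>\<omega>. E m t x \<omega> * E m t x' \<omega>)\<bar>) =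
        (\<Sum>h<Q. \<Sum>l<q. \<bar>expectation (\<lambda>\<omega>. E m t x \<omega> * E m t ((digits ?I (\<lambda>_. q) h)(0 := l)) \<omega>)\<bar>)"
      unfolding Q_def
      by (subst sum_digits[where f = "\<lambda>c. \<Sum>l<q. \<bar>expectation (\<lambda>\<omega>. E m t x \<omega> * E m t (c(0 := l)) \<omega>)\<bar>"])
        (simp_all add: sum_idx_remove[OF K0])
    also have "\<dots> = (\<Sum>h<Q. \<Sum>l<q. \<bar>\<integral>\<omega>. e t (x 0) j \<omega> * e t l h \<omega> \<partial>P\<bar>)"
      using jQ x0 by (intro sum.cong refl) (simp add: e x_eq)
    also have "\<dots> = (\<Sum>l<q. \<Sum>h<Q. \<bar>\<integral>\<omega>. e t (x 0) j \<omega> * e t l h \<omega> \<partial>P\<bar>)"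
      by (rule sum.swap)
    also have "\<dots> \<le> (\<Sum>s<Suc t. \<Sum>l<q. \<Sum>h<Q. \<bar>\<integral>\<omega>. e t (x 0) j \<omega> * e s l h \<omega> \<partial>P\<bar>)"
      by (rule member_le_sum[where i = t and f = "\<lambda>s. \<Sum>l<q. \<Sum>h<Q. \<bar>\<integral>\<omega>. e t (x 0) j \<omega> * e s l h \<omega> \<partial>P\<bar>"])
        (auto intro!: sum_nonneg)
    finally show ?thesis using bound by simp
  qed
  show ?thesis
    by (rule exI[of _ "max c 0"]) (use le in auto)
qed

text \<open>Bounded row sums of the covariance make the second moment of the weighted sum at most
  q^K (W / q^K)^2 c = W^2 c / q^K, so averaging over a growing block removes the noise.\<close>

lemma noise_average:
  assumes m: "m < M"
  shows "\<exists>c\<ge>0. \<forall>q\<ge>1. \<forall>t w. \<forall>W\<ge>0. (\<forall>x\<in>idx (K m) (\<lambda>_. q). \<bar>w x\<bar> \<le> W / real q ^ K m) \<longrightarrow>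
    L2le P (W * c / sqrt (real q)) (\<lambda>\<omega>. \<Sum>x\<in>idx (K m) (\<lambda>_. q). w x * E m t x \<omega>)"
proof -
  obtain c where c: "c \<ge> 0" "\<forall>q t. \<forall>x\<in>idx (K m) (\<lambda>_. q).
    (\<Sum>x'\<in>idx (K m) (\<lambda>_. q). \<bar>expectation (\<lambda>\<omega>. E m t x \<omega> * E m t x' \<omega>)\<bar>) \<le> c"
    using noise_sum[OF m] by blast
  obtain c' where noi: "\<forall>i\<in>all_idx (K m). \<forall>t. L4 P (E m t i) \<and> L2le P c' (E m t i)"
    using noise_moments[OF m] by blast
  have K0: "1 \<le> K m" using K_pos[OF m] .
  have "L2le P (W * sqrt c / sqrt (real q)) (\<lambda>\<omega>. \<Sum>x\<in>idx (K m) (\<lambda>_. q). w x * E m t x \<omega>)"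
    if q: "1 \<le> q" and W: "0 \<le> W" and w: "\<forall>x\<in>idx (K m) (\<lambda>_. q). \<bar>w x\<bar> \<le> W / real q ^ K m" for q t w W
  proof -
    let ?I = "idx (K m) (\<lambda>_. q)"
    have E: "L2le P c' (E m t x)" if "x \<in> ?I" for x
      using noi idx_subset_all_idx[of "K m"] that by blast
    have EE: "integrable P (\<lambda>\<omega>. E m t x \<omega> * E m t x' \<omega>)" if "x \<in> ?I" "x' \<in> ?I" for x x'
      using L2le_mult(1)[OF E E] that by blast
    have sq: "(\<Sum>x\<in>?I. w x * E m t x \<omega>)\<^sup>2 = (\<Sum>x\<in>?I. \<Sum>x'\<in>?I. w x * w x' * (E m t x \<omega> * E m t x' \<omega>))" for \<omega>
      unfolding power2_eq_square sum_product by (intro sum.cong refl) (simp add: mult_ac)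
    define V where "V = W / real q ^ K m"
    have V0: "0 \<le> V" using W by (simp add: V_def)
    have "expectation (\<lambda>\<omega>. (\<Sum>x\<in>?I. w x * E m t x \<omega>)\<^sup>2) =
        (\<Sum>x\<in>?I. \<Sum>x'\<in>?I. w x * w x' * expectation (\<lambda>\<omega>. E m t x \<omega> * E m t x' \<omega>))"
      unfolding sq using EE by (simp add: Bochner_Integration.integral_sum)
    also have "\<dots> \<le> (\<Sum>x\<in>?I. \<Sum>x'\<in>?I. V * V * \<bar>expectation (\<lambda>\<omega>. E m t x \<omega> * E m t x' \<omega>)\<bar>)"
    proof (intro sum_mono)
      fix x x' assume x: "x \<in> ?I" "x' \<in> ?I"
      have "w x * w x' * expectation (\<lambda>\<omega>. E m t x \<omega> * E m t x' \<omega>) \<le>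
          \<bar>w x\<bar> * \<bar>w x'\<bar> * \<bar>expectation (\<lambda>\<omega>. E m t x \<omega> * E m t x' \<omega>)\<bar>"
        by (metis abs_ge_self abs_mult)
      also have "\<dots> \<le> V * V * \<bar>expectation (\<lambda>\<omega>. E m t x \<omega> * E m t x' \<omega>)\<bar>"
        using w x V0 by (intro mult_right_mono mult_mono) (auto simp: V_def)
      finally show "w x * w x' * expectation (\<lambda>\<omega>. E m t x \<omega> * E m t x' \<omega>) \<le>
          V * V * \<bar>expectation (\<lambda>\<omega>. E m t x \<omega> * E m t x' \<omega>)\<bar>" .
    qed
    also have "\<dots> = (\<Sum>x\<in>?I. V * V * (\<Sum>x'\<in>?I. \<bar>expectation (\<lambda>\<omega>. E m t x \<omega> * E m t x' \<omega>)\<bar>))"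
      by (simp add: sum_distrib_left)
    also have "\<dots> \<le> (\<Sum>x\<in>?I. V * V * c)"
      using c(2) V0 by (intro sum_mono mult_left_mono) auto
    also have "\<dots> = real q ^ K m * (V * V * c)"
      by (simp add: card_idx)
    also have "\<dots> = W * W * c / real q ^ K m"
      using q by (simp add: V_def field_simps)
    \<comment> \<open>There is at least one mode, so q <= q^K.\<close>
    also have "\<dots> \<le> W * W * c / real q"
      using q K0 W c by (intro divide_left_mono) (auto intro: self_le_power)
    also have "\<dots> = (W * sqrt c / sqrt (real q))\<^sup>2"
      using c(1) by (simp add: power2_eq_square field_simps)
    finally have le: "expectation (\<lambda>\<omega>. (\<Sum>x\<in>?I. w x * E m t x \<omega>)\<^sup>2) \<le> (W * sqrt c / sqrt (real q))\<^sup>2" .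
    have L2: "L2le P (\<Sum>x\<in>?I. \<bar>w x\<bar> * c') (\<lambda>\<omega>. \<Sum>x\<in>?I. w x * E m t x \<omega>)"
      by (intro L2le_sum L2le_cmult E) auto
    show ?thesis
      using L2leD(2,3)[OF L2] le W c(1) by (simp add: L2le_def)
  qed
  then show ?thesis
    using c(1) by (intro exI[of _ "sqrt c"]) auto
qed

text \<open>
  A factor is an \<open>L\<^sup>2\<close> limit of averages of observed entries of its thread, and these are
  uncorrelated with the noise of every other thread.
\<close>

lemma factor_times_noise:
  assumes m: "m < M" and n: "n < M" "n \<noteq> m" and \<phi>: "\<phi> \<in> facs m"
  shows "\<exists>C\<ge>0. \<forall>T\<ge>1. \<forall>i\<in>all_idx (K n).
    L2le P (C / sqrt (real T)) (\<lambda>\<omega>. (1 / real T) * (\<Sum>t<T. fac m t \<phi> \<omega> * E n t i \<omega>))"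
proof -
  obtain C where C: "C \<ge> 0" "\<forall>\<phi>\<in>facs m. \<forall>i. \<bar>coef m i \<phi>\<bar> \<le> C"
    using coef_bounded[OF m] by blast
  have ct: "(\<forall>t. \<forall>i\<in>all_idx (K m). \<forall>j\<in>all_idx (K n). cov P (X m t i) (E n t j) = 0) \<and>
     (\<exists>c. product_var_le P c (all_idx (K m)) (X m) (all_idx (K n)) (E n) \<and>
          product_var_le P c (idx (K m) (r m)) (G m) (idx (K n) (u n)) (F n) \<and>
          product_var_le P c (idx (K m) (u m)) (F m) (idx (K n) (u n)) (F n) \<and>
          product_var_le P c (idx (K m) (r m)) (G m) (idx (K n) (r n)) (G n))"
    using cross_thread[unfolded cross_thread_condition_def, THEN spec, THEN mp, OF m,
        THEN spec, THEN mp, OF n(1), THEN mp, OF n(2)] .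
  then obtain c where c: "product_var_le P c (all_idx (K m)) (X m) (all_idx (K n)) (E n)" by blast
  obtain cf where fac: "\<forall>\<phi>\<in>facs m. \<forall>t. L4 P (fac m t \<phi>) \<and> L2le P cf (fac m t \<phi>)"
    using fac_moments[OF m] by blast
  obtain ce where noi: "\<forall>i\<in>all_idx (K n). \<forall>t. L4 P (E n t i) \<and> L2le P ce (E n t i)"
    using noise_moments[OF n(1)] by blast
  obtain cn where cn: "cn \<ge> 0" "\<forall>q\<ge>1. \<forall>t w. \<forall>W\<ge>0. (\<forall>x\<in>idx (K m) (\<lambda>_. q). \<bar>w x\<bar> \<le> W / real q ^ K m) \<longrightarrow>
    L2le P (W * cn / sqrt (real q)) (\<lambda>\<omega>. \<Sum>x\<in>idx (K m) (\<lambda>_. q). w x * E m t x \<omega>)"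
    using noise_average[OF m] by blast
  have cf0: "0 \<le> cf" using fac \<phi> L2leD(1) by blast
  \<comment> \<open>Projection weights: averaging the data against the loadings of \<phi> isolates
    that factor. The block has \<open>Suc q\<close> indices per mode, hence is never empty.\<close>
  define w where "w q x = coef m x \<phi> / real (Suc q) ^ K m" for q x
  let ?I = "\<lambda>q. idx (K m) (\<lambda>_. Suc q)"
  have Iall: "x \<in> all_idx (K m)" if "x \<in> ?I q" for x q
    using idx_subset_all_idx that by blast
  have wC: "\<bar>w q x\<bar> \<le> C / real (Suc q) ^ K m" for q x
    using C(2) \<phi> by (simp add: w_def abs_divide divide_right_mono del: of_nat_Suc)
  have wsum: "(\<Sum>x\<in>?I q. \<bar>w q x\<bar>) \<le> C" for q
  proof -
    have "(\<Sum>x\<in>?I q. \<bar>w q x\<bar>) \<le> (\<Sum>x\<in>?I q. C / real (Suc q) ^ K m)"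
      by (intro sum_mono wC)
    also have "\<dots> = C" by (simp add: card_idx)
    finally show ?thesis .
  qed
  define Z where "Z q t \<omega> = (\<Sum>x\<in>?I q. w q x * X m t x \<omega>)" for q t \<omega>
  have XE0: "expectation (\<lambda>\<omega>. X m t x \<omega> * E n t i \<omega>) = 0" if "x \<in> all_idx (K m)" "i \<in> all_idx (K n)" for t x i
    using ct that by (intro cov_zero_product X_mean_zero noise_mean_zero m n) auto
  \<comment> \<open>The bound is uniform in \<open>q\<close>, because the absolute weights sum to at
    most \<open>C\<close>; this is why it survives the limit.\<close>
  have ZE: "L2le P (C * (sqrt c / sqrt (real T))) (\<lambda>\<omega>. (1 / real T) * (\<Sum>t<T. Z q t \<omega> * E n t i \<omega>))"
    if T: "1 \<le> T" and i: "i \<in> all_idx (K n)" for T i q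
  proof -
    have XE: "L2le P (sqrt c / sqrt (real T)) (\<lambda>\<omega>. (1 / real T) * (\<Sum>t<T. X m t x \<omega> * E n t i \<omega>))"
      if "x \<in> all_idx (K m)" for x
      using avg_product_L2le[OF X_L4[OF m that] _ c that i T] noi i XE0[OF that i] by simp
    have nonneg: "0 \<le> sqrt c / sqrt (real T)"
    proof -
      have "?I 0 \<noteq> {}" by (auto simp: idx_def PiE_eq_empty_iff)
      then obtain x where "x \<in> ?I 0" by blast
      then show ?thesis using L2leD(1)[OF XE[OF Iall]] by blast
    qed
    have "L2le P (C * (sqrt c / sqrt (real T)))
        (\<lambda>\<omega>. \<Sum>x\<in>?I q. w q x * ((1 / real T) * (\<Sum>t<T. X m t x \<omega> * E n t i \<omega>)))"
      by (intro L2le_weighted_sum XE Iall wsum nonneg) auto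
    moreover have "(\<Sum>x\<in>?I q. w q x * ((1 / real T) * (\<Sum>t<T. X m t x \<omega> * E n t i \<omega>))) =
        (1 / real T) * (\<Sum>t<T. Z q t \<omega> * E n t i \<omega>)" for \<omega>
    proof -
      have "(\<Sum>t<T. Z q t \<omega> * E n t i \<omega>) = (\<Sum>t<T. \<Sum>x\<in>?I q. w q x * (X m t x \<omega> * E n t i \<omega>))"
        by (simp add: Z_def sum_distrib_right mult.assoc)
      also have "\<dots> = (\<Sum>x\<in>?I q. \<Sum>t<T. w q x * (X m t x \<omega> * E n t i \<omega>))"
        by (rule sum.swap)
      finally show ?thesis
        by (simp add: sum_distrib_left mult_ac)
    qed
    ultimately show ?thesis by simp
  qed
  define \<rho> where "\<rho> q \<psi> = (1 / real q ^ K m) * (\<Sum>x\<in>idx (K m) (\<lambda>_. q). coef m x \<phi> * coef m x \<psi>)" for q \<psi>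
  \<comment> \<open>The L^2 error of recovering the factor: the defect of the loading Gram matrix,
    plus the averaged noise.\<close>
  define \<delta> where "\<delta> q = (\<Sum>\<psi>\<in>facs m. \<bar>\<rho> (Suc q) \<psi> - (if \<phi> = \<psi> then 1 else 0)\<bar> * cf) + C * cn / sqrt (real (Suc q))" for q
  have Zdiff: "L2le P (\<delta> q) (\<lambda>\<omega>. Z q t \<omega> - fac m t \<phi> \<omega>)" for q t
  proof -
    have "L2le P (\<delta> q) (\<lambda>\<omega>. (\<Sum>\<psi>\<in>facs m. (\<rho> (Suc q) \<psi> - (if \<phi> = \<psi> then 1 else 0)) * fac m t \<psi> \<omega>) +
        (\<Sum>x\<in>?I q. w q x * E m t x \<omega>))"
      unfolding \<delta>_def
    proof (rule L2le_add)
      show "L2le P (\<Sum>\<psi>\<in>facs m. \<bar>\<rho> (Suc q) \<psi> - (if \<phi> = \<psi> then 1 else 0)\<bar> * cf)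
          (\<lambda>\<omega>. \<Sum>\<psi>\<in>facs m. (\<rho> (Suc q) \<psi> - (if \<phi> = \<psi> then 1 else 0)) * fac m t \<psi> \<omega>)"
        using fac by (intro L2le_sum L2le_cmult) auto
      show "L2le P (C * cn / sqrt (real (Suc q))) (\<lambda>\<omega>. \<Sum>x\<in>?I q. w q x * E m t x \<omega>)"
        using cn(2)[THEN spec, of "Suc q"] wC C(1) by auto
    qed
    then show ?thesis
    proof (rule L2le_cong)
      fix \<omega> assume \<omega>: "\<omega> \<in> space P"
      have "Z q t \<omega> = (\<Sum>x\<in>?I q. w q x * ((\<Sum>\<psi>\<in>facs m. coef m x \<psi> * fac m t \<psi> \<omega>) + E m t x \<omega>))"
        unfolding Z_def by (intro sum.cong refl) (simp add: model_eq[OF m Iall \<omega>])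
      also have "\<dots> = (\<Sum>x\<in>?I q. \<Sum>\<psi>\<in>facs m. w q x * coef m x \<psi> * fac m t \<psi> \<omega>) + (\<Sum>x\<in>?I q. w q x * E m t x \<omega>)"
        by (simp add: distrib_left sum.distrib sum_distrib_left mult.assoc)
      also have "(\<Sum>x\<in>?I q. \<Sum>\<psi>\<in>facs m. w q x * coef m x \<psi> * fac m t \<psi> \<omega>) =
          (\<Sum>\<psi>\<in>facs m. \<Sum>x\<in>?I q. w q x * coef m x \<psi> * fac m t \<psi> \<omega>)"
        by (rule sum.swap)
      also have "\<dots> = (\<Sum>\<psi>\<in>facs m. \<rho> (Suc q) \<psi> * fac m t \<psi> \<omega>)"
        by (intro sum.cong refl) (simp add: \<rho>_def w_def sum_distrib_left sum_distrib_right)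
      finally have Z: "Z q t \<omega> = (\<Sum>\<psi>\<in>facs m. \<rho> (Suc q) \<psi> * fac m t \<psi> \<omega>) + (\<Sum>x\<in>?I q. w q x * E m t x \<omega>)" .
      have "(\<Sum>\<psi>\<in>facs m. (if \<phi> = \<psi> then 1 else 0) * fac m t \<psi> \<omega>) = (\<Sum>\<psi>\<in>facs m. if \<psi> = \<phi> then fac m t \<psi> \<omega> else 0)"
        by (intro sum.cong) auto
      also have "\<dots> = fac m t \<phi> \<omega>" using \<phi> by simp
      finally show "(\<Sum>\<psi>\<in>facs m. (\<rho> (Suc q) \<psi> - (if \<phi> = \<psi> then 1 else 0)) * fac m t \<psi> \<omega>) +
          (\<Sum>x\<in>?I q. w q x * E m t x \<omega>) = Z q t \<omega> - fac m t \<phi> \<omega>"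
        unfolding Z by (simp add: left_diff_distrib sum_subtractf)
    qed
  qed
  have \<delta>_lim: "\<delta> \<longlonglongrightarrow> 0"
  proof -
    have "(\<lambda>q. \<bar>\<rho> (Suc q) \<psi> - (if \<phi> = \<psi> then 1 else 0)\<bar> * cf) \<longlonglongrightarrow> 0" if "\<psi> \<in> facs m" for \<psi>
    proof -
      have "(\<lambda>q. \<rho> q \<psi>) \<longlonglongrightarrow> (if \<phi> = \<psi> then 1 else 0)"
        unfolding \<rho>_def by (rule coef_gram_tendsto[OF m \<phi> that])
      then have "(\<lambda>q. \<bar>\<rho> (Suc q) \<psi> - (if \<phi> = \<psi> then 1 else 0)\<bar> * cf) \<longlonglongrightarrow>
          \<bar>(if \<phi> = \<psi> then 1 else 0) - (if \<phi> = \<psi> then 1 else 0)\<bar> * cf"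
        by (intro tendsto_intros) (rule LIMSEQ_Suc)
      then show ?thesis by simp
    qed
    then have "(\<lambda>q. \<Sum>\<psi>\<in>facs m. \<bar>\<rho> (Suc q) \<psi> - (if \<phi> = \<psi> then 1 else 0)\<bar> * cf) \<longlonglongrightarrow> 0"
      by (rule tendsto_null_sum)
    moreover have "(\<lambda>q. C * cn / sqrt (real (Suc q))) \<longlonglongrightarrow> 0"
      by real_asymp
    ultimately show ?thesis
      unfolding \<delta>_def using tendsto_add by fastforce
  qed
  \<comment> \<open>T stays fixed while \<open>q\<close> tends to infinity. The averages converge in
    L^1, since in each product one factor converges in L^2 and the other is bounded there.\<close>
  have "L2le P (C * (sqrt c / sqrt (real T))) (\<lambda>\<omega>. (1 / real T) * (\<Sum>t<T. fac m t \<phi> \<omega> * E n t i \<omega>))"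
    if T: "1 \<le> T" and i: "i \<in> all_idx (K n)" for T i
  proof (rule L2le_L1_limit[where Y = "\<lambda>q \<omega>. (1 / real T) * (\<Sum>t<T. Z q t \<omega> * E n t i \<omega>)"])
    have noi': "L2le P ce (E n t i)" for t using noi i by blast
    have fac_meas: "fac m t \<phi> \<in> borel_measurable P" for t
      using fac \<phi> by (blast dest: L2leD(2))
    show "L2le P (C * (sqrt c / sqrt (real T))) (\<lambda>\<omega>. (1 / real T) * (\<Sum>t<T. Z q t \<omega> * E n t i \<omega>))" for q
      by (rule ZE[OF T i])
    show "(\<lambda>\<omega>. (1 / real T) * (\<Sum>t<T. fac m t \<phi> \<omega> * E n t i \<omega>)) \<in> borel_measurable P"
      using L2leD(2)[OF noi'] fac_meas by (intro borel_measurable_times borel_measurable_sum) auto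
    have eq: "(1 / real T) * (\<Sum>t<T. Z q t \<omega> * E n t i \<omega>) - (1 / real T) * (\<Sum>t<T. fac m t \<phi> \<omega> * E n t i \<omega>) =
        (1 / real T) * (\<Sum>t<T. (Z q t \<omega> - fac m t \<phi> \<omega>) * E n t i \<omega>)" for q \<omega>
      by (simp add: left_diff_distrib sum_subtractf right_diff_distrib diff_divide_distrib)
    have int: "integrable P (\<lambda>\<omega>. (Z q t \<omega> - fac m t \<phi> \<omega>) * E n t i \<omega>)" for q t
      by (rule L2le_mult(1)[OF Zdiff noi'])
    show "integrable P (\<lambda>\<omega>. (1 / real T) * (\<Sum>t<T. Z q t \<omega> * E n t i \<omega>) -
        (1 / real T) * (\<Sum>t<T. fac m t \<phi> \<omega> * E n t i \<omega>))" for q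
      unfolding eq using int by (intro integrable_mult_right Bochner_Integration.integrable_sum)
    show "(\<lambda>q. \<integral>\<omega>. \<bar>(1 / real T) * (\<Sum>t<T. Z q t \<omega> * E n t i \<omega>) -
        (1 / real T) * (\<Sum>t<T. fac m t \<phi> \<omega> * E n t i \<omega>)\<bar> \<partial>P) \<longlonglongrightarrow> 0"
    proof (rule Lim_null_comparison)
      have "(\<lambda>q. \<delta> q * ce) \<longlonglongrightarrow> 0 * ce"
        by (intro tendsto_intros \<delta>_lim)
      then show "(\<lambda>q. \<delta> q * ce) \<longlonglongrightarrow> 0" by simp
      show "\<forall>\<^sub>F q in sequentially. norm (\<integral>\<omega>. \<bar>(1 / real T) * (\<Sum>t<T. Z q t \<omega> * E n t i \<omega>) -
        (1 / real T) * (\<Sum>t<T. fac m t \<phi> \<omega> * E n t i \<omega>)\<bar> \<partial>P) \<le> \<delta> q * ce"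
      proof (intro always_eventually allI)
        fix q
        have "(\<integral>\<omega>. \<bar>(1 / real T) * (\<Sum>t<T. (Z q t \<omega> - fac m t \<phi> \<omega>) * E n t i \<omega>)\<bar> \<partial>P) \<le>
            (\<integral>\<omega>. (1 / real T) * (\<Sum>t<T. \<bar>(Z q t \<omega> - fac m t \<phi> \<omega>) * E n t i \<omega>\<bar>) \<partial>P)"
        proof (rule integral_mono)
          fix \<omega>
          show "\<bar>(1 / real T) * (\<Sum>t<T. (Z q t \<omega> - fac m t \<phi> \<omega>) * E n t i \<omega>)\<bar> \<le>
              (1 / real T) * (\<Sum>t<T. \<bar>(Z q t \<omega> - fac m t \<phi> \<omega>) * E n t i \<omega>\<bar>)"
            using T by (simp add: abs_mult divide_right_mono) (simp add: abs_mult[symmetric] sum_abs divide_right_mono)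
        qed (use int in \<open>intro integrable_abs integrable_mult_right Bochner_Integration.integrable_sum; auto\<close>)+
        also have "\<dots> = (1 / real T) * (\<Sum>t<T. \<integral>\<omega>. \<bar>(Z q t \<omega> - fac m t \<phi> \<omega>) * E n t i \<omega>\<bar> \<partial>P)"
          using int[THEN integrable_abs] by simp
        also have "\<dots> \<le> (1 / real T) * (\<Sum>t<T. \<delta> q * ce)"
          by (intro mult_left_mono sum_mono L2le_mult(2)[OF Zdiff noi']) auto
        also have "\<dots> = \<delta> q * ce"
          using T by simp
        finally have "(\<integral>\<omega>. \<bar>(1 / real T) * (\<Sum>t<T. (Z q t \<omega> - fac m t \<phi> \<omega>) * E n t i \<omega>)\<bar> \<partial>P) \<le> \<delta> q * ce" .
        then show "norm (\<integral>\<omega>. \<bar>(1 / real T) * (\<Sum>t<T. Z q t \<omega> * E n t i \<omega>) -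
            (1 / real T) * (\<Sum>t<T. fac m t \<phi> \<omega> * E n t i \<omega>)\<bar> \<partial>P) \<le> \<delta> q * ce"
          unfolding eq by (simp add: integral_nonneg_AE)
      qed
    qed
  qed
  \<comment> \<open>The absolute value makes the constant nonnegative without a case distinction on
    \<open>c\<close>.\<close>
  moreover have "L2le P (C * (sqrt c / sqrt (real T))) Y \<Longrightarrow> L2le P (C * \<bar>sqrt c\<bar> / sqrt (real T)) Y" for T Y
    using C(1) by (elim L2le_mono) (simp add: mult_left_mono divide_right_mono)
  ultimately show ?thesis
    using C(1) by (intro exI[of _ "C * \<bar>sqrt c\<bar>"]) auto
qed

end

section \<open>Selections independent of the data\<close>

text \<open>Independence is given between families of events. Passing to the real variables
  \<open>indicator B\<close> and \<open>D\<close> makes the product formula for independent real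
  variables applicable; preimages under the indicator are among four events, whose independence
  follows from that of \<open>B\<close>.\<close>

lemma (in prob_space) expectation_indicator_indep:
  fixes D :: "'a \<Rightarrow> real"
  assumes indep: "indep_set \<A> {Y -` A \<inter> space M | A. A \<in> sets N}"
    and B: "B \<in> \<A>" and Y: "Y \<in> measurable M N"
    and g: "g \<in> borel_measurable N" and D: "\<And>\<omega>. \<omega> \<in> space M \<Longrightarrow> D \<omega> = g (Y \<omega>)" and int: "integrable M D"
  shows "expectation (\<lambda>\<omega>. indicator B \<omega> * D \<omega>) = prob B * expectation D"
proof -
  have Bev: "B \<in> events"
    using indep_setD_ev1[OF indep] B by blast
  let ?I = "{(indicator B :: 'a \<Rightarrow> real) -` A \<inter> space M | A. A \<in> sets borel}"
  let ?J = "{D -` A \<inter> space M | A. A \<in> sets borel}"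
  have J: "D -` A \<inter> space M \<in> {Y -` A \<inter> space M | A. A \<in> sets N}" if "A \<in> sets borel" for A
  proof -
    have "D -` A \<inter> space M = Y -` (g -` A \<inter> space N) \<inter> space M"
      using D measurable_space[OF Y] by auto
    then show ?thesis
      using measurable_sets[OF g that] by blast
  qed
  have I: "(indicator B :: 'a \<Rightarrow> real) -` A \<inter> space M \<in> {{}, B, space M - B, space M}" for A
  proof (cases "1 \<in> A"; cases "0 \<in> A")
    assume "1 \<in> A" "0 \<in> A"
    then have "(indicator B :: 'a \<Rightarrow> real) -` A \<inter> space M = space M" by (auto simp: indicator_def)
    then show ?thesis by simp
  next
    assume "1 \<in> A" "0 \<notin> A"
    then have "(indicator B :: 'a \<Rightarrow> real) -` A \<inter> space M = B"
      using sets.sets_into_space[OF Bev] by (auto simp: indicator_def of_bool_def split: if_splits)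
    then show ?thesis by simp
  next
    assume "1 \<notin> A" "0 \<in> A"
    then have "(indicator B :: 'a \<Rightarrow> real) -` A \<inter> space M = space M - B"
      by (auto simp: indicator_def of_bool_def split: if_splits)
    then show ?thesis by simp
  next
    assume "1 \<notin> A" "0 \<notin> A"
    then have "(indicator B :: 'a \<Rightarrow> real) -` A \<inter> space M = {}"
      by (auto simp: indicator_def of_bool_def split: if_splits)
    then show ?thesis by simp
  qed
  have Dm: "D \<in> borel_measurable M" using int by simp
  have IJ: "indep_set ?I ?J"
  proof (rule indep_setI)
    show "?I \<subseteq> events" using Bev by auto
    show "?J \<subseteq> events" using Dm by (auto intro: measurable_sets)
    fix i j assume i: "i \<in> ?I" and j: "j \<in> ?J"
    have jev: "j \<in> events" using j Dm by (auto intro: measurable_sets)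
    obtain A where A: "A \<in> sets borel" "j = D -` A \<inter> space M" using j by blast
    have Bj: "prob (B \<inter> j) = prob B * prob j"
      unfolding A(2) by (rule indep_setD[OF indep B J[OF A(1)]])
    have "i \<in> {{}, B, space M - B, space M}" using i I by blast
    moreover have "prob ((space M - B) \<inter> j) = prob (space M - B) * prob j"
    proof -
      have "(space M - B) \<inter> j = j - B \<inter> j"
        using sets.sets_into_space[OF jev] by auto
      then have "prob ((space M - B) \<inter> j) = prob j - prob (B \<inter> j)"
        using finite_measure_Diff[of j "B \<inter> j"] jev Bev by auto
      then show ?thesis
        using Bj prob_compl[OF Bev] by (simp add: left_diff_distrib)
    qed
    moreover have "space M \<inter> j = j"
      using sets.sets_into_space[OF jev] by auto
    ultimately show "prob (i \<inter> j) = prob i * prob j"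
      using Bj by (auto simp: prob_space)
  qed
  \<comment> \<open>Closure under intersection lets independence pass from the preimages to the
    generated sigma-algebras.\<close>
  have stable: "Int_stable {f -` A \<inter> space M | A. A \<in> sets borel}" for f :: "'a \<Rightarrow> real"
  proof (rule Int_stableI)
    fix U V assume "U \<in> {f -` A \<inter> space M | A. A \<in> sets borel}" "V \<in> {f -` A \<inter> space M | A. A \<in> sets borel}"
    then obtain A A' where "A \<in> sets borel" "A' \<in> sets borel" "U = f -` A \<inter> space M" "V = f -` A' \<inter> space M"
      by blast
    then have "U \<inter> V = f -` (A \<inter> A') \<inter> space M" "A \<inter> A' \<in> sets borel" by auto
    then show "U \<inter> V \<in> {f -` A \<inter> space M | A. A \<in> sets borel}" by blast
  qed
  have "indep_var borel (indicator B :: 'a \<Rightarrow> real) borel D"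
    unfolding indep_var_eq using Bev Dm indep_set_sigma_sets[OF IJ stable stable] by auto
  then have "expectation (\<lambda>\<omega>. indicator B \<omega> * D \<omega>) = expectation (indicator B) * expectation D"
    using Bev int by (intro indep_var_lebesgue_integral) (auto simp: integrable_real_indicator emeasure_eq_measure)
  then show ?thesis
    using Bev by simp
qed

text \<open>Since the selection is independent of the data, selecting does not inflate the mean.\<close>

lemma (in prob_space) selected_sum_bound:
  fixes D :: "'i \<Rightarrow> 'a \<Rightarrow> real"
  assumes N: "finite N" and S: "S \<in> measurable M (count_space (Pow N))" "\<And>\<omega>. \<omega> \<in> space M \<Longrightarrow> S \<omega> \<noteq> {}"
    and indep: "indep_set {S -` A \<inter> space M | A. A \<in> sets (count_space (Pow N))} {Y -` A \<inter> space M | A. A \<in> sets NY}"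
    and Y: "Y \<in> measurable M NY" and g: "\<And>i. i \<in> N \<Longrightarrow> g i \<in> borel_measurable NY"
    and D: "\<And>i \<omega>. i \<in> N \<Longrightarrow> \<omega> \<in> space M \<Longrightarrow> D i \<omega> = g i (Y \<omega>)"
    and int: "\<And>i. i \<in> N \<Longrightarrow> integrable M (D i)" and D0: "\<And>i \<omega>. 0 \<le> D i \<omega>"
    and c: "\<And>i. i \<in> N \<Longrightarrow> expectation (D i) \<le> c" and A: "0 < A"
  shows "\<exists>B\<in>events. prob B \<ge> 1 - c / A \<and> (\<forall>\<omega>\<in>B. (\<Sum>i\<in>S \<omega>. D i \<omega>) \<le> A * real (card (S \<omega>)))"
proof -
  have SN: "S \<omega> \<subseteq> N" if "\<omega> \<in> space M" for \<omega>
    using measurable_space[OF S(1) that] by simp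
  define L where "L = Pow N - {{}}"
  have L: "finite L" using N by (simp add: L_def)
  define U where "U s = S -` {s} \<inter> space M" for s
  have U: "U s \<in> {S -` A \<inter> space M | A. A \<in> sets (count_space (Pow N))}" if "s \<in> L" for s
    using that by (auto simp: U_def L_def)
  have Uev: "U s \<in> events" if "s \<in> L" for s
    using indep_setD_ev1[OF indep] U[OF that] by blast
  \<comment> \<open>Averages over a fixed nonempty set have mean at most \<open>c\<close> whatever
    the set; dividing by the size absorbs the random number of selected indices.\<close>
  define h where "h s \<omega> = (\<Sum>i\<in>s. D i \<omega>) / real (card s)" for s \<omega>
  have hint: "integrable M (h s)" if "s \<in> L" for s
    unfolding h_def using that int by (intro integrable_divide Bochner_Integration.integrable_sum) (auto simp: L_def)
  have hc: "expectation (h s) \<le> c" if s: "s \<in> L" for s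
  proof -
    have fs: "finite s" "0 < card s"
      using s N by (auto simp: L_def card_gt_0_iff intro: finite_subset)
    have "expectation (h s) = (\<Sum>i\<in>s. expectation (D i)) / real (card s)"
      unfolding h_def using s int by (simp add: L_def subset_eq)
    also have "\<dots> \<le> (\<Sum>i\<in>s. c) / real (card s)"
      using s c by (intro divide_right_mono sum_mono) (auto simp: L_def)
    also have "\<dots> = c" using fs by (auto simp: card_gt_0_iff)
    finally show ?thesis .
  qed
  \<comment> \<open>The finitely many events that the selection equals s partition the space, so
    \<open>W\<close> is the average over the random selection.\<close>
  define W where "W \<omega> = (\<Sum>s\<in>L. indicator (U s) \<omega> * h s \<omega>)" for \<omega>
  have W_eq: "W \<omega> = h (S \<omega>) \<omega>" if \<omega>: "\<omega> \<in> space M" for \<omega>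
  proof -
    have "S \<omega> \<in> L" using SN[OF \<omega>] S(2)[OF \<omega>] by (auto simp: L_def)
    have "W \<omega> = (\<Sum>s\<in>L. if s = S \<omega> then h s \<omega> else 0)"
      unfolding W_def using \<omega> by (intro sum.cong refl) (auto simp: U_def indicator_def)
    also have "\<dots> = h (S \<omega>) \<omega>"
      using \<open>S \<omega> \<in> L\<close> L by simp
    finally show ?thesis .
  qed
  have hU: "integrable M (\<lambda>\<omega>. indicator (U s) \<omega> * h s \<omega>)" if "s \<in> L" for s
    using integrable_mult_indicator[OF Uev[OF that] hint[OF that]] by simp
  have W_int: "integrable M W"
    unfolding W_def using hU by (intro Bochner_Integration.integrable_sum)
  have h0: "0 \<le> h s \<omega>" for s \<omega>
    by (auto simp: h_def D0 intro!: divide_nonneg_nonneg sum_nonneg)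
  have W0: "0 \<le> W \<omega>" for \<omega>
    unfolding W_def by (auto intro!: sum_nonneg simp: h0)
  have c0: "0 \<le> c"
  proof -
    obtain \<omega> where "\<omega> \<in> space M" using not_empty by blast
    then obtain i where "i \<in> N" using SN S(2) by blast
    then show ?thesis
      using c[of i] integral_nonneg_AE[where M = M and f = "D i"] D0 by fastforce
  qed
  have "expectation W = (\<Sum>s\<in>L. expectation (\<lambda>\<omega>. indicator (U s) \<omega> * h s \<omega>))"
    unfolding W_def using hU by (rule Bochner_Integration.integral_sum)
  also have "\<dots> \<le> (\<Sum>s\<in>L. prob (U s) * c)"
  proof (rule sum_mono)
    fix s assume s: "s \<in> L"
    have "expectation (\<lambda>\<omega>. indicator (U s) \<omega> * h s \<omega>) = prob (U s) * expectation (h s)"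
    proof (rule expectation_indicator_indep[OF indep U[OF s] Y, where g = "\<lambda>y. (\<Sum>i\<in>s. g i y) / real (card s)"])
      show "(\<lambda>y. (\<Sum>i\<in>s. g i y) / real (card s)) \<in> borel_measurable NY"
        using s g by (intro borel_measurable_divide borel_measurable_sum) (auto simp: L_def)
      show "h s \<omega> = (\<Sum>i\<in>s. g i (Y \<omega>)) / real (card s)" if "\<omega> \<in> space M" for \<omega>
        unfolding h_def using s that by (intro arg_cong2[where f = "(/)"] sum.cong refl D) (auto simp: L_def)
    qed (rule hint[OF s])
    also have "\<dots> \<le> prob (U s) * c"
      using hc[OF s] by (intro mult_left_mono) auto
    finally show "expectation (\<lambda>\<omega>. indicator (U s) \<omega> * h s \<omega>) \<le> prob (U s) * c" .
  qed
  also have "\<dots> = (\<Sum>s\<in>L. prob (U s)) * c"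
    by (simp add: sum_distrib_right)
  also have "(\<Sum>s\<in>L. prob (U s)) = prob (\<Union>s\<in>L. U s)"
    using L Uev by (intro finite_measure_finite_Union[symmetric]) (auto simp: disjoint_family_on_def U_def)
  also have "prob (\<Union>s\<in>L. U s) * c \<le> 1 * c"
    using c0 by (intro mult_right_mono prob_le_1)
  finally have EW: "expectation W \<le> c" by simp
  have Wm: "W \<in> borel_measurable M" using W_int by simp
  have "prob {\<omega> \<in> space M. A \<le> W \<omega>} \<le> expectation W / A"
    using W_int W0 A by (intro integral_Markov_inequality_measure[where A = "{}"]) auto
  also have "\<dots> \<le> c / A"
    using EW A by (intro divide_right_mono) auto
  finally have "prob {\<omega> \<in> space M. A \<le> W \<omega>} \<le> c / A" .
  moreover have "{\<omega> \<in> space M. A \<le> W \<omega>} \<in> events" using Wm by measurable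
  ultimately have "prob (space M - {\<omega> \<in> space M. A \<le> W \<omega>}) \<ge> 1 - c / A"
    by (simp add: prob_compl)
  moreover have "(\<Sum>i\<in>S \<omega>. D i \<omega>) \<le> A * real (card (S \<omega>))"
    if "\<omega> \<in> space M - {\<omega> \<in> space M. A \<le> W \<omega>}" for \<omega>
  proof -
    have \<omega>: "\<omega> \<in> space M" and lt: "W \<omega> < A" using that by auto
    have "0 < card (S \<omega>)"
      using SN[OF \<omega>] S(2)[OF \<omega>] N by (auto simp: card_gt_0_iff intro: finite_subset)
    then show ?thesis
      using lt W_eq[OF \<omega>] by (simp add: h_def pos_divide_less_eq)
  qed
  ultimately show ?thesis
    using \<open>{\<omega> \<in> space M. A \<le> W \<omega>} \<in> events\<close>
    by (intro bexI[of _ "space M - {\<omega> \<in> space M. A \<le> W \<omega>}"]) auto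
qed

section \<open>Signal and deviation of the cross moments\<close>

context factor_model
begin

lemma cross_threadD:
  assumes "m < M" "n < M" "n \<noteq> m"
  shows "\<And>t i j. i \<in> all_idx (K m) \<Longrightarrow> j \<in> all_idx (K n) \<Longrightarrow> cov P (X m t i) (E n t j) = 0"
    "\<exists>c. product_var_le P c (all_idx (K m)) (X m) (all_idx (K n)) (E n) \<and>
          product_var_le P c (idx (K m) (r m)) (G m) (idx (K n) (u n)) (F n) \<and>
          product_var_le P c (idx (K m) (u m)) (F m) (idx (K n) (u n)) (F n) \<and>
          product_var_le P c (idx (K m) (r m)) (G m) (idx (K n) (r n)) (G n)"
proof -
  note ct = cross_thread[unfolded cross_thread_condition_def, THEN spec, THEN mp, OF assms(1),
        THEN spec, THEN mp, OF assms(2), THEN mp, OF assms(3)]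
  show "\<And>t i j. i \<in> all_idx (K m) \<Longrightarrow> j \<in> all_idx (K n) \<Longrightarrow> cov P (X m t i) (E n t j) = 0"
    using ct by blast
  show "\<exists>c. product_var_le P c (all_idx (K m)) (X m) (all_idx (K n)) (E n) \<and>
          product_var_le P c (idx (K m) (r m)) (G m) (idx (K n) (u n)) (F n) \<and>
          product_var_le P c (idx (K m) (u m)) (F m) (idx (K n) (u n)) (F n) \<and>
          product_var_le P c (idx (K m) (r m)) (G m) (idx (K n) (r n)) (G n)"
    using ct ..
qed

lemma fac_simps: "fac m t (Inl j) = G m t j" "fac m t (Inr j) = F m t j"
  by (simp_all add: fac_def)

lemma local_factor_product_mean:
  assumes m: "m < M" and n: "n < M" "n \<noteq> m" and \<phi>: "\<phi> \<in> facs m" and j: "j \<in> idx (K n) (u n)"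
  shows "expectation (\<lambda>\<omega>. fac m t \<phi> \<omega> * F n t j \<omega>) = 0"
proof -
  have "mean_zero P (F n t j)"
    using fac_mean_zero[OF n(1), of "Inr j" t] j by (auto simp: facs_def fac_def)
  moreover have "cov P (fac m t \<phi>) (F n t j) = 0"
    using \<phi>
  proof (cases rule: facsE)
    case (1 i)
    then show ?thesis
      using identification m n j unfolding identification_condition_def by (simp add: fac_def)
  next
    case (2 i)
    then show ?thesis
      using identification m n j unfolding identification_condition_def by (simp add: fac_def)
  qed
  ultimately show ?thesis
    using fac_mean_zero[OF m \<phi>] by (intro cov_zero_product)
qed

definition product_deviation :: "nat \<Rightarrow> nat \<Rightarrow> nat \<Rightarrow> midx + midx \<Rightarrow> midx + midx \<Rightarrow> 'w \<Rightarrow> real" where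
  "product_deviation T m n \<phi> \<psi> \<omega> = (1 / real T) *
    (\<Sum>t<T. fac m t \<phi> \<omega> * fac n t \<psi> \<omega> - expectation (\<lambda>\<omega>. fac m t \<phi> \<omega> * fac n t \<psi> \<omega>))"

text \<open>Three of the four combinations are clauses of the cross-thread condition as they stand;
  a local factor of thread m with a global factor of thread n is covered after exchanging the two
  threads.\<close>

lemma factor_product_deviation:
  assumes m: "m < M" and n: "n < M" "n \<noteq> m" and \<phi>: "\<phi> \<in> facs m" and \<psi>: "\<psi> \<in> facs n"
  shows "\<exists>C\<ge>0. \<forall>T\<ge>1. L2le P (C / sqrt (real T)) (product_deviation T m n \<phi> \<psi>)"
proof -
  obtain c where c: "product_var_le P c (idx (K m) (r m)) (G m) (idx (K n) (u n)) (F n)"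
      "product_var_le P c (idx (K m) (u m)) (F m) (idx (K n) (u n)) (F n)"
      "product_var_le P c (idx (K m) (r m)) (G m) (idx (K n) (r n)) (G n)"
    using cross_threadD(2)[OF m n] by blast
  obtain c' where c': "product_var_le P c' (idx (K n) (r n)) (G n) (idx (K m) (u m)) (F m)"
    using cross_threadD(2)[OF n(1) m] n(2) by blast
  have L4: "L4 P (fac m t \<phi>)" "L4 P (fac n t \<psi>)" for t
    using fac_moments[OF m] fac_moments[OF n(1)] \<phi> \<psi> by blast+
  have "\<exists>d. \<forall>T\<ge>1. L2le P (sqrt d / sqrt (real T)) (product_deviation T m n \<phi> \<psi>)"
    using \<phi>
  proof (cases rule: facsE)
    case (1 i)
    show ?thesis
      using \<psi>
    proof (cases rule: facsE)
      case (1 j)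
      show ?thesis
        using avg_product_L2le[OF _ _ c(3), of i j] L4 \<open>\<phi> = Inl i\<close> \<open>i \<in> _\<close> 1
        by (intro exI[of _ c]) (simp add: product_deviation_def[abs_def] fac_simps)
    next
      case (2 j)
      show ?thesis
        using avg_product_L2le[OF _ _ c(1), of i j] L4 \<open>\<phi> = Inl i\<close> \<open>i \<in> _\<close> 2
        by (intro exI[of _ c]) (simp add: product_deviation_def[abs_def] fac_simps)
    qed
  next
    case (2 i)
    show ?thesis
      using \<psi>
    proof (cases rule: facsE)
      case (1 j)
      show ?thesis
        using avg_product_L2le[OF _ _ c', of j i] L4 \<open>\<phi> = Inr i\<close> \<open>i \<in> _\<close> 1
        by (intro exI[of _ c']) (simp add: product_deviation_def[abs_def] fac_simps mult.commute)
    next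
      case (2 j)
      show ?thesis
        using avg_product_L2le[OF _ _ c(2), of i j] L4 \<open>\<phi> = Inr i\<close> \<open>i \<in> _\<close> 2
        by (intro exI[of _ c]) (simp add: product_deviation_def[abs_def] fac_simps)
    qed
  qed
  then obtain d where d: "\<forall>T\<ge>1. L2le P (sqrt d / sqrt (real T)) (product_deviation T m n \<phi> \<psi>)" ..
  have "0 \<le> sqrt d / sqrt (real 1)"
    using d L2leD(1) by blast
  with d show ?thesis by (intro exI[of _ "sqrt d"]) auto
qed

text \<open>The time-averaged cross moment of two core tensors: \<open>cross_moment\<close> with the
  Kronecker product of the test matrices stripped off.\<close>

definition \<theta> :: "nat \<Rightarrow> nat \<Rightarrow> nat \<Rightarrow> midx \<Rightarrow> midx \<Rightarrow> real" where
  "\<theta> T m n j j' = (1 / real T) * (\<Sum>t<T. expectation (\<lambda>\<omega>. G m t j \<omega> * G n t j' \<omega>))"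

definition signal :: "nat \<Rightarrow> nat \<Rightarrow> nat \<Rightarrow> midx \<Rightarrow> midx \<Rightarrow> real" where
  "signal T m n x i = (\<Sum>j\<in>idx (K m) (r m). \<Sum>j'\<in>idx (K n) (r n).
     coef m x (Inl j) * coef n i (Inl j') * \<theta> T m n j j')"

definition deviation :: "nat \<Rightarrow> nat \<Rightarrow> nat \<Rightarrow> midx \<Rightarrow> midx \<Rightarrow> 'w \<Rightarrow> real" where
  "deviation T m n x i \<omega> = (1 / real T) * (\<Sum>t<T. X m t x \<omega> * X n t i \<omega>) - signal T m n x i"

text \<open>Moments involving a local factor vanish, so the sum over global factors may be extended
  to all pairs. In this form it matches the expansion of a product of two observations term by
  term.\<close>

lemma signal_eq:
  assumes m: "m < M" and n: "n < M" "n \<noteq> m"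
  shows "signal T m n x i = (\<Sum>\<phi>\<in>facs m. \<Sum>\<psi>\<in>facs n. coef m x \<phi> * coef n i \<psi> *
    ((1 / real T) * (\<Sum>t<T. expectation (\<lambda>\<omega>. fac m t \<phi> \<omega> * fac n t \<psi> \<omega>))))"
proof -
  have 1: "expectation (\<lambda>\<omega>. fac m t \<phi> \<omega> * F n t j \<omega>) = 0" if "\<phi> \<in> facs m" "j \<in> idx (K n) (u n)" for \<phi> j t
    using local_factor_product_mean[OF m n that] .
  have 2: "expectation (\<lambda>\<omega>. F m t i \<omega> * fac n t \<psi> \<omega>) = 0" if "\<psi> \<in> facs n" "i \<in> idx (K m) (u m)" for \<psi> i t
    using local_factor_product_mean[OF n(1) m _ that] n(2) by (simp add: mult.commute)
  have "(\<Sum>\<psi>\<in>facs n. coef m x \<phi> * coef n i \<psi> *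
    ((1 / real T) * (\<Sum>t<T. expectation (\<lambda>\<omega>. fac m t \<phi> \<omega> * fac n t \<psi> \<omega>)))) =
    (\<Sum>j'\<in>idx (K n) (r n). coef m x \<phi> * coef n i (Inl j') *
    ((1 / real T) * (\<Sum>t<T. expectation (\<lambda>\<omega>. fac m t \<phi> \<omega> * G n t j' \<omega>))))" if "\<phi> \<in> facs m" for \<phi>
    using 1[OF that] unfolding facs_def[of n] by (subst sum.Plus) (simp_all add: fac_simps)
  moreover have "(\<Sum>\<phi>\<in>facs m. \<Sum>j'\<in>idx (K n) (r n). coef m x \<phi> * coef n i (Inl j') *
    ((1 / real T) * (\<Sum>t<T. expectation (\<lambda>\<omega>. fac m t \<phi> \<omega> * G n t j' \<omega>)))) = signal T m n x i"
  proof -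
    have "expectation (\<lambda>\<omega>. F m t i \<omega> * G n t j \<omega>) = 0" if "j \<in> idx (K n) (r n)" "i \<in> idx (K m) (u m)" for i j t
      using 2[of "Inl j" i t] that by (auto simp: facs_def fac_simps)
    then show ?thesis
      unfolding facs_def[of m] signal_def \<theta>_def by (subst sum.Plus) (simp_all add: fac_simps)
  qed
  ultimately show ?thesis by simp
qed

text \<open>With s and s' the factor parts, the product of observations splits as s s' + s E_n + E_m
  X_n. Keeping the last term whole avoids products of two noises: the cross-thread condition covers
  it with the threads exchanged, and only s E_n relies on \<open>factor_times_noise\<close>.\<close>

lemma deviation_L2le:
  assumes m: "m < M" and n: "n < M" "n \<noteq> m"
  shows "\<exists>C\<ge>0. \<forall>T\<ge>1. \<forall>x\<in>all_idx (K m). \<forall>i\<in>all_idx (K n). L2le P (C / sqrt (real T)) (deviation T m n x i)"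
proof -
  \<comment> \<open>Constants are fixed per pair of factors before T and the indices vary, so the
    final constant is uniform in both.\<close>
  define C1 where "C1 \<phi> \<psi> = (SOME C. 0 \<le> C \<and> (\<forall>T\<ge>1. L2le P (C / sqrt (real T)) (product_deviation T m n \<phi> \<psi>)))" for \<phi> \<psi>
  have "0 \<le> C1 \<phi> \<psi> \<and> (\<forall>T\<ge>1. L2le P (C1 \<phi> \<psi> / sqrt (real T)) (product_deviation T m n \<phi> \<psi>))"
    if "\<phi> \<in> facs m" "\<psi> \<in> facs n" for \<phi> \<psi>
    unfolding C1_def by (rule someI_ex[OF factor_product_deviation[OF m n that]])
  then have C1: "\<forall>\<phi>\<in>facs m. \<forall>\<psi>\<in>facs n. 0 \<le> C1 \<phi> \<psi> \<and> (\<forall>T\<ge>1. L2le P (C1 \<phi> \<psi> / sqrt (real T)) (product_deviation T m n \<phi> \<psi>))"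
    by blast
  define C2 where "C2 \<phi> = (SOME C. 0 \<le> C \<and> (\<forall>T\<ge>1. \<forall>i\<in>all_idx (K n).
    L2le P (C / sqrt (real T)) (\<lambda>\<omega>. (1 / real T) * (\<Sum>t<T. fac m t \<phi> \<omega> * E n t i \<omega>))))" for \<phi>
  have "0 \<le> C2 \<phi> \<and> (\<forall>T\<ge>1. \<forall>i\<in>all_idx (K n).
    L2le P (C2 \<phi> / sqrt (real T)) (\<lambda>\<omega>. (1 / real T) * (\<Sum>t<T. fac m t \<phi> \<omega> * E n t i \<omega>)))"
    if "\<phi> \<in> facs m" for \<phi>
    unfolding C2_def by (rule someI_ex[OF factor_times_noise[OF m n that]])
  then have C2: "\<forall>\<phi>\<in>facs m. 0 \<le> C2 \<phi> \<and> (\<forall>T\<ge>1. \<forall>i\<in>all_idx (K n).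
    L2le P (C2 \<phi> / sqrt (real T)) (\<lambda>\<omega>. (1 / real T) * (\<Sum>t<T. fac m t \<phi> \<omega> * E n t i \<omega>)))"
    by blast
  obtain c where c: "product_var_le P c (all_idx (K n)) (X n) (all_idx (K m)) (E m)"
    using cross_threadD(2)[OF n(1) m] n(2) by blast
  obtain Am where Am: "Am \<ge> 0" "\<forall>\<phi>\<in>facs m. \<forall>i. \<bar>coef m i \<phi>\<bar> \<le> Am"
    using coef_bounded[OF m] by blast
  obtain An where An: "An \<ge> 0" "\<forall>\<phi>\<in>facs n. \<forall>i. \<bar>coef n i \<phi>\<bar> \<le> An"
    using coef_bounded[OF n(1)] by blast
  define C where "C = (\<Sum>\<phi>\<in>facs m. \<Sum>\<psi>\<in>facs n. Am * An * C1 \<phi> \<psi>) + ((\<Sum>\<phi>\<in>facs m. Am * C2 \<phi>) + \<bar>sqrt c\<bar>)"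
  have "L2le P (C / sqrt (real T)) (deviation T m n x i)"
    if T: "1 \<le> T" and x: "x \<in> all_idx (K m)" and i: "i \<in> all_idx (K n)" for T x i
  proof -
    have EX0: "expectation (\<lambda>\<omega>. X n t i \<omega> * E m t x \<omega>) = 0" for t
      using cross_threadD(1)[OF n(1) m _ i x] n(2) by (intro cov_zero_product X_mean_zero noise_mean_zero m n x i) auto
    then have EX0': "expectation (\<lambda>\<omega>. E m t x \<omega> * X n t i \<omega>) = 0" for t
      by (simp add: mult.commute)
    have L4E: "L4 P (E m t x)" for t using noise_moments[OF m] x by blast
    have 3: "L2le P (\<bar>sqrt c\<bar> / sqrt (real T)) (\<lambda>\<omega>. (1 / real T) * (\<Sum>t<T. E m t x \<omega> * X n t i \<omega>))"
    proof (rule L2le_mono)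
      show "L2le P (sqrt c / sqrt (real T)) (\<lambda>\<omega>. (1 / real T) * (\<Sum>t<T. E m t x \<omega> * X n t i \<omega>))"
        using avg_product_L2le[OF X_L4[OF n(1) i] L4E c i x T] by (simp add: EX0 EX0' mult.commute)
    qed (simp add: divide_right_mono)
    have 2: "L2le P ((\<Sum>\<phi>\<in>facs m. Am * C2 \<phi>) / sqrt (real T))
        (\<lambda>\<omega>. \<Sum>\<phi>\<in>facs m. coef m x \<phi> * ((1 / real T) * (\<Sum>t<T. fac m t \<phi> \<omega> * E n t i \<omega>)))"
    proof (rule L2le_mono)
      show "L2le P (\<Sum>\<phi>\<in>facs m. \<bar>coef m x \<phi>\<bar> * (C2 \<phi> / sqrt (real T)))
        (\<lambda>\<omega>. \<Sum>\<phi>\<in>facs m. coef m x \<phi> * ((1 / real T) * (\<Sum>t<T. fac m t \<phi> \<omega> * E n t i \<omega>)))"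
        using C2 T i by (intro L2le_sum L2le_cmult) auto
      show "(\<Sum>\<phi>\<in>facs m. \<bar>coef m x \<phi>\<bar> * (C2 \<phi> / sqrt (real T))) \<le> (\<Sum>\<phi>\<in>facs m. Am * C2 \<phi>) / sqrt (real T)"
        unfolding sum_divide_distrib times_divide_eq_right using Am C2
        by (intro sum_mono divide_right_mono mult_right_mono) auto
    qed
    have 1: "L2le P ((\<Sum>\<phi>\<in>facs m. \<Sum>\<psi>\<in>facs n. Am * An * C1 \<phi> \<psi>) / sqrt (real T))
        (\<lambda>\<omega>. \<Sum>\<phi>\<in>facs m. \<Sum>\<psi>\<in>facs n. coef m x \<phi> * coef n i \<psi> * product_deviation T m n \<phi> \<psi> \<omega>)"
    proof (rule L2le_mono)
      show "L2le P (\<Sum>\<phi>\<in>facs m. \<Sum>\<psi>\<in>facs n. \<bar>coef m x \<phi> * coef n i \<psi>\<bar> * (C1 \<phi> \<psi> / sqrt (real T)))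
        (\<lambda>\<omega>. \<Sum>\<phi>\<in>facs m. \<Sum>\<psi>\<in>facs n. coef m x \<phi> * coef n i \<psi> * product_deviation T m n \<phi> \<psi> \<omega>)"
        using C1 T by (intro L2le_sum L2le_cmult) auto
      show "(\<Sum>\<phi>\<in>facs m. \<Sum>\<psi>\<in>facs n. \<bar>coef m x \<phi> * coef n i \<psi>\<bar> * (C1 \<phi> \<psi> / sqrt (real T))) \<le>
          (\<Sum>\<phi>\<in>facs m. \<Sum>\<psi>\<in>facs n. Am * An * C1 \<phi> \<psi>) / sqrt (real T)"
        unfolding sum_divide_distrib times_divide_eq_right abs_mult using Am An C1
        by (intro sum_mono divide_right_mono mult_right_mono mult_mono) auto
    qed
    have "L2le P (C / sqrt (real T)) (\<lambda>\<omega>. (\<Sum>\<phi>\<in>facs m. \<Sum>\<psi>\<in>facs n. coef m x \<phi> * coef n i \<psi> * product_deviation T m n \<phi> \<psi> \<omega>) +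
        ((\<Sum>\<phi>\<in>facs m. coef m x \<phi> * ((1 / real T) * (\<Sum>t<T. fac m t \<phi> \<omega> * E n t i \<omega>))) +
        (1 / real T) * (\<Sum>t<T. E m t x \<omega> * X n t i \<omega>)))"
      unfolding C_def add_divide_distrib by (intro L2le_add 1 2 3)
    then show ?thesis
    proof (rule L2le_cong)
      fix \<omega> assume \<omega>: "\<omega> \<in> space P"
      define s where "s t = (\<Sum>\<phi>\<in>facs m. coef m x \<phi> * fac m t \<phi> \<omega>)" for t
      define s' where "s' t = (\<Sum>\<psi>\<in>facs n. coef n i \<psi> * fac n t \<psi> \<omega>)" for t
      have Xm: "X m t x \<omega> = s t + E m t x \<omega>" for t
        by (simp add: model_eq[OF m x \<omega>] s_def)
      have Xn: "X n t i \<omega> = s' t + E n t i \<omega>" for t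
        by (simp add: model_eq[OF n(1) i \<omega>] s'_def)
      have a: "(\<Sum>\<phi>\<in>facs m. \<Sum>\<psi>\<in>facs n. coef m x \<phi> * coef n i \<psi> * product_deviation T m n \<phi> \<psi> \<omega>) =
          (1 / real T) * (\<Sum>t<T. s t * s' t) - signal T m n x i"
      proof -
        have "(\<Sum>t<T. s t * s' t) = (\<Sum>t<T. \<Sum>\<phi>\<in>facs m. \<Sum>\<psi>\<in>facs n. coef m x \<phi> * coef n i \<psi> * (fac m t \<phi> \<omega> * fac n t \<psi> \<omega>))"
          unfolding s_def s'_def sum_product by (intro sum.cong refl) (simp add: mult_ac)
        also have "\<dots> = (\<Sum>\<phi>\<in>facs m. \<Sum>t<T. \<Sum>\<psi>\<in>facs n. coef m x \<phi> * coef n i \<psi> * (fac m t \<phi> \<omega> * fac n t \<psi> \<omega>))"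
          by (rule sum.swap)
        also have "\<dots> = (\<Sum>\<phi>\<in>facs m. \<Sum>\<psi>\<in>facs n. \<Sum>t<T. coef m x \<phi> * coef n i \<psi> * (fac m t \<phi> \<omega> * fac n t \<psi> \<omega>))"
          by (rule sum.cong[OF refl], rule sum.swap)
        finally have "(1 / real T) * (\<Sum>t<T. s t * s' t) = (\<Sum>\<phi>\<in>facs m. \<Sum>\<psi>\<in>facs n. coef m x \<phi> * coef n i \<psi> *
            ((1 / real T) * (\<Sum>t<T. fac m t \<phi> \<omega> * fac n t \<psi> \<omega>)))"
          by (simp add: sum_distrib_left mult_ac)
        then show ?thesis
          unfolding signal_eq[OF m n] product_deviation_def by (simp only: sum_subtractf right_diff_distrib)
      qed
      have b: "(\<Sum>\<phi>\<in>facs m. coef m x \<phi> * ((1 / real T) * (\<Sum>t<T. fac m t \<phi> \<omega> * E n t i \<omega>))) =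
          (1 / real T) * (\<Sum>t<T. s t * E n t i \<omega>)"
      proof -
        have "(\<Sum>t<T. s t * E n t i \<omega>) = (\<Sum>t<T. \<Sum>\<phi>\<in>facs m. coef m x \<phi> * (fac m t \<phi> \<omega> * E n t i \<omega>))"
          by (simp add: s_def sum_distrib_right mult.assoc)
        also have "\<dots> = (\<Sum>\<phi>\<in>facs m. \<Sum>t<T. coef m x \<phi> * (fac m t \<phi> \<omega> * E n t i \<omega>))"
          by (rule sum.swap)
        finally show ?thesis by (simp add: sum_distrib_left mult_ac)
      qed
      have "(\<Sum>t<T. X m t x \<omega> * X n t i \<omega>) =
          (\<Sum>t<T. s t * s' t) + ((\<Sum>t<T. s t * E n t i \<omega>) + (\<Sum>t<T. E m t x \<omega> * X n t i \<omega>))"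
        unfolding sum.distrib[symmetric] by (intro sum.cong refl) (simp add: Xm Xn algebra_simps)
      then show "(\<Sum>\<phi>\<in>facs m. \<Sum>\<psi>\<in>facs n. coef m x \<phi> * coef n i \<psi> * product_deviation T m n \<phi> \<psi> \<omega>) +
        ((\<Sum>\<phi>\<in>facs m. coef m x \<phi> * ((1 / real T) * (\<Sum>t<T. fac m t \<phi> \<omega> * E n t i \<omega>))) +
        (1 / real T) * (\<Sum>t<T. E m t x \<omega> * X n t i \<omega>)) = deviation T m n x i \<omega>"
        unfolding a b deviation_def by (simp only: distrib_left)
    qed
  qed
  moreover have "0 \<le> C"
    using C1 C2 Am An unfolding C_def by (intro add_nonneg_nonneg sum_nonneg mult_nonneg_nonneg) auto
  ultimately show ?thesis by blast
qed

text \<open>Scaling by p_m / T and by the number of selected indices makes \<open>A\<close> a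
  dimension-free constant.\<close>

definition deviation_bound :: "real \<Rightarrow> nat \<Rightarrow> dims \<Rightarrow> nat \<Rightarrow> nat \<Rightarrow> midx set \<Rightarrow> 'w \<Rightarrow> bool" where
  "deviation_bound A T p m n S \<omega> \<longleftrightarrow> (\<Sum>i\<in>S. \<Sum>x\<in>idx (K m) (p m). (deviation T m n x i \<omega>)\<^sup>2) \<le>
     A * (real (\<Prod>h<K m. p m h) / real T) * real (card S)"

lemma selected_deviation:
  assumes m: "m < M" and n: "n < M" "n \<noteq> m"
  shows "\<exists>C\<ge>0. \<forall>T\<ge>1. \<forall>p S A. independent_index_set P M K X T p n S \<longrightarrow> 0 < A \<longrightarrow>
    (\<exists>B\<in>events. prob B \<ge> 1 - C / A \<and> (\<forall>\<omega>\<in>B.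
      deviation_bound A T p m n (S \<omega>) \<omega>))"
proof -
  obtain C where C: "0 \<le> C" "\<forall>T\<ge>1. \<forall>x\<in>all_idx (K m). \<forall>i\<in>all_idx (K n). L2le P (C / sqrt (real T)) (deviation T m n x i)"
    using deviation_L2le[OF m n] by blast
  have "\<exists>B\<in>events. prob B \<ge> 1 - C\<^sup>2 / A \<and> (\<forall>\<omega>\<in>B.
      deviation_bound A T p m n (S \<omega>) \<omega>)"
    if T: "1 \<le> T" and S: "independent_index_set P M K X T p n S" and A: "0 < A" for T p S A
  \<comment> \<open>If thread m has no entries, the threshold in Markov's inequality would be 0; all
    sums are empty then.\<close>
  proof (cases "(\<Prod>h<K m. p m h) = 0")
    case True
    then have "idx (K m) (p m) = {}"
      using card_idx[of "K m" "p m"] by (metis card_0_eq finite_idx)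
    then show ?thesis
      using T A by (intro bexI[of _ "space P"]) (auto simp: deviation_bound_def prob_space intro!: divide_nonneg_nonneg mult_nonneg_nonneg prod_nonneg)
  next
    case False
    let ?N = "idx (K n) (p n)" and ?NX = "PiM (data M K T p) (\<lambda>_. borel :: real measure)"
    let ?Y = "\<lambda>\<omega>. \<lambda>(m, t, i)\<in>data M K T p. X m t i \<omega>"
    define v where "v = real (\<Prod>h<K m. p m h) / real T"
    have v: "0 < v" unfolding v_def using False T by (intro divide_pos_pos) (auto intro!: prod_pos)
    have S1: "S \<in> measurable P (count_space (Pow ?N))" "\<And>\<omega>. \<omega> \<in> space P \<Longrightarrow> S \<omega> \<noteq> {}"
      and indep: "indep_set {S -` A \<inter> space P | A. A \<in> sets (count_space (Pow ?N))} {?Y -` A \<inter> space P | A. A \<in> sets ?NX}"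
      using S unfolding independent_index_set_def Let_def by auto
    have all: "x \<in> all_idx (K m)" if "x \<in> idx (K m) (p m)" for x
      using idx_subset_all_idx that by blast
    have all': "i \<in> all_idx (K n)" if "i \<in> ?N" for i
      using idx_subset_all_idx that by blast
    have Ym: "?Y \<in> measurable P ?NX"
    proof (rule measurable_restrict)
      fix z assume "z \<in> data M K T p"
      then obtain m t i where z: "z = (m, t, i)" "m < M" "i \<in> idx (K m) (p m)"
        by (auto simp: data_def)
      then have "L4 P (X m t i)"
        using idx_subset_all_idx by (intro X_L4) auto
      then show "(\<lambda>\<omega>. case z of (m, t, i) \<Rightarrow> X m t i \<omega>) \<in> borel_measurable P"
        by (simp add: z L4_def)
    qed
    \<comment> \<open>The total deviation as a measurable function of the array of observed entries,
      which is the form that independence from the data can use.\<close>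
    define g where "g i y = (\<Sum>x\<in>idx (K m) (p m). ((1 / real T) * (\<Sum>t<T. y (m, t, x) * y (n, t, i)) - signal T m n x i)\<^sup>2)"
      for i and y :: "nat \<times> nat \<times> midx \<Rightarrow> real"
    define D where "D i \<omega> = (\<Sum>x\<in>idx (K m) (p m). (deviation T m n x i \<omega>)\<^sup>2)" for i \<omega>
    have "\<exists>B\<in>events. prob B \<ge> 1 - (C\<^sup>2 * v) / (A * v) \<and> (\<forall>\<omega>\<in>B. (\<Sum>i\<in>S \<omega>. D i \<omega>) \<le> A * v * real (card (S \<omega>)))"
    proof (rule selected_sum_bound[OF _ S1 indep Ym, where g = g])
      show "g i \<in> borel_measurable ?NX" if i: "i \<in> ?N" for i
      proof -
        have "(\<lambda>y. y (m, t, x)) \<in> borel_measurable ?NX" if "t < T" "x \<in> idx (K m) (p m)" for t x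
          using m that by (intro measurable_component_singleton) (auto simp: data_def)
        moreover have "(\<lambda>y. y (n, t, i)) \<in> borel_measurable ?NX" if "t < T" for t
          using n i that by (intro measurable_component_singleton) (auto simp: data_def)
        ultimately show ?thesis
          unfolding g_def
          by (intro borel_measurable_sum borel_measurable_power borel_measurable_diff borel_measurable_times
              borel_measurable_const) auto
      qed
      show "D i \<omega> = g i (?Y \<omega>)" if i: "i \<in> ?N" for i \<omega>
      proof -
        have "(\<Sum>t<T. ?Y \<omega> (m, t, x) * ?Y \<omega> (n, t, i)) = (\<Sum>t<T. X m t x \<omega> * X n t i \<omega>)" if "x \<in> idx (K m) (p m)" for x
          using m n i that by (intro sum.cong refl) (auto simp: data_def)
        then show ?thesis
          unfolding D_def g_def deviation_def by simp
      qed
      have dev: "L2le P (C / sqrt (real T)) (deviation T m n x i)" if "x \<in> idx (K m) (p m)" "i \<in> ?N" for x i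
        using C(2) T all[OF that(1)] all'[OF that(2)] by blast
      show "integrable P (D i)" if "i \<in> ?N" for i
        unfolding D_def using L2leD(3)[OF dev[OF _ that]] by (intro Bochner_Integration.integrable_sum)
      show "expectation (D i) \<le> C\<^sup>2 * v" if i: "i \<in> ?N" for i
      proof -
        have "expectation (D i) = (\<Sum>x\<in>idx (K m) (p m). expectation (\<lambda>\<omega>. (deviation T m n x i \<omega>)\<^sup>2))"
          unfolding D_def using L2leD(3)[OF dev[OF _ i]] by (intro Bochner_Integration.integral_sum)
        also have "\<dots> \<le> (\<Sum>x\<in>idx (K m) (p m). (C / sqrt (real T))\<^sup>2)"
          by (intro sum_mono L2leD(4)[OF dev[OF _ i]])
        also have "\<dots> = C\<^sup>2 * v"
          by (simp add: card_idx power_divide v_def)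
        finally show ?thesis .
      qed
      show "0 \<le> D i \<omega>" for i \<omega>
        unfolding D_def by (intro sum_nonneg) auto
      show "0 < A * v" using A v by simp
    qed simp
    moreover have "(C\<^sup>2 * v) / (A * v) = C\<^sup>2 / A" using v by simp
    ultimately show ?thesis
      unfolding deviation_bound_def D_def v_def[symmetric] by simp
  qed
  then show ?thesis
    by (intro exI[of _ "C\<^sup>2"]) auto
qed

end

section \<open>Strength of the signal\<close>

lemma bij_betw_pick:
  assumes "finite R"
  shows "bij_betw (pick R) {..<card R} R"
proof -
  have "inj_on (pick R) {..<card R}"
  proof (rule inj_onI)
    fix x y assume "x \<in> {..<card R}" "y \<in> {..<card R}" "pick R x = pick R y"
    then show "x = y"
      using pick_mono_le[of x R y] pick_mono_le[of y R x] by (cases x y rule: linorder_cases) auto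
  qed
  moreover have "pick R ` {..<card R} \<subseteq> R"
    using pick_in_set_le by auto
  ultimately have "inj_on (pick R) {..<card R}" "pick R ` {..<card R} = R"
    using card_subset_eq[OF assms, of "pick R ` {..<card R}"] card_image[of "pick R" "{..<card R}"] by auto
  then show ?thesis by (simp add: bij_betw_def)
qed

lemma sum_mult_split:
  fixes f :: "nat \<Rightarrow> 'b :: comm_monoid_add"
  shows "(\<Sum>c<Q * R. f c) = (\<Sum>c<Q. \<Sum>d<R. f (c * R + d))"
proof -
  have "(\<Sum>c<Q * R. f c) = (\<Sum>c<Q. sum f {c * R..<c * R + R})"
    by (rule sum.nat_group[symmetric])
  also have "\<dots> = (\<Sum>c<Q. \<Sum>d<R. f (c * R + d))"
  proof (rule sum.cong[OF refl])
    fix c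
    show "sum f {c * R..<c * R + R} = (\<Sum>d<R. f (c * R + d))"
      using sum.shift_bounds_nat_ivl[of f 0 "c * R" R] by (simp add: atLeast0LessThan add.commute)
  qed
  finally show ?thesis .
qed

text \<open>For x = a z, Cauchy-Schwarz gives |x|^4 <= |z|^2 |a^T x|^2, and the assumed bound trades
  |z|^2 for |x|^2: a lower bound for \<open>a\<close> passes to its transpose on the range of
  \<open>a\<close>.\<close>

lemma range_lower_bound:
  fixes a :: "nat \<Rightarrow> nat \<Rightarrow> real"
  assumes lower: "\<beta> * (\<Sum>j<r. (z j)\<^sup>2) \<le> (\<Sum>i<p. (\<Sum>j<r. a i j * z j)\<^sup>2)" and \<beta>: "0 \<le> \<beta>"
    and x: "\<And>i. i < p \<Longrightarrow> x i = (\<Sum>j<r. a i j * z j)"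
  shows "\<beta> * (\<Sum>i<p. (x i)\<^sup>2) \<le> (\<Sum>j<r. (\<Sum>i<p. x i * a i j)\<^sup>2)"
proof -
  define N where "N = (\<Sum>i<p. (x i)\<^sup>2)"
  define w where "w j = (\<Sum>i<p. x i * a i j)" for j
  have N0: "0 \<le> N" by (auto simp: N_def intro: sum_nonneg)
  have "N = (\<Sum>i<p. x i * (\<Sum>j<r. a i j * z j))"
    unfolding N_def by (rule sum.cong[OF refl]) (simp add: power2_eq_square x)
  also have "\<dots> = (\<Sum>i<p. \<Sum>j<r. z j * (x i * a i j))"
    by (simp add: sum_distrib_left mult_ac)
  also have "\<dots> = (\<Sum>j<r. \<Sum>i<p. z j * (x i * a i j))"
    by (rule sum.swap)
  also have "\<dots> = (\<Sum>j<r. z j * w j)"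
    by (simp add: w_def sum_distrib_left)
  finally have "N\<^sup>2 \<le> (\<Sum>j<r. (z j)\<^sup>2) * (\<Sum>j<r. (w j)\<^sup>2)"
    using Cauchy_Schwarz_ineq_sum[of z w "{..<r}"] by simp
  then have "\<beta> * N\<^sup>2 \<le> \<beta> * ((\<Sum>j<r. (z j)\<^sup>2) * (\<Sum>j<r. (w j)\<^sup>2))"
    using \<beta> by (rule mult_left_mono)
  also have "\<dots> = (\<beta> * (\<Sum>j<r. (z j)\<^sup>2)) * (\<Sum>j<r. (w j)\<^sup>2)" by simp
  also have "\<dots> \<le> N * (\<Sum>j<r. (w j)\<^sup>2)"
  proof (rule mult_right_mono)
    show "\<beta> * (\<Sum>j<r. (z j)\<^sup>2) \<le> N"
      using lower x by (simp add: N_def)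
  qed (auto intro: sum_nonneg)
  finally have le: "N * (\<beta> * N) \<le> N * (\<Sum>j<r. (w j)\<^sup>2)"
    by (simp add: power2_eq_square mult_ac)
  have "\<beta> * N \<le> (\<Sum>j<r. (w j)\<^sup>2)"
  proof (cases "N = 0")
    case True
    then show ?thesis by (auto intro: sum_nonneg)
  next
    case False
    then show ?thesis using N0 le by simp
  qed
  then show ?thesis by (simp add: N_def w_def)
qed

context factor_model
begin

text \<open>The Gram matrix of the loadings divided by q tends to the identity; 1/2 is a convenient
  constant below 1. This is one of three bounds whose product is the strength of the signal, beside
  \<open>core_bound\<close> and \<open>selection_bound\<close>.\<close>

definition loading_bound :: "nat \<Rightarrow> nat \<Rightarrow> nat \<Rightarrow> bool" where
  "loading_bound m h q \<longleftrightarrow> (\<forall>z. (real q / 2) * (\<Sum>j<r m h. (z j)\<^sup>2) \<le> (\<Sum>x<q. (\<Sum>j<r m h. a m h x j * z j)\<^sup>2))"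

text \<open>A lower bound on the squared row singular values of the core moments, arranged as a
  matrix with mode \<open>k\<close> as rows and the remaining modes together with the other thread
  as columns.\<close>

definition core_bound :: "real \<Rightarrow> nat \<Rightarrow> nat \<Rightarrow> nat \<Rightarrow> nat \<Rightarrow> bool" where
  "core_bound c T m k n \<longleftrightarrow> (\<forall>y. c * (\<Sum>i<r m k. (y i)\<^sup>2) \<le>
     (\<Sum>c\<in>PiE ({..<K m} - {k}) (\<lambda>h. {..<r m h}). \<Sum>j\<in>idx (K n) (r n).
       (\<Sum>i<r m k. y i * \<theta> T m n (c(k := i)) j)\<^sup>2))"

text \<open>\<sigma> bounds from below the squared singular values of the selected rows of the
  Kronecker product of the global loadings of thread n.\<close>

definition selection_bound :: "real \<Rightarrow> nat \<Rightarrow> midx set \<Rightarrow> bool" where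
  "selection_bound \<sigma> n S \<longleftrightarrow> (\<forall>z. \<sigma> * (\<Sum>j\<in>idx (K n) (r n). (z j)\<^sup>2) \<le>
     (\<Sum>i\<in>S. (\<Sum>j\<in>idx (K n) (r n). coef n i (Inl j) * z j)\<^sup>2))"

lemma loading_lower:
  assumes m: "m < M" and h: "h < K m"
  shows "\<exists>N. \<forall>q\<ge>N. loading_bound m h q"
proof -
  obtain C where C0: "0 \<le> C"
    and C1: "\<forall>h<K m. \<forall>i. \<forall>j<r m h + u m h. \<bar>ab m h i j\<bar> \<le> C"
    and C2: "\<forall>h<K m. \<forall>q\<ge>1. \<forall>i<r m h + u m h. \<forall>j<r m h + u m h.
      \<bar>(1 / real q) * (\<Sum>x<q. ab m h x i * ab m h x j) - (if i = j then 1 else 0)\<bar> \<le> C / sqrt (real q)"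
    using loading_gram[OF m] by blast
  define d where "d = r m h"
  \<comment> \<open>Entries of the Gram error are at most C / sqrt q, so its quadratic form is at
    most d C / sqrt q times |z|^2; beyond this threshold that factor is at most 1/2.\<close>
  define N where "N = nat \<lceil>(2 * C * real d)\<^sup>2\<rceil> + 1"
  have "(real q / 2) * (\<Sum>j<d. (z j)\<^sup>2) \<le> (\<Sum>x<q. (\<Sum>j<d. a m h x j * z j)\<^sup>2)" if q: "N \<le> q" for q z
  proof -
    have q1: "1 \<le> q" using q by (simp add: N_def)
    have "(2 * C * real d)\<^sup>2 \<le> real q"
      using q by (simp add: N_def) linarith
    then have "sqrt ((2 * C * real d)\<^sup>2) \<le> sqrt (real q)"
      by (rule real_sqrt_le_mono)
    then have Cq: "2 * C * real d \<le> sqrt (real q)"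
      using C0 by simp
    define \<epsilon> where "\<epsilon> i j = (1 / real q) * (\<Sum>x<q. a m h x i * a m h x j) - (if i = j then 1 else 0)" for i j
    have \<epsilon>: "\<bar>\<epsilon> i j\<bar> \<le> C / sqrt (real q)" if "i < d" "j < d" for i j
      using C2[THEN spec, THEN mp, OF h, THEN spec, THEN mp, OF q1, THEN spec, of i, THEN mp, THEN spec, of j] that
      by (simp add: \<epsilon>_def ab_def d_def)
    have gram: "(\<Sum>x<q. a m h x i * a m h x j) = real q * ((if i = j then 1 else 0) + \<epsilon> i j)" for i j
      using q1 by (simp add: \<epsilon>_def)
    define Z where "Z = (\<Sum>j<d. (z j)\<^sup>2)"
    have Z0: "0 \<le> Z" by (auto simp: Z_def intro: sum_nonneg)
    have "(\<Sum>x<q. (\<Sum>j<d. a m h x j * z j)\<^sup>2) = (\<Sum>x<q. \<Sum>i<d. \<Sum>j<d. z i * z j * (a m h x i * a m h x j))"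
      unfolding power2_eq_square sum_product by (intro sum.cong refl) (simp add: mult_ac)
    also have "\<dots> = (\<Sum>i<d. \<Sum>x<q. \<Sum>j<d. z i * z j * (a m h x i * a m h x j))"
      by (rule sum.swap)
    also have "\<dots> = (\<Sum>i<d. \<Sum>j<d. \<Sum>x<q. z i * z j * (a m h x i * a m h x j))"
      by (rule sum.cong[OF refl], rule sum.swap)
    also have "\<dots> = (\<Sum>i<d. \<Sum>j<d. z i * z j * (real q * ((if i = j then 1 else 0) + \<epsilon> i j)))"
      by (simp only: gram sum_distrib_left[symmetric])
    also have "\<dots> = (\<Sum>i<d. \<Sum>j<d. (if j = i then real q * (z i * z j) else 0) + real q * (z i * z j * \<epsilon> i j))"
      by (intro sum.cong refl) (auto simp: algebra_simps)
    also have "\<dots> = real q * Z + real q * (\<Sum>i<d. \<Sum>j<d. z i * z j * \<epsilon> i j)"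
      by (simp add: sum.distrib Z_def power2_eq_square sum_distrib_left)
    finally have eq: "(\<Sum>x<q. (\<Sum>j<d. a m h x j * z j)\<^sup>2) = real q * (Z + (\<Sum>i<d. \<Sum>j<d. z i * z j * \<epsilon> i j))"
      by (simp add: distrib_left)
    have "\<bar>\<Sum>i<d. \<Sum>j<d. z i * z j * \<epsilon> i j\<bar> \<le> (\<Sum>i<d. \<Sum>j<d. \<bar>z i\<bar> * \<bar>z j\<bar> * (C / sqrt (real q)))"
    proof (rule order_trans[OF sum_abs], rule sum_mono, rule order_trans[OF sum_abs], rule sum_mono)
      fix i j assume "i \<in> {..<d}" "j \<in> {..<d}"
      then show "\<bar>z i * z j * \<epsilon> i j\<bar> \<le> \<bar>z i\<bar> * \<bar>z j\<bar> * (C / sqrt (real q))"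
        unfolding abs_mult by (intro mult_left_mono \<epsilon>) auto
    qed
    also have "\<dots> = (\<Sum>i<d. \<bar>z i\<bar>)\<^sup>2 * (C / sqrt (real q))"
    proof -
      have "(\<Sum>i<d. \<bar>z i\<bar>)\<^sup>2 = (\<Sum>i<d. \<Sum>j<d. \<bar>z i\<bar> * \<bar>z j\<bar>)"
        unfolding power2_eq_square by (rule sum_product)
      then show ?thesis by (simp only: sum_distrib_right)
    qed
    also have "\<dots> \<le> (real d * Z) * (C / sqrt (real q))"
    proof (rule mult_right_mono)
      have "(\<Sum>i<d. 1 * \<bar>z i\<bar>)\<^sup>2 \<le> (\<Sum>i<d. 1\<^sup>2) * (\<Sum>i<d. \<bar>z i\<bar>\<^sup>2)"
        by (rule Cauchy_Schwarz_ineq_sum)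
      then show "(\<Sum>i<d. \<bar>z i\<bar>)\<^sup>2 \<le> real d * Z" by (simp add: Z_def)
    qed (use C0 in simp)
    also have "\<dots> = Z / 2 * (2 * C * real d / sqrt (real q))"
      by simp
    also have "\<dots> \<le> Z / 2 * 1"
      using Cq q1 Z0 by (intro mult_left_mono) auto
    finally have "Z / 2 \<le> Z + (\<Sum>i<d. \<Sum>j<d. z i * z j * \<epsilon> i j)" by linarith
    then show ?thesis
      unfolding eq Z_def[symmetric] using mult_left_mono[of "Z / 2" _ "real q"] by simp
  qed
  then show ?thesis unfolding d_def loading_bound_def by blast
qed

lemma coef_Inl: "coef m i (Inl j) = (\<Prod>h<K m. a m h (i h) (j h))"
  by (simp add: coef_def)

text \<open>The core-factor condition speaks of moments multiplied by arbitrary well-conditioned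
  matrices. Truncated identities are admissible, all their singular values being 1, and their
  Kronecker product has squared Frobenius norm \<open>R\<close>, the product of the core dimensions;
  stripping it off costs only the factor 1 / R.\<close>

lemma core_lower:
  assumes m: "m < M" and n: "n < M" and k: "k < K m"
  shows "\<exists>c>0. \<forall>\<^sub>F (T, p) in large M K. core_bound c T m k n"
proof -
  let ?I = "{..<K m} - {k}"
  let ?P = "\<lambda>c\<^sub>1 c\<^sub>2 T p. \<forall>As. (\<forall>h<K n. As h \<in> carrier_mat (p n h) (r n h) \<and>
           (\<forall>j<r n h. 1 \<le> sing_val (As h) j \<and> sing_val (As h) j \<le> 1)) \<longrightarrow>
        (\<forall>j<r m k. c\<^sub>1 \<le> sing_val (cross_moment P K r G T p m k n As) j \<and>
                   sing_val (cross_moment P K r G T p m k n As) j \<le> c\<^sub>2)"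
  have "\<exists>c\<^sub>1>0. \<exists>c\<^sub>2. \<forall>\<^sub>F (T, p) in large M K. ?P c\<^sub>1 c\<^sub>2 T p"
    using core_factor[unfolded core_factor_condition_def, THEN spec, THEN mp, OF m, THEN conjunct2, THEN conjunct2,
        THEN spec, THEN mp, OF n, THEN spec, THEN mp, OF k, THEN spec, of 1, THEN mp, THEN spec, of 1] by simp
  then obtain c\<^sub>1 c\<^sub>2 where c1: "c\<^sub>1 > 0" and ev: "\<forall>\<^sub>F (T, p) in large M K. ?P c\<^sub>1 c\<^sub>2 T p"
    by blast
  define R where "R = real (\<Prod>h<K n. r n h)"
  have R: "0 < R" using r_pos[OF n] by (auto simp: R_def Suc_le_eq intro!: prod_pos)
  \<comment> \<open>A truncated identity has orthonormal columns only when it has at least as many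
    rows as columns.\<close>
  have ev': "\<forall>\<^sub>F (T, p) in large M K. \<forall>h<K n. r n h \<le> p n h"
    unfolding eventually_large
  proof (intro exI allI impI)
    fix T :: nat and p :: dims
    assume p: "\<forall>m<M. \<forall>k<K m. (\<Sum>h<K n. r n h) \<le> p m k"
    show "case (T, p) of (T, p) \<Rightarrow> \<forall>h<K n. r n h \<le> p n h"
    proof (clarsimp)
      fix h assume h: "h < K n"
      have "r n h \<le> (\<Sum>h<K n. r n h)" using h by (intro member_le_sum) auto
      then show "r n h \<le> p n h" using p n h order_trans by blast
    qed
  qed
  have main: "c\<^sub>1\<^sup>2 / R * (\<Sum>i<r m k. (y i)\<^sup>2) \<le>
    (\<Sum>c\<in>PiE ?I (\<lambda>h. {..<r m h}). \<Sum>j\<in>idx (K n) (r n). (\<Sum>i<r m k. y i * \<theta> T m n (c(k := i)) j)\<^sup>2)"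
    if P: "?P c\<^sub>1 c\<^sub>2 T p" and p: "\<forall>h<K n. r n h \<le> p n h" for T p y
  proof -
    define As where "As h = mat (p n h) (r n h) (\<lambda>(i, j). if i = j then 1 else (0 :: real))" for h
    have As: "As h \<in> carrier_mat (p n h) (r n h)" for h by (simp add: As_def)
    have AsAs: "transpose_mat (As h) * As h = 1\<^sub>m (r n h)" if h: "h < K n" for h
    proof (rule eq_matI, goal_cases)
      case (1 i j)
      then have ij: "i < r n h" "j < r n h" by auto
      have "(transpose_mat (As h) * As h) $$ (i, j) = (\<Sum>x<p n h. As h $$ (x, i) * As h $$ (x, j))"
        by (rule gram_mat(3)[OF As ij])
      also have "\<dots> = (\<Sum>x<p n h. if x = i then (if i = j then 1 else 0) else 0)"
        using ij by (intro sum.cong refl) (auto simp: As_def)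
      also have "\<dots> = (if i = j then 1 else 0)"
        using ij p h by auto
      finally show ?case using ij by simp
    qed (auto simp: As_def)
    define CM where "CM = cross_moment P K r G T p m k n As"
    define Q where "Q = (\<Prod>h\<in>?I. r m h)"
    define Pn where "Pn = (\<Prod>h<K n. p n h)"
    define Rn where "Rn = (\<Prod>h<K n. r n h)"
    have kron: "kron_desc As (K n) \<in> carrier_mat Pn Rn"
      unfolding Pn_def Rn_def by (rule kron_desc_index(1)[OF As])
    have sv: "\<forall>h<K n. As h \<in> carrier_mat (p n h) (r n h) \<and>
        (\<forall>j<r n h. 1 \<le> sing_val (As h) j \<and> sing_val (As h) j \<le> 1)"
      using As sing_val_orthonormal[OF AsAs] by auto
    have d: "0 < r m k" using r_pos[OF m k] by simp
    have CMsv: "c\<^sub>1 \<le> sing_val CM (r m k - 1)"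
      using P[THEN spec, of As, THEN mp, OF sv, THEN spec, of "r m k - 1"] d by (simp add: CM_def)
    have CM: "CM \<in> carrier_mat (r m k) (Q * Pn)"
      by (simp add: CM_def cross_moment_def Let_def mat_sum_def Q_def Pn_def)
    define \<Psi> where "\<Psi> c d = (\<Sum>i<r m k. y i * \<theta> T m n ((digits ?I (r m) c)(k := i)) (digits {..<K n} (r n) d))" for c d
    \<comment> \<open>The second Kronecker factor is a single row of length \<open>Pn\<close>, so a
      column of the cross moment is \<open>c * Pn + e\<close> with \<open>c\<close> a column of the
      unfolded core and \<open>e\<close> an entry of the other thread.\<close>
    have entry: "CM $$ (i, c * Pn + e) = (\<Sum>d<Rn. kron_desc As (K n) $$ (e, d) *
        \<theta> T m n ((digits ?I (r m) c)(k := i)) (digits {..<K n} (r n) d))"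
      if i: "i < r m k" and c: "c < Q" and e: "e < Pn" for i c e
    proof -
      have lt: "c * Pn + e < Q * Pn"
      proof -
        have "c * Pn + e < (c + 1) * Pn" using e by simp
        also have "\<dots> \<le> Q * Pn" using c by (intro mult_right_mono) auto
        finally show ?thesis .
      qed
      have dm: "(c * Pn + e) div Pn = c" "(c * Pn + e) mod Pn = e" using e by auto
      have in_m: "(digits ?I (r m) c)(k := i) \<in> idx (K m) (r m)"
      proof -
        have "digits ?I (r m) c \<in> PiE ?I (\<lambda>h. {..<r m h})"
          using bij_betw_digits[of ?I "r m"] c by (auto simp: bij_betw_def Q_def)
        then show ?thesis
          using i k by (auto simp: idx_def PiE_iff extensional_def)
      qed
      have in_n: "digits {..<K n} (r n) d \<in> idx (K n) (r n)" if "d < Rn" for d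
        using bij_betw_digits[of "{..<K n}" "r n"] that by (auto simp: bij_betw_def Rn_def idx_def)
      have row: "(mat_of_row (vect (K n) (r n) (\<lambda>i. G n t i \<omega>)) * transpose_mat (kron_desc As (K n))) $$ (0, e) =
          (\<Sum>d<Rn. G n t (digits {..<K n} (r n) d) \<omega> * kron_desc As (K n) $$ (e, d))" for t \<omega>
        using kron e by (simp add: scalar_prod_def vect_def Rn_def[symmetric] atLeast0LessThan)
      have dims: "dim_row (mat_of_row (vect (K n) (r n) (\<lambda>i. G n t i \<omega>)) * transpose_mat (kron_desc As (K n))) = 1"
        "dim_col (mat_of_row (vect (K n) (r n) (\<lambda>i. G n t i \<omega>)) * transpose_mat (kron_desc As (K n))) = Pn" for t \<omega>
        using kron by auto
      have ent: "kron (mode_mat (K m) (r m) k (\<lambda>i. G m t i \<omega>))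
          (mat_of_row (vect (K n) (r n) (\<lambda>i. G n t i \<omega>)) * transpose_mat (kron_desc As (K n))) $$ (i, c * Pn + e) =
          (\<Sum>d<Rn. kron_desc As (K n) $$ (e, d) *
            (G m t ((digits ?I (r m) c)(k := i)) \<omega> * G n t (digits {..<K n} (r n) d) \<omega>))" for t \<omega>
      proof -
        have "kron (mode_mat (K m) (r m) k (\<lambda>i. G m t i \<omega>))
          (mat_of_row (vect (K n) (r n) (\<lambda>i. G n t i \<omega>)) * transpose_mat (kron_desc As (K n))) $$ (i, c * Pn + e) =
          mode_mat (K m) (r m) k (\<lambda>i. G m t i \<omega>) $$ (i, c) *
          (mat_of_row (vect (K n) (r n) (\<lambda>i. G n t i \<omega>)) * transpose_mat (kron_desc As (K n))) $$ (0, e)"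
          unfolding kron_def dims using i lt dm
          by (simp add: mode_mat_def Q_def[symmetric] del: index_mult_mat)
        also have "mode_mat (K m) (r m) k (\<lambda>i. G m t i \<omega>) $$ (i, c) = G m t ((digits ?I (r m) c)(k := i)) \<omega>"
          using i c by (intro mode_mat_index) (auto simp: Q_def)
        finally show ?thesis unfolding row by (simp add: sum_distrib_left mult_ac)
      qed
      have fm: "L4 P (G m t j)" if "j \<in> idx (K m) (r m)" for t j
        using fac_moments[OF m] that by (metis facs_def InlI fac_simps(1))
      have fn: "L4 P (G n t j)" if "j \<in> idx (K n) (r n)" for t j
        using fac_moments[OF n] that by (metis facs_def InlI fac_simps(1))
      have int: "integrable P (\<lambda>\<omega>. G m t j \<omega> * G n t j' \<omega>)"
        if "j \<in> idx (K m) (r m)" "j' \<in> idx (K n) (r n)" for t j j'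
        using L4_mult_L2[OF fm fn, OF that] L2le_integrable by blast
      have "CM $$ (i, c * Pn + e) = (1 / real T) * (\<Sum>t<T. expectation (\<lambda>\<omega>.
          kron (mode_mat (K m) (r m) k (\<lambda>i. G m t i \<omega>))
          (mat_of_row (vect (K n) (r n) (\<lambda>i. G n t i \<omega>)) * transpose_mat (kron_desc As (K n))) $$ (i, c * Pn + e)))"
        using i lt unfolding CM_def cross_moment_def Let_def mat_sum_def mat_expectation_def
        by (simp add: Q_def[symmetric] Pn_def[symmetric])
      also have "\<dots> = (1 / real T) * (\<Sum>t<T. \<Sum>d<Rn. kron_desc As (K n) $$ (e, d) *
            expectation (\<lambda>\<omega>. G m t ((digits ?I (r m) c)(k := i)) \<omega> * G n t (digits {..<K n} (r n) d) \<omega>))"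
        unfolding ent using int[OF in_m in_n] by (simp add: Bochner_Integration.integral_sum)
      also have "(\<Sum>t<T. \<Sum>d<Rn. kron_desc As (K n) $$ (e, d) *
            expectation (\<lambda>\<omega>. G m t ((digits ?I (r m) c)(k := i)) \<omega> * G n t (digits {..<K n} (r n) d) \<omega>)) =
          (\<Sum>d<Rn. \<Sum>t<T. kron_desc As (K n) $$ (e, d) *
            expectation (\<lambda>\<omega>. G m t ((digits ?I (r m) c)(k := i)) \<omega> * G n t (digits {..<K n} (r n) d) \<omega>))"
        by (rule sum.swap)
      finally show ?thesis
        by (simp add: \<theta>_def sum_distrib_left mult_ac)
    qed
    have "c\<^sub>1\<^sup>2 * (\<Sum>i<r m k. (y i)\<^sup>2) \<le> (\<Sum>j<Q * Pn. (\<Sum>i<r m k. y i * CM $$ (i, j))\<^sup>2)"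
      by (rule sing_val_le_rows[OF CM d c1 CMsv])
    also have "\<dots> = (\<Sum>c<Q. \<Sum>e<Pn. (\<Sum>i<r m k. y i * CM $$ (i, c * Pn + e))\<^sup>2)"
      by (rule sum_mult_split)
    also have "\<dots> = (\<Sum>c<Q. \<Sum>e<Pn. (\<Sum>d<Rn. kron_desc As (K n) $$ (e, d) * \<Psi> c d)\<^sup>2)"
    proof (intro sum.cong[OF refl])
      fix c e assume ce: "c \<in> {..<Q}" "e \<in> {..<Pn}"
      have "(\<Sum>i<r m k. y i * CM $$ (i, c * Pn + e)) = (\<Sum>i<r m k. \<Sum>d<Rn. kron_desc As (K n) $$ (e, d) *
          (y i * \<theta> T m n ((digits ?I (r m) c)(k := i)) (digits {..<K n} (r n) d)))"
      proof (rule sum.cong[OF refl])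
        fix i assume "i \<in> {..<r m k}"
        then have "CM $$ (i, c * Pn + e) = (\<Sum>d<Rn. kron_desc As (K n) $$ (e, d) *
            \<theta> T m n ((digits ?I (r m) c)(k := i)) (digits {..<K n} (r n) d))"
          using ce by (intro entry) auto
        then show "y i * CM $$ (i, c * Pn + e) = (\<Sum>d<Rn. kron_desc As (K n) $$ (e, d) *
            (y i * \<theta> T m n ((digits ?I (r m) c)(k := i)) (digits {..<K n} (r n) d)))"
          by (simp only: sum_distrib_left mult.left_commute)
      qed
      also have "\<dots> = (\<Sum>d<Rn. kron_desc As (K n) $$ (e, d) * \<Psi> c d)"
        by (subst sum.swap) (simp add: \<Psi>_def sum_distrib_left)
      finally show "(\<Sum>i<r m k. y i * CM $$ (i, c * Pn + e))\<^sup>2 =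
          (\<Sum>d<Rn. kron_desc As (K n) $$ (e, d) * \<Psi> c d)\<^sup>2" by simp
    qed
    \<comment> \<open>Cauchy-Schwarz replaces the Kronecker product by its Frobenius norm, which
      does not grow with the dimensions.\<close>
    also have "\<dots> \<le> (\<Sum>c<Q. \<Sum>e<Pn. (\<Sum>d<Rn. (kron_desc As (K n) $$ (e, d))\<^sup>2) * (\<Sum>d<Rn. (\<Psi> c d)\<^sup>2))"
      by (intro sum_mono Cauchy_Schwarz_ineq_sum)
    also have "\<dots> = (\<Sum>e<Pn. \<Sum>d<Rn. (kron_desc As (K n) $$ (e, d))\<^sup>2) * (\<Sum>c<Q. \<Sum>d<Rn. (\<Psi> c d)\<^sup>2)"
      by (subst sum.swap) (simp add: sum_product)
    also have "(\<Sum>e<Pn. \<Sum>d<Rn. (kron_desc As (K n) $$ (e, d))\<^sup>2) = R"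
    proof -
      have "(\<Sum>e<Pn. \<Sum>d<Rn. (kron_desc As (K n) $$ (e, d))\<^sup>2) =
          (\<Prod>h<K n. \<Sum>i<p n h. \<Sum>j<r n h. (As h $$ (i, j))\<^sup>2)"
        unfolding Pn_def Rn_def by (rule kron_desc_frobenius[OF As])
      also have "\<dots> = (\<Prod>h<K n. real (r n h))"
      proof (rule prod.cong[OF refl])
        fix h assume "h \<in> {..<K n}"
        then have h: "h < K n" by simp
        have "(\<Sum>i<p n h. \<Sum>j<r n h. (As h $$ (i, j))\<^sup>2) = (\<Sum>j<r n h. \<Sum>i<p n h. (As h $$ (i, j))\<^sup>2)"
          by (rule sum.swap)
        also have "\<dots> = (\<Sum>j<r n h. (transpose_mat (As h) * As h) $$ (j, j))"
          using gram_mat(3)[OF As] by (intro sum.cong[OF refl]) (simp add: power2_eq_square del: index_mult_mat)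
        also have "\<dots> = real (r n h)"
          unfolding AsAs[OF h] by simp
        finally show "(\<Sum>i<p n h. \<Sum>j<r n h. (As h $$ (i, j))\<^sup>2) = real (r n h)" .
      qed
      finally show ?thesis by (simp add: R_def)
    qed
    also have "(\<Sum>c<Q. \<Sum>d<Rn. (\<Psi> c d)\<^sup>2) =
      (\<Sum>c\<in>PiE ?I (\<lambda>h. {..<r m h}). \<Sum>j\<in>idx (K n) (r n). (\<Sum>i<r m k. y i * \<theta> T m n (c(k := i)) j)\<^sup>2)"
    proof -
      have "(\<Sum>d<Rn. (\<Psi> c d)\<^sup>2) = (\<Sum>j\<in>idx (K n) (r n).
          (\<Sum>i<r m k. y i * \<theta> T m n ((digits ?I (r m) c)(k := i)) j)\<^sup>2)" for c
        unfolding \<Psi>_def Rn_def idx_def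
        by (rule sum_digits[where f = "\<lambda>j. (\<Sum>i<r m k. y i * \<theta> T m n ((digits ?I (r m) c)(k := i)) j)\<^sup>2"]) simp
      then show ?thesis
        unfolding Q_def
        by (simp, intro sum_digits[where f = "\<lambda>c. \<Sum>j\<in>idx (K n) (r n). (\<Sum>i<r m k. y i * \<theta> T m n (c(k := i)) j)\<^sup>2"]) simp
    qed
    finally show ?thesis
      using R by (simp add: pos_divide_le_eq mult.commute)
  qed
  show ?thesis
  proof (intro exI[of _ "c\<^sub>1\<^sup>2 / R"] conjI)
    show "0 < c\<^sub>1\<^sup>2 / R" using c1 R by simp
    show "\<forall>\<^sub>F (T, p) in large M K. core_bound (c\<^sub>1\<^sup>2 / R) T m k n"
      using ev ev'
    proof eventually_elim
      case (elim x)
      obtain T p where x: "x = (T, p)" by (cases x)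
      have "?P c\<^sub>1 c\<^sub>2 T p" "\<forall>h<K n. r n h \<le> p n h"
        using elim unfolding x by simp_all
      from main[OF this] show ?case
        unfolding x core_bound_def by simp
    qed
  qed
qed

text \<open>\<open>submatrix\<close> lists the selected rows in increasing order through
  \<open>pick\<close>. Sums over rows ignore the order and \<open>lin\<close> is injective on
  \<open>S\<close>, so the singular value bound becomes one over multi-indices, with as many rows as
  selected indices.\<close>

lemma selection_lower:
  assumes n: "n < M" and S: "S \<subseteq> idx (K n) (p n)" and s: "0 < s"
    and sv: "s * sqrt (real (card (rows_of (K n) (p n) S))) \<le>
      sing_val (submatrix (kron_desc (\<lambda>h. loading_mat (p n h) (r n h) (a n h)) (K n)) (rows_of (K n) (p n) S) UNIV)
        ((\<Prod>h<K n. r n h) - 1)"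
  shows "selection_bound (s\<^sup>2 * real (card S)) n S"
  unfolding selection_bound_def
proof (rule allI)
  fix z :: "midx \<Rightarrow> real"
  define R where "R = rows_of (K n) (p n) S"
  define A where "A = kron_desc (\<lambda>h. loading_mat (p n h) (r n h) (a n h)) (K n)"
  define d where "d = (\<Prod>h<K n. r n h)"
  have lm: "loading_mat (p n h) (r n h) (a n h) \<in> carrier_mat (p n h) (r n h)" for h
    by (simp add: loading_mat_def)
  have A: "A \<in> carrier_mat (\<Prod>h<K n. p n h) d"
    unfolding A_def d_def by (rule kron_desc_index(1)[OF lm])
  have bij: "bij_betw (lin {..<K n} (p n)) (idx (K n) (p n)) {..<\<Prod>h<K n. p n h}"
    unfolding idx_def by (rule bij_betw_lin) simp
  have inj: "inj_on (lin {..<K n} (p n)) S"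
    using bij S by (auto simp: bij_betw_def intro: inj_on_subset)
  have R_sub: "R \<subseteq> {..<\<Prod>h<K n. p n h}"
    using bij S by (auto simp: R_def rows_of_def bij_betw_def)
  have finR: "finite R" using R_sub finite_subset by blast
  have cardR: "card R = card S"
    unfolding R_def rows_of_def by (rule card_image[OF inj])
  have rows: "{i. i < dim_row A \<and> i \<in> R} = R" using A R_sub by auto
  define B where "B = submatrix A R UNIV"
  have B: "B \<in> carrier_mat (card R) d"
    unfolding B_def using A by (intro carrier_matI) (simp_all only: dim_submatrix rows, simp)
  have B_entry: "B $$ (l, j) = A $$ (pick R l, j)" if "l < card R" "j < d" for l j
    unfolding B_def using that A by (subst submatrix_index) (simp_all only: rows, simp_all add: pick_UNIV)
  have d0: "0 < d"
    using r_pos[OF n] by (auto simp: d_def Suc_le_eq intro!: prod_pos)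
  have "(s * sqrt (real (card R)))\<^sup>2 * (\<Sum>j<d. (z (digits {..<K n} (r n) j))\<^sup>2) \<le>
      (\<Sum>l<card R. (\<Sum>j<d. B $$ (l, j) * z (digits {..<K n} (r n) j))\<^sup>2)"
    using sv s by (intro sing_val_le_cols[OF B d0]) (auto simp: R_def B_def A_def d_def)
  also have "\<dots> = (\<Sum>l<card R. (\<Sum>j<d. A $$ (pick R l, j) * z (digits {..<K n} (r n) j))\<^sup>2)"
    by (simp add: B_entry)
  also have "\<dots> = (\<Sum>\<rho>\<in>R. (\<Sum>j<d. A $$ (\<rho>, j) * z (digits {..<K n} (r n) j))\<^sup>2)"
    by (rule sum.reindex_bij_betw[OF bij_betw_pick[OF finR]])
  also have "\<dots> = (\<Sum>i\<in>S. (\<Sum>j<d. A $$ (lin {..<K n} (p n) i, j) * z (digits {..<K n} (r n) j))\<^sup>2)"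
    unfolding R_def rows_of_def by (rule sum.reindex_cong[OF inj refl]) simp
  also have "\<dots> = (\<Sum>i\<in>S. (\<Sum>j\<in>idx (K n) (r n). coef n i (Inl j) * z j)\<^sup>2)"
  proof (rule sum.cong[OF refl])
    fix i assume "i \<in> S"
    then have i: "i \<in> idx (K n) (p n)" using S by blast
    have "(\<Sum>j<d. A $$ (lin {..<K n} (p n) i, j) * z (digits {..<K n} (r n) j)) =
        (\<Sum>j\<in>idx (K n) (r n). A $$ (lin {..<K n} (p n) i, lin {..<K n} (r n) j) *
          z (digits {..<K n} (r n) (lin {..<K n} (r n) j)))"
      unfolding d_def idx_def by (rule sum_lin) simp
    also have "\<dots> = (\<Sum>j\<in>idx (K n) (r n). coef n i (Inl j) * z j)"
    proof (rule sum.cong[OF refl])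
      fix j assume j: "j \<in> idx (K n) (r n)"
      have "A $$ (lin {..<K n} (p n) i, lin {..<K n} (r n) j) = coef n i (Inl j)"
        unfolding A_def kron_desc_index(2)[OF lm i j] coef_Inl
        by (rule prod.cong[OF refl]) (use idx_less[OF i] idx_less[OF j] in \<open>simp add: loading_mat_def\<close>)
      moreover have "digits {..<K n} (r n) (lin {..<K n} (r n) j) = j"
        using j unfolding idx_def by (intro digits_lin) auto
      ultimately show "A $$ (lin {..<K n} (p n) i, lin {..<K n} (r n) j) *
          z (digits {..<K n} (r n) (lin {..<K n} (r n) j)) = coef n i (Inl j) * z j" by simp
    qed
    finally show "(\<Sum>j<d. A $$ (lin {..<K n} (p n) i, j) * z (digits {..<K n} (r n) j))\<^sup>2 =
        (\<Sum>j\<in>idx (K n) (r n). coef n i (Inl j) * z j)\<^sup>2" by simp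
  qed
  also have "(\<Sum>j<d. (z (digits {..<K n} (r n) j))\<^sup>2) = (\<Sum>j\<in>idx (K n) (r n). (z j)\<^sup>2)"
    unfolding d_def idx_def by (rule sum_digits[where f = "\<lambda>j. (z j)\<^sup>2"]) simp
  also have "(s * sqrt (real (card R)))\<^sup>2 = s\<^sup>2 * real (card S)"
    by (simp add: power_mult_distrib cardR)
  finally show "s\<^sup>2 * real (card S) * (\<Sum>j\<in>idx (K n) (r n). (z j)\<^sup>2) \<le>
    (\<Sum>i\<in>S. (\<Sum>j\<in>idx (K n) (r n). coef n i (Inl j) * z j)\<^sup>2)" .
qed

text \<open>For x in the range of the mode-k loadings, contracting the signal with x is a chain of
  linear maps that are bounded below one at a time: the transposed loadings of mode k, the core
  moments, the selected rows of thread n, and the loadings of the remaining modes.\<close>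

lemma signal_lower:
  assumes k: "k < K m" and S: "finite S"
    and load: "\<And>h. h < K m \<Longrightarrow> loading_bound m h (p m h)"
    and core: "core_bound c T m k n" and sel: "selection_bound \<sigma> n S"
    and c: "0 \<le> c" and \<sigma>: "0 \<le> \<sigma>"
    and x: "\<And>i. i < p m k \<Longrightarrow> x i = (\<Sum>j<r m k. a m k i j * z j)"
  shows "(\<Prod>h<K m. real (p m h) / 2) * \<sigma> * c * (\<Sum>i<p m k. (x i)\<^sup>2) \<le>
    (\<Sum>i\<in>S. \<Sum>c\<in>PiE ({..<K m} - {k}) (\<lambda>h. {..<p m h}).
      (\<Sum>l<p m k. x l * signal T m n (c(k := l)) i)\<^sup>2)"
proof -
  let ?I = "{..<K m} - {k}" and ?Jn = "idx (K n) (r n)"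
  note load = load[unfolded loading_bound_def, rule_format] and core = core[unfolded core_bound_def, rule_format]
    and sel = sel[unfolded selection_bound_def, rule_format]
  let ?R = "PiE ?I (\<lambda>h. {..<r m h})" and ?Pi = "PiE ?I (\<lambda>h. {..<p m h})"
  define \<pi> where "\<pi> = (\<Prod>h\<in>?I. real (p m h) / 2)"
  have \<pi>: "0 \<le> \<pi>" by (auto simp: \<pi>_def intro: prod_nonneg)
  define w where "w j = (\<Sum>i<p m k. x i * a m k i j)" for j
  define \<Phi> where "\<Phi> c j = (\<Sum>l<r m k. w l * \<theta> T m n (c(k := l)) j)" for c j
  define Y where "Y i c = (\<Sum>j\<in>?Jn. coef n i (Inl j) * \<Phi> c j)" for i c
  have split: "(\<Prod>h<K m. real (p m h) / 2) = \<pi> * (real (p m k) / 2)"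
    unfolding \<pi>_def using k by (simp add: prod.remove[of "{..<K m}" k] mult.commute)
  have w: "(real (p m k) / 2) * (\<Sum>i<p m k. (x i)\<^sup>2) \<le> (\<Sum>j<r m k. (w j)\<^sup>2)"
    unfolding w_def using load[OF k, of z] x by (intro range_lower_bound) auto
  have "(\<Prod>h<K m. real (p m h) / 2) * \<sigma> * c * (\<Sum>i<p m k. (x i)\<^sup>2) =
      \<pi> * (\<sigma> * (c * ((real (p m k) / 2) * (\<Sum>i<p m k. (x i)\<^sup>2))))"
    unfolding split by (simp add: mult_ac)
  also have "\<dots> \<le> \<pi> * (\<sigma> * (c * (\<Sum>j<r m k. (w j)\<^sup>2)))"
    by (intro mult_left_mono w c \<sigma> \<pi>)
  also have "\<dots> \<le> \<pi> * (\<sigma> * (\<Sum>c\<in>?R. \<Sum>j\<in>?Jn. (\<Phi> c j)\<^sup>2))"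
    unfolding \<Phi>_def by (intro mult_left_mono core \<sigma> \<pi>)
  also have "\<dots> = \<pi> * (\<Sum>c\<in>?R. \<sigma> * (\<Sum>j\<in>?Jn. (\<Phi> c j)\<^sup>2))"
    by (simp add: sum_distrib_left)
  also have "\<dots> \<le> \<pi> * (\<Sum>c\<in>?R. \<Sum>i\<in>S. (Y i c)\<^sup>2)"
    unfolding Y_def by (intro mult_left_mono sum_mono sel \<pi>)
  also have "\<dots> = (\<Sum>i\<in>S. \<pi> * (\<Sum>c\<in>?R. (Y i c)\<^sup>2))"
    by (subst sum.swap) (simp add: sum_distrib_left)
  also have "\<dots> \<le> (\<Sum>i\<in>S. \<Sum>c\<in>?Pi. (\<Sum>j\<in>?R. (\<Prod>h\<in>?I. a m h (c h) (j h)) * Y i j)\<^sup>2)"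
    unfolding \<pi>_def using load by (intro sum_mono tensor_product_lower_bound) auto
  also have "\<dots> = (\<Sum>i\<in>S. \<Sum>c\<in>?Pi. (\<Sum>l<p m k. x l * signal T m n (c(k := l)) i)\<^sup>2)"
  proof (rule sum.cong[OF refl], rule sum.cong[OF refl])
    fix i c
    \<comment> \<open>The coefficient factors into mode \<open>k\<close> and the remaining modes,
      which separates the links of the chain.\<close>
    have coef: "coef m (c(k := l)) (Inl (j(k := l'))) = a m k l l' * (\<Prod>h\<in>?I. a m h (c h) (j h))" for l j l'
      unfolding coef_Inl using k by (simp add: prod.remove[of "{..<K m}" k])
    have "(\<Sum>l<p m k. x l * signal T m n (c(k := l)) i) =
        (\<Sum>l<p m k. \<Sum>j\<in>?R. (\<Prod>h\<in>?I. a m h (c h) (j h)) *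
          (x l * (\<Sum>l'<r m k. \<Sum>j'\<in>?Jn. a m k l l' * coef n i (Inl j') * \<theta> T m n (j(k := l')) j')))"
      unfolding signal_def sum_idx_remove[OF k] coef by (simp add: sum_distrib_left mult_ac)
    also have "\<dots> = (\<Sum>j\<in>?R. (\<Prod>h\<in>?I. a m h (c h) (j h)) *
          (\<Sum>l<p m k. x l * (\<Sum>l'<r m k. \<Sum>j'\<in>?Jn. a m k l l' * coef n i (Inl j') * \<theta> T m n (j(k := l')) j')))"
      by (subst sum.swap) (simp add: sum_distrib_left)
    also have "\<dots> = (\<Sum>j\<in>?R. (\<Prod>h\<in>?I. a m h (c h) (j h)) * Y i j)"
    proof (rule sum.cong[OF refl])
      fix j
      have "(\<Sum>l<p m k. x l * (\<Sum>l'<r m k. \<Sum>j'\<in>?Jn. a m k l l' * coef n i (Inl j') * \<theta> T m n (j(k := l')) j')) =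
          (\<Sum>l<p m k. \<Sum>l'<r m k. \<Sum>j'\<in>?Jn. x l * a m k l l' * (coef n i (Inl j') * \<theta> T m n (j(k := l')) j'))"
        by (simp add: sum_distrib_left mult_ac)
      also have "\<dots> = (\<Sum>l'<r m k. \<Sum>l<p m k. \<Sum>j'\<in>?Jn. x l * a m k l l' * (coef n i (Inl j') * \<theta> T m n (j(k := l')) j'))"
        by (rule sum.swap)
      also have "\<dots> = (\<Sum>l'<r m k. \<Sum>j'\<in>?Jn. \<Sum>l<p m k. x l * a m k l l' * (coef n i (Inl j') * \<theta> T m n (j(k := l')) j'))"
        by (rule sum.cong[OF refl], rule sum.swap)
      also have "\<dots> = (\<Sum>j'\<in>?Jn. \<Sum>l'<r m k. \<Sum>l<p m k. x l * a m k l l' * (coef n i (Inl j') * \<theta> T m n (j(k := l')) j'))"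
        by (rule sum.swap)
      also have "\<dots> = Y i j"
        unfolding Y_def \<Phi>_def w_def
        by (simp add: sum_distrib_left sum_distrib_right mult_ac)
      finally show "(\<Prod>h\<in>?I. a m h (c h) (j h)) *
          (\<Sum>l<p m k. x l * (\<Sum>l'<r m k. \<Sum>j'\<in>?Jn. a m k l l' * coef n i (Inl j') * \<theta> T m n (j(k := l')) j')) =
          (\<Prod>h\<in>?I. a m h (c h) (j h)) * Y i j" by simp
    qed
    finally show "(\<Sum>j\<in>?R. (\<Prod>h\<in>?I. a m h (c h) (j h)) * Y i j)\<^sup>2 =
        (\<Sum>l<p m k. x l * signal T m n (c(k := l)) i)\<^sup>2" by simp
  qed
  finally show ?thesis .
qed

end

section \<open>Consistency\<close>

text \<open>Orthonormalisation through the eigenbasis of the Gram matrix: H = u / sqrt e and R =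
  sqrt e u, where \<beta> > 0 makes every e positive. Both directions are recorded, because the
  signal has to be rewritten in the orthonormal basis and vectors of its range in terms of the
  loadings.\<close>

lemma loading_factorization:
  fixes a :: "nat \<Rightarrow> nat \<Rightarrow> real"
  assumes \<beta>: "0 < \<beta>"
    and lower: "\<And>z. \<beta> * (\<Sum>j<d. (z j)\<^sup>2) \<le> (\<Sum>x<q. (\<Sum>j<d. a x j * z j)\<^sup>2)"
  shows "\<exists>H R. (\<forall>l<d. \<forall>l'<d. (\<Sum>x<q. (\<Sum>j<d. a x j * H j l) * (\<Sum>j<d. a x j * H j l')) =
      (if l = l' then 1 else (0 :: real))) \<and>
    (\<forall>x. \<forall>j<d. a x j = (\<Sum>l<d. (\<Sum>j<d. a x j * H j l) * R l j))"
proof -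
  define S where "S = mat d d (\<lambda>(i, j). \<Sum>x<q. a x i * a x j)"
  have S: "S \<in> carrier_mat d d" "transpose_mat S = S"
    by (auto simp: S_def mult.commute)
  obtain u where basis: "orthonormal_eigenbasis d S u"
    using spectral_theorem[OF S] by blast
  note u = orthonormal_eigenbasisD[OF basis]
  define e where "e l = eigval S l" for l
  define g where "g l x = (\<Sum>j<d. a x j * u l j)" for l x
  have g: "(\<Sum>x<q. g l x * g l' x) = (if l = l' then e l else 0)" if l: "l < d" "l' < d" for l l'
    unfolding g_def e_def by (rule gram_of_eigenbasis[OF _ basis l]) (simp add: S_def)
  have e: "0 < e l" if l: "l < d" for l
  proof -
    have "0 < \<beta> * (\<Sum>j<d. (u l j)\<^sup>2)"
      using u(1)[OF l l] \<beta> by (simp add: power2_eq_square)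
    also have "\<dots> \<le> (\<Sum>x<q. (g l x)\<^sup>2)"
      unfolding g_def by (rule lower)
    also have "\<dots> = e l"
      using g[OF l l] by (simp add: power2_eq_square)
    finally show ?thesis .
  qed
  define H where "H j l = u l j / sqrt (e l)" for j l
  have Q: "(\<Sum>j<d. a x j * H j l) = g l x / sqrt (e l)" for x l
    by (simp add: H_def g_def sum_divide_distrib)
  have 1: "(\<Sum>x<q. (\<Sum>j<d. a x j * H j l) * (\<Sum>j<d. a x j * H j l')) = (if l = l' then 1 else 0)"
    if l: "l < d" "l' < d" for l l'
  proof -
    have "(\<Sum>x<q. (\<Sum>j<d. a x j * H j l) * (\<Sum>j<d. a x j * H j l')) =
        (\<Sum>x<q. g l x * g l' x) / (sqrt (e l) * sqrt (e l'))"
      by (simp add: Q sum_divide_distrib)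
    then show ?thesis
      using g[OF l] e[OF l(1)] by auto
  qed
  have 2: "a x j = (\<Sum>l<d. (\<Sum>j<d. a x j * H j l) * (sqrt (e l) * u l j))" if j: "j < d" for x j
  proof -
    have "(\<Sum>l<d. (\<Sum>j<d. a x j * H j l) * (sqrt (e l) * u l j)) = (\<Sum>l<d. g l x * u l j)"
    proof (rule sum.cong[OF refl])
      fix l assume "l \<in> {..<d}"
      then have "e l > 0" using e by simp
      then show "(\<Sum>j<d. a x j * H j l) * (sqrt (e l) * u l j) = g l x * u l j"
        unfolding Q by simp
    qed
    also have "\<dots> = (\<Sum>l<d. \<Sum>i<d. a x i * (u l i * u l j))"
      by (simp add: g_def sum_distrib_right mult.assoc)
    also have "\<dots> = (\<Sum>i<d. a x i * (\<Sum>l<d. u l i * u l j))"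
      by (subst sum.swap) (simp add: sum_distrib_left)
    also have "\<dots> = (\<Sum>i<d. if i = j then a x i else 0)"
      using j by (intro sum.cong refl) (auto simp: u(2))
    also have "\<dots> = a x j" using j by simp
    finally show ?thesis by simp
  qed
  show ?thesis
    by (intro exI[of _ H] exI[of _ "\<lambda>l j. sqrt (e l) * u l j"] conjI allI impI 1 2)
qed

text \<open>For orthonormal columns of \<open>Q\<close> and \<open>V\<close> this is the sum of the
  squared sines of the principal angles between their ranges.\<close>

definition range_dist :: "nat \<Rightarrow> nat \<Rightarrow> (nat \<Rightarrow> nat \<Rightarrow> real) \<Rightarrow> real mat \<Rightarrow> real" where
  "range_dist q d Q V = (\<Sum>j<d. \<Sum>a<q. (V $$ (a, j) - (\<Sum>i<d. Q a i * (\<Sum>b<q. Q b i * V $$ (b, j))))\<^sup>2)"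

lemma orthonormal_cols:
  fixes V :: "real mat"
  assumes "V \<in> carrier_mat q d" "transpose_mat V * V = 1\<^sub>m d" "i < d" "j < d"
  shows "(\<Sum>a<q. V $$ (a, i) * V $$ (a, j)) = (if i = j then 1 else 0)"
  using gram_mat(3)[OF assms(1,3,4)] assms by simp

text \<open>\<open>H\<close> is sqrt q times the orthonormalising matrix times an orthogonal Z.
  Every such Z gives the exact normalisation, so that part is unconditional; when the ranges are
  close, Z comes from \<open>procrustes\<close>, which supplies the error bound.\<close>

lemma rotation_exists:
  fixes a H\<^sub>0 :: "nat \<Rightarrow> nat \<Rightarrow> real" and d q :: nat
  defines "Q \<equiv> \<lambda>x l. \<Sum>j<d. a x j * H\<^sub>0 j l"
  assumes Q: "\<And>l l'. l < d \<Longrightarrow> l' < d \<Longrightarrow> (\<Sum>x<q. Q x l * Q x l') = (if l = l' then 1 else 0)"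
    and q: "0 < q" and V: "V \<in> carrier_mat q d" "transpose_mat V * V = 1\<^sub>m d"
  shows "\<exists>H\<in>carrier_mat d d.
    transpose_mat (loading_mat q d a * H) * (loading_mat q d a * H) = real q \<cdot>\<^sub>m 1\<^sub>m d \<and>
    (range_dist q d Q V < 1 \<longrightarrow>
      (1 / real q) * (frob_norm (sqrt (real q) \<cdot>\<^sub>m V - loading_mat q d a * H))\<^sup>2 \<le> 2 * range_dist q d Q V)"
proof -
  have Vo: "(\<Sum>a<q. V $$ (a, i) * V $$ (a, j)) = (if i = j then 1 else 0)" if "i < d" "j < d" for i j
    using orthonormal_cols[OF V that] .
  have "\<exists>Z. (\<forall>j<d. \<forall>j'<d. (\<Sum>i<d. Z i j * Z i j') = (if j = j' then 1 else (0::real))) \<and>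
    (range_dist q d Q V < 1 \<longrightarrow> (\<Sum>j<d. \<Sum>x<q. (V $$ (x, j) - (\<Sum>i<d. Q x i * Z i j))\<^sup>2) \<le> 2 * range_dist q d Q V)"
  proof (cases "range_dist q d Q V < 1")
    case True
    then show ?thesis
      using procrustes[where Q = Q and V = "\<lambda>a j. V $$ (a, j)" and p = q and r = d, OF Q Vo]
      unfolding range_dist_def by blast
  next
    case False
    have "(\<Sum>i<d. (if i = j then 1 else 0) * (if i = j' then 1 else (0::real))) = (if j = j' then 1 else 0)"
      if "j < d" for j j'
    proof -
      have "(\<Sum>i<d. (if i = j then 1 else 0) * (if i = j' then 1 else (0::real))) =
          (\<Sum>i<d. if i = j then (if j = j' then 1 else 0) else 0)"
        by (intro sum.cong) auto
      then show ?thesis using that by simp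
    qed
    with False show ?thesis
      by (intro exI[of _ "\<lambda>i j. if i = j then 1 else 0"]) blast
  qed
  then obtain Z where Z: "\<And>j j'. j < d \<Longrightarrow> j' < d \<Longrightarrow> (\<Sum>i<d. Z i j * Z i j') = (if j = j' then 1 else (0::real))"
    and ZV: "range_dist q d Q V < 1 \<Longrightarrow>
      (\<Sum>j<d. \<Sum>x<q. (V $$ (x, j) - (\<Sum>i<d. Q x i * Z i j))\<^sup>2) \<le> 2 * range_dist q d Q V"
    by blast
  define H where "H = mat d d (\<lambda>(j, l). sqrt (real q) * (\<Sum>i<d. H\<^sub>0 j i * Z i l))"
  define A where "A = loading_mat q d a"
  have A: "A \<in> carrier_mat q d" and H: "H \<in> carrier_mat d d"
    by (simp_all add: A_def loading_mat_def H_def)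
  have AH: "A * H \<in> carrier_mat q d" using A H by simp
  have entry: "(A * H) $$ (x, l) = sqrt (real q) * (\<Sum>i<d. Q x i * Z i l)" if "x < q" "l < d" for x l
  proof -
    have "(A * H) $$ (x, l) = (\<Sum>j<d. a x j * (sqrt (real q) * (\<Sum>i<d. H\<^sub>0 j i * Z i l)))"
      using that by (simp add: A_def H_def loading_mat_def scalar_prod_def atLeast0LessThan)
    also have "\<dots> = (\<Sum>j<d. \<Sum>i<d. sqrt (real q) * (a x j * H\<^sub>0 j i * Z i l))"
      by (simp add: sum_distrib_left mult_ac)
    also have "\<dots> = (\<Sum>i<d. \<Sum>j<d. sqrt (real q) * (a x j * H\<^sub>0 j i * Z i l))"
      by (rule sum.swap)
    also have "\<dots> = sqrt (real q) * (\<Sum>i<d. Q x i * Z i l)"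
      by (simp add: Q_def sum_distrib_left sum_distrib_right mult.assoc)
    finally show ?thesis .
  qed
  have norm: "transpose_mat (A * H) * (A * H) = real q \<cdot>\<^sub>m 1\<^sub>m d"
  proof (rule eq_matI, goal_cases)
    case (1 l l')
    then have l: "l < d" "l' < d" by auto
    have "(transpose_mat (A * H) * (A * H)) $$ (l, l') = (\<Sum>x<q. (A * H) $$ (x, l) * (A * H) $$ (x, l'))"
      by (rule gram_mat(3)[OF AH l])
    also have "\<dots> = (\<Sum>x<q. real q * ((\<Sum>i<d. Q x i * Z i l) * (\<Sum>i<d. Q x i * Z i l')))"
    proof (rule sum.cong[OF refl])
      fix x assume "x \<in> {..<q}"
      then have x: "x < q" by simp
      have "s * y * (s * z) = (s * s) * (y * z)" for s y z :: real by (simp add: mult_ac)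
      then show "(A * H) $$ (x, l) * (A * H) $$ (x, l') =
          real q * ((\<Sum>i<d. Q x i * Z i l) * (\<Sum>i<d. Q x i * Z i l'))"
        unfolding entry[OF x l(1)] entry[OF x l(2)] by simp
    qed
    also have "\<dots> = real q * (\<Sum>i<d. Z i l * Z i l')"
      unfolding sum_distrib_left[symmetric]
      by (intro arg_cong[where f = "\<lambda>y. real q * y"] sum_mult_gram Q)
    also have "\<dots> = (real q \<cdot>\<^sub>m 1\<^sub>m d) $$ (l, l')"
      using l Z[OF l] by simp
    finally show ?case .
  qed (use A H in auto)
  have frob: "(1 / real q) * (frob_norm (sqrt (real q) \<cdot>\<^sub>m V - A * H))\<^sup>2 =
      (\<Sum>j<d. \<Sum>x<q. (V $$ (x, j) - (\<Sum>i<d. Q x i * Z i j))\<^sup>2)"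
  proof -
    have dims: "dim_row (sqrt (real q) \<cdot>\<^sub>m V - A * H) = q" "dim_col (sqrt (real q) \<cdot>\<^sub>m V - A * H) = d"
      using A H V by auto
    have "(frob_norm (sqrt (real q) \<cdot>\<^sub>m V - A * H))\<^sup>2 =
        (\<Sum>x<q. \<Sum>j<d. ((sqrt (real q) \<cdot>\<^sub>m V - A * H) $$ (x, j))\<^sup>2)"
      unfolding frob_norm_def dims by (intro real_sqrt_pow2 sum_nonneg) auto
    also have "\<dots> = (\<Sum>x<q. \<Sum>j<d. real q * (V $$ (x, j) - (\<Sum>i<d. Q x i * Z i j))\<^sup>2)"
    proof (rule sum.cong[OF refl], rule sum.cong[OF refl])
      fix x j assume "x \<in> {..<q}" "j \<in> {..<d}"
      then have xj: "x < q" "j < d" by auto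
      have "(sqrt (real q) \<cdot>\<^sub>m V - A * H) $$ (x, j) = sqrt (real q) * V $$ (x, j) - (A * H) $$ (x, j)"
        using xj V A H by (simp del: index_mult_mat(1))
      also have "\<dots> = sqrt (real q) * (V $$ (x, j) - (\<Sum>i<d. Q x i * Z i j))"
        unfolding entry[OF xj] by (simp add: right_diff_distrib)
      finally show "((sqrt (real q) \<cdot>\<^sub>m V - A * H) $$ (x, j))\<^sup>2 = real q * (V $$ (x, j) - (\<Sum>i<d. Q x i * Z i j))\<^sup>2"
        by (simp add: power_mult_distrib)
    qed
    also have "\<dots> = real q * (\<Sum>j<d. \<Sum>x<q. (V $$ (x, j) - (\<Sum>i<d. Q x i * Z i j))\<^sup>2)"
      by (subst sum.swap) (simp add: sum_distrib_left)
    finally show ?thesis using q by simp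
  qed
  show ?thesis
    using H norm frob ZV unfolding A_def by (intro bexI[of _ H]) auto
qed

text \<open>On the range of \<open>Q\<close>, (t + w)^2 >= t^2 / 2 - w^2 leaves at least \<kappa> /
  2 - \<zeta> >= \<kappa> / 4, so by Courant-Fischer the d leading eigenvalues are at least \<kappa>
  / 4. Applying \<open>eigenvector_perturbation\<close> to each of the d columns yields the factor 4
  d.\<close>

lemma range_dist_leading:
  fixes \<Omega> L :: "nat \<Rightarrow> 's \<Rightarrow> real" and Q :: "nat \<Rightarrow> nat \<Rightarrow> real"
  assumes S: "S = mat q q (\<lambda>(a, b). \<Sum>s\<in>J. \<Omega> a s * \<Omega> b s)"
    and lead: "leading_eigenvectors S d V" and d: "0 < d" "d \<le> q"
    and Q: "\<And>i j. i < d \<Longrightarrow> j < d \<Longrightarrow> (\<Sum>a<q. Q a i * Q a j) = (if i = j then 1 else 0)"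
    and L: "\<And>s a. s \<in> J \<Longrightarrow> a < q \<Longrightarrow> L a s = (\<Sum>i<d. Q a i * y i s)"
    and lower: "\<And>z. \<kappa> * (\<Sum>a<q. (\<Sum>j<d. Q a j * z j)\<^sup>2) \<le> (\<Sum>s\<in>J. (\<Sum>a<q. (\<Sum>j<d. Q a j * z j) * L a s)\<^sup>2)"
    and \<zeta>: "(\<Sum>s\<in>J. \<Sum>a<q. (\<Omega> a s - L a s)\<^sup>2) \<le> \<zeta>" and \<kappa>: "\<zeta> \<le> \<kappa> / 4" "0 < \<kappa>"
  shows "range_dist q d Q V \<le> 4 * real d * \<zeta> / \<kappa>"
proof -
  have Sc: "S \<in> carrier_mat q q" and Ssym: "transpose_mat S = S"
    by (auto simp: S mult.commute)
  have V: "V \<in> carrier_mat q d" "transpose_mat V * V = 1\<^sub>m d"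
    and ev: "\<And>j. j < d \<Longrightarrow> S *\<^sub>v col V j = eigval S j \<cdot>\<^sub>v col V j"
    using lead Sc by (auto simp: leading_eigenvectors_def)
  define \<xi> where "\<xi> = (\<Sum>s\<in>J. \<Sum>a<q. (\<Omega> a s - L a s)\<^sup>2)"
  have \<xi>0: "0 \<le> \<xi>" by (auto simp: \<xi>_def intro!: sum_nonneg)
  have "\<kappa> / 4 \<le> eigval S (d - 1)"
  proof (rule eigval_ge_quadratic_form[OF Sc Ssym d Q])
    fix z :: "nat \<Rightarrow> real"
    define x where "x a = (\<Sum>j<d. Q a j * z j)" for a
    have xz: "(\<Sum>a<q. (x a)\<^sup>2) = (\<Sum>j<d. (z j)\<^sup>2)"
      unfolding x_def by (rule sum_square_gram[OF Q])
    have "(\<Sum>a<q. \<Sum>b<q. x a * S $$ (a, b) * x b) = (\<Sum>a<q. \<Sum>b<q. \<Sum>s\<in>J. (x a * \<Omega> a s) * (x b * \<Omega> b s))"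
      by (intro sum.cong refl) (simp add: S sum_distrib_left sum_distrib_right mult_ac)
    also have "\<dots> = (\<Sum>a<q. \<Sum>s\<in>J. \<Sum>b<q. (x a * \<Omega> a s) * (x b * \<Omega> b s))"
      by (rule sum.cong[OF refl], rule sum.swap)
    also have "\<dots> = (\<Sum>s\<in>J. \<Sum>a<q. \<Sum>b<q. (x a * \<Omega> a s) * (x b * \<Omega> b s))"
      by (rule sum.swap)
    also have "\<dots> = (\<Sum>s\<in>J. (\<Sum>a<q. x a * \<Omega> a s)\<^sup>2)"
      by (simp add: power2_eq_square sum_product)
    finally have form: "(\<Sum>a<q. \<Sum>b<q. x a * S $$ (a, b) * x b) = (\<Sum>s\<in>J. (\<Sum>a<q. x a * \<Omega> a s)\<^sup>2)" .
    have "\<kappa> * (\<Sum>a<q. (x a)\<^sup>2) / 2 - \<xi> * (\<Sum>a<q. (x a)\<^sup>2) \<le>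
        (\<Sum>s\<in>J. (\<Sum>a<q. x a * L a s)\<^sup>2) / 2 - (\<Sum>s\<in>J. (\<Sum>a<q. x a * (\<Omega> a s - L a s))\<^sup>2)"
    proof -
      have "(\<Sum>s\<in>J. (\<Sum>a<q. x a * (\<Omega> a s - L a s))\<^sup>2) \<le> (\<Sum>s\<in>J. (\<Sum>a<q. (x a)\<^sup>2) * (\<Sum>a<q. (\<Omega> a s - L a s)\<^sup>2))"
        by (intro sum_mono Cauchy_Schwarz_ineq_sum)
      also have "\<dots> = \<xi> * (\<Sum>a<q. (x a)\<^sup>2)"
        by (simp add: \<xi>_def sum_distrib_left[symmetric] mult.commute)
      finally show ?thesis
        using lower[of z, folded x_def] by linarith
    qed
    also have "\<dots> = (\<Sum>s\<in>J. (\<Sum>a<q. x a * L a s)\<^sup>2 / 2 - (\<Sum>a<q. x a * (\<Omega> a s - L a s))\<^sup>2)"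
      by (simp add: sum_subtractf sum_divide_distrib)
    also have "\<dots> \<le> (\<Sum>s\<in>J. (\<Sum>a<q. x a * \<Omega> a s)\<^sup>2)"
    proof (rule sum_mono)
      fix s
      have le: "t\<^sup>2 / 2 - w\<^sup>2 \<le> (t + w)\<^sup>2" for t w :: real
      proof -
        have "0 \<le> (t + 2 * w)\<^sup>2" by simp
        then show ?thesis by (simp add: power2_sum)
      qed
      have "(\<Sum>a<q. x a * \<Omega> a s) = (\<Sum>a<q. x a * L a s) + (\<Sum>a<q. x a * (\<Omega> a s - L a s))"
        by (simp add: sum.distrib[symmetric] right_diff_distrib)
      then show "(\<Sum>a<q. x a * L a s)\<^sup>2 / 2 - (\<Sum>a<q. x a * (\<Omega> a s - L a s))\<^sup>2 \<le> (\<Sum>a<q. x a * \<Omega> a s)\<^sup>2"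
        using le by simp
    qed
    finally have "\<kappa> * (\<Sum>a<q. (x a)\<^sup>2) / 2 - \<xi> * (\<Sum>a<q. (x a)\<^sup>2) \<le> (\<Sum>a<q. \<Sum>b<q. x a * S $$ (a, b) * x b)"
      unfolding form .
    moreover have "\<xi> * (\<Sum>a<q. (x a)\<^sup>2) \<le> \<kappa> / 4 * (\<Sum>a<q. (x a)\<^sup>2)"
      using \<zeta> \<kappa> by (intro mult_right_mono sum_nonneg) (auto simp: \<xi>_def)
    ultimately show "\<kappa> / 4 * (\<Sum>j<d. (z j)\<^sup>2) \<le>
        (\<Sum>a<q. \<Sum>b<q. (\<Sum>j<d. Q a j * z j) * S $$ (a, b) * (\<Sum>j<d. Q b j * z j))"
      unfolding xz[symmetric] x_def[symmetric] by simp
  qed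
  then have e: "\<kappa> / 4 \<le> eigval S j" if "j < d" for j
  proof -
    have "j \<le> d - 1" "d - 1 < q" using that d by auto
    then have "eigval S (d - 1) \<le> eigval S j" by (rule eigval_antimono[OF Sc Ssym])
    with \<open>\<kappa> / 4 \<le> eigval S (d - 1)\<close> show ?thesis by linarith
  qed
  have "range_dist q d Q V \<le> (\<Sum>j<d. 4 * \<zeta> / \<kappa>)"
    unfolding range_dist_def
  proof (rule sum_mono)
    fix j assume "j \<in> {..<d}"
    then have j: "j < d" by simp
    have e0: "0 < eigval S j" using e[OF j] \<kappa> by simp
    have "(\<Sum>a<q. (V $$ (a, j) - (\<Sum>i<d. Q a i * (\<Sum>b<q. Q b i * V $$ (b, j))))\<^sup>2) \<le>
        (\<Sum>s\<in>J. \<Sum>a<q. (\<Omega> a s - L a s)\<^sup>2) / eigval S j"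
    proof (rule eigenvector_perturbation[OF Q L _ _ e0])
      show "(\<Sum>a<q. (V $$ (a, j))\<^sup>2) = 1"
        using orthonormal_cols[OF V j j] by (simp add: power2_eq_square)
      fix a assume a: "a < q"
      have "(\<Sum>b<q. S $$ (a, b) * V $$ (b, j)) = (S *\<^sub>v col V j) $ a"
        using a j Sc V by (simp add: scalar_prod_def atLeast0LessThan)
      also have "\<dots> = eigval S j * V $$ (a, j)"
        unfolding ev[OF j] using a j V by simp
      finally show "(\<Sum>b<q. (\<Sum>s\<in>J. \<Omega> a s * \<Omega> b s) * V $$ (b, j)) = eigval S j * V $$ (a, j)"
        using a by (simp add: S)
    qed
    also have "\<dots> \<le> \<zeta> / eigval S j"
      using \<zeta> e0 by (intro divide_right_mono) auto
    also have "\<dots> \<le> \<zeta> / (\<kappa> / 4)"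
      using e[OF j] e0 \<kappa> \<zeta> \<xi>0 by (intro divide_left_mono) (auto simp: \<xi>_def)
    finally show "(\<Sum>a<q. (V $$ (a, j) - (\<Sum>i<d. Q a i * (\<Sum>b<q. Q b i * V $$ (b, j))))\<^sup>2) \<le> 4 * \<zeta> / \<kappa>"
      by (simp add: mult.commute)
  qed
  then show ?thesis by (simp add: mult.left_commute mult.assoc)
qed

lemma (in prob_space) finite_Int_prob:
  assumes "finite I" "\<And>n. n \<in> I \<Longrightarrow> \<exists>B\<in>events. 1 - c n \<le> prob B \<and> (\<forall>\<omega>\<in>B. \<P> n \<omega>)"
  shows "\<exists>B\<in>events. 1 - (\<Sum>n\<in>I. c n) \<le> prob B \<and> (\<forall>\<omega>\<in>B. \<forall>n\<in>I. \<P> n \<omega>)"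
  using assms
proof (induction I)
  case empty
  then show ?case by (intro bexI[of _ "space M"]) (auto simp: prob_space)
next
  case (insert n I)
  obtain B where B: "B \<in> events" "1 - (\<Sum>n\<in>I. c n) \<le> prob B" "\<forall>\<omega>\<in>B. \<forall>n\<in>I. \<P> n \<omega>"
    using insert by blast
  obtain B' where B': "B' \<in> events" "1 - c n \<le> prob B'" "\<forall>\<omega>\<in>B'. \<P> n \<omega>"
    using insert.prems[of n] by blast
  have "prob (B \<union> B') = prob B + prob B' - prob (B \<inter> B')"
    using B B' by (intro measure_Un3) (auto simp: fmeasurable_eq_sets)
  moreover have "prob (B \<union> B') \<le> 1" by (rule prob_le_1)
  ultimately show ?case
    using B B' insert.hyps by (intro bexI[of _ "B \<inter> B'"]) auto
qed

lemma finite_positive_lower_bound: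
  fixes f :: "'a \<Rightarrow> real"
  assumes "finite I" "\<And>n. n \<in> I \<Longrightarrow> 0 < f n"
  shows "\<exists>c>0. \<forall>n\<in>I. c \<le> f n"
  using assms
proof (induction I)
  case empty
  show ?case by (intro exI[of _ 1]) simp
next
  case (insert n I)
  then obtain c where "0 < c" "\<forall>n\<in>I. c \<le> f n" by auto
  with insert.prems[of n] show ?case
    by (intro exI[of _ "min c (f n)"]) (auto simp: min_le_iff_disj)
qed

lemma eventually_large_ge: "\<forall>\<^sub>F x in large M K. N \<le> fst x \<and> (\<forall>m<M. \<forall>k<K m. N \<le> snd x m k)"
  unfolding eventually_large by (intro exI[of _ N]) simp

section \<open>The estimator at a fixed sample point\<close>

context factor_model
begin

text \<open>Coordinates of the unfolded signal with respect to the columns of the mode-k loadings: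
  the witness in \<open>signal_range\<close> that the signal lies in their range.\<close>

definition signal_coord :: "nat \<Rightarrow> nat \<Rightarrow> nat \<Rightarrow> nat \<Rightarrow> midx \<Rightarrow> midx \<Rightarrow> nat \<Rightarrow> real" where
  "signal_coord T m k n i c l = (\<Sum>j\<in>PiE ({..<K m} - {k}) (\<lambda>h. {..<r m h}). \<Sum>j'\<in>idx (K n) (r n).
     (\<Prod>h\<in>{..<K m} - {k}. a m h (c h) (j h)) * coef n i (Inl j') * \<theta> T m n (j(k := l)) j')"

lemma signal_range:
  assumes k: "k < K m"
  shows "signal T m n (c(k := x)) i = (\<Sum>l<r m k. a m k x l * signal_coord T m k n i c l)"
proof -
  let ?I = "{..<K m} - {k}"
  have coef: "coef m (c(k := x)) (Inl (j(k := l))) = a m k x l * (\<Prod>h\<in>?I. a m h (c h) (j h))" for j l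
    unfolding coef_Inl using k by (simp add: prod.remove[of "{..<K m}" k])
  have "signal T m n (c(k := x)) i = (\<Sum>j\<in>PiE ?I (\<lambda>h. {..<r m h}). \<Sum>l<r m k. a m k x l * (\<Sum>j'\<in>idx (K n) (r n).
     (\<Prod>h\<in>?I. a m h (c h) (j h)) * coef n i (Inl j') * \<theta> T m n (j(k := l)) j'))"
    unfolding signal_def sum_idx_remove[OF k] coef by (simp add: sum_distrib_left mult_ac)
  also have "\<dots> = (\<Sum>l<r m k. a m k x l * signal_coord T m k n i c l)"
    by (subst sum.swap) (simp add: signal_coord_def sum_distrib_left)
  finally show ?thesis .
qed

lemma Omega_hat_index:
  assumes "x < p m k" "c < (\<Prod>h\<in>{..<K m} - {k}. p m h)"
  shows "Omega_hat K X T p m k n i \<omega> $$ (x, c) =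
    (1 / real T) * (\<Sum>t<T. X m t ((digits ({..<K m} - {k}) (p m) c)(k := x)) \<omega> * X n t i \<omega>)"
  using assms by (simp add: Omega_hat_def mat_sum_def mode_mat_def mult.commute)

lemma Omega_hat_carrier: "Omega_hat K X T p m k n i \<omega> \<in> carrier_mat (p m k) (\<Prod>h\<in>{..<K m} - {k}. p m h)"
  by (simp add: Omega_hat_def mat_sum_def)

text \<open>Deterministic, at a single sample point. All matrices \<open>Omega_hat\<close> over
  threads and selected indices are placed side by side, so that \<open>Sigma_hat\<close> becomes
  \<Omega> \<Omega>^T for one wide matrix and \<open>range_dist_leading\<close> applies once to all
  threads together.\<close>

lemma estimator_range_dist:
  fixes S :: "nat \<Rightarrow> midx set" and \<omega> :: 'w and T m k :: nat and p :: dims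
  defines "I \<equiv> {..<M} - {m}"
  assumes m: "m < M" and k: "k < K m" and T: "1 \<le> T"
    and p: "\<And>h. h < K m \<Longrightarrow> 1 \<le> p m h" "r m k \<le> p m k"
    and S: "\<And>n. n \<in> I \<Longrightarrow> S n \<subseteq> idx (K n) (p n) \<and> S n \<noteq> {}"
    and load: "\<And>h. h < K m \<Longrightarrow> loading_bound m h (p m h)"
    and core: "\<And>n. n \<in> I \<Longrightarrow> core_bound (c n) T m k n"
    and sel: "\<And>n. n \<in> I \<Longrightarrow> selection_bound ((s n)\<^sup>2 * real (card (S n))) n (S n)"
    and dev: "\<And>n. n \<in> I \<Longrightarrow> deviation_bound A T p m n (S n) \<omega>"
    and c: "\<And>n. n \<in> I \<Longrightarrow> 0 < c n" and c0: "0 < c0" "\<And>n. n \<in> I \<Longrightarrow> c0 \<le> (s n)\<^sup>2 * c n"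
    and A: "A / real T \<le> c0 / (4 * 2 ^ K m)"
    and Q: "\<And>l l'. l < r m k \<Longrightarrow> l' < r m k \<Longrightarrow> (\<Sum>x<p m k. Q x l * Q x l') = (if l = l' then 1 else 0)"
    and QH: "\<And>x l. Q x l = (\<Sum>j<r m k. a m k x j * H j l)"
    and QR: "\<And>x j. j < r m k \<Longrightarrow> a m k x j = (\<Sum>l<r m k. Q x l * R l j)"
    and lead: "leading_eigenvectors (Sigma_hat M K X S T p m k \<omega>) (r m k) V"
  shows "range_dist (p m k) (r m k) Q V \<le> 4 * real (r m k) * A * 2 ^ K m / (c0 * real T)"
proof -
  define q where "q = p m k"
  define d where "d = r m k"
  let ?I = "{..<K m} - {k}"
  define Qc where "Qc = (\<Prod>h\<in>?I. p m h)"
  define dg where "dg = digits ?I (p m)"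
  \<comment> \<open>Columns of the wide matrix: thread, selected index of that thread, column of the
    unfolding.\<close>
  define J where "J = (SIGMA n:I. S n \<times> {..<Qc})"
  define \<Omega> where "\<Omega> x = (\<lambda>(n, i, e). (1 / real T) * (\<Sum>t<T. X m t ((dg e)(k := x)) \<omega> * X n t i \<omega>))" for x
  define L where "L x = (\<lambda>(n, i, e). signal T m n ((dg e)(k := x)) i)" for x
  define N where "N = (\<Sum>n\<in>I. real (card (S n)))"
  define v where "v = real (\<Prod>h<K m. p m h)"
  \<comment> \<open>Signal strength and deviation share the factor \<open>v * N\<close>, the number
    of entries of thread m times the total number of selected indices, which cancels in their ratio.
    The power of 2 collects the halves of \<open>loading_bound\<close>, one per mode.\<close>
  define \<kappa> where "\<kappa> = c0 * (v / 2 ^ K m) * N"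
  define \<zeta> where "\<zeta> = A * (v / real T) * N"
  have finI: "finite I" by (simp add: I_def)
  have finS: "finite (S n)" if "n \<in> I" for n
    using S[OF that] finite_subset[OF _ finite_idx] by blast
  have v: "0 < v" unfolding v_def using p(1) by (auto simp: Suc_le_eq intro!: prod_pos)
  have N: "0 < N"
  proof -
    have "I \<noteq> {}"
    proof -
      have "2 \<le> M" using model by (simp add: tensor_factor_model_def)
      then have "(if m = 0 then 1 else 0) \<in> I" by (auto simp: I_def)
      then show ?thesis by blast
    qed
    moreover have "0 < real (card (S n))" if "n \<in> I" for n
      using S[OF that] finS[OF that] by (simp add: card_gt_0_iff)
    ultimately show ?thesis
      unfolding N_def using finI by (intro sum_pos) auto
  qed
  have sumJ: "(\<Sum>s\<in>J. f s) = (\<Sum>n\<in>I. \<Sum>i\<in>S n. \<Sum>e<Qc. f (n, i, e))" for f :: "nat \<times> midx \<times> nat \<Rightarrow> real"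
  proof -
    have "(\<Sum>n\<in>I. \<Sum>i\<in>S n. \<Sum>e<Qc. f (n, i, e)) = (\<Sum>n\<in>I. \<Sum>z\<in>S n \<times> {..<Qc}. f (n, z))"
      by (simp add: sum.cartesian_product case_prod_unfold)
    also have "\<dots> = (\<Sum>s\<in>J. f s)"
      unfolding J_def using finI finS by (subst sum.Sigma) (auto simp: case_prod_unfold)
    finally show ?thesis by simp
  qed
  have sum_dg: "(\<Sum>e<Qc. f (dg e)) = (\<Sum>e\<in>PiE ?I (\<lambda>h. {..<p m h}). f e)" for f :: "midx \<Rightarrow> real"
    unfolding Qc_def dg_def by (rule sum_digits) simp
  have Sig: "Sigma_hat M K X S T p m k \<omega> = mat q q (\<lambda>(a, b). \<Sum>s\<in>J. \<Omega> a s * \<Omega> b s)"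
  proof (rule eq_matI, goal_cases)
    case (1 x y)
    then have xy: "x < q" "y < q" by auto
    have "Sigma_hat M K X S T p m k \<omega> $$ (x, y) = (\<Sum>n\<in>I. \<Sum>i\<in>S n.
        (Omega_hat K X T p m k n i \<omega> * transpose_mat (Omega_hat K X T p m k n i \<omega>)) $$ (x, y))"
      using xy by (simp add: Sigma_hat_def mat_sum_def I_def q_def)
    also have "\<dots> = (\<Sum>n\<in>I. \<Sum>i\<in>S n. \<Sum>e<Qc. \<Omega> x (n, i, e) * \<Omega> y (n, i, e))"
    proof (rule sum.cong[OF refl], rule sum.cong[OF refl])
      fix n i
      let ?O = "Omega_hat K X T p m k n i \<omega>"
      note O = Omega_hat_carrier[of T p m k n i \<omega>, folded q_def Qc_def]
      have "(?O * transpose_mat ?O) $$ (x, y) = (\<Sum>e<Qc. ?O $$ (x, e) * ?O $$ (y, e))"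
        using O xy by (simp add: scalar_prod_def atLeast0LessThan)
      also have "\<dots> = (\<Sum>e<Qc. \<Omega> x (n, i, e) * \<Omega> y (n, i, e))"
      proof (rule sum.cong[OF refl])
        fix e assume "e \<in> {..<Qc}"
        then show "?O $$ (x, e) * ?O $$ (y, e) = \<Omega> x (n, i, e) * \<Omega> y (n, i, e)"
          using xy by (simp add: Omega_hat_index q_def Qc_def \<Omega>_def dg_def)
      qed
      finally show "(?O * transpose_mat ?O) $$ (x, y) = (\<Sum>e<Qc. \<Omega> x (n, i, e) * \<Omega> y (n, i, e))" .
    qed
    finally show ?case using xy by (simp add: sumJ)
  qed (simp_all add: Sigma_hat_def mat_sum_def q_def)
  have Lrange: "L x s = (\<Sum>l<d. Q x l * (case s of (n, i, e) \<Rightarrow> \<Sum>j<d. R l j * signal_coord T m k n i (dg e) j))"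
    for x s
  proof -
    obtain n i e where s: "s = (n, i, e)" by (cases s)
    have "L x s = (\<Sum>j<d. a m k x j * signal_coord T m k n i (dg e) j)"
      by (simp add: L_def s signal_range[OF k] d_def)
    also have "\<dots> = (\<Sum>j<d. \<Sum>l<d. Q x l * (R l j * signal_coord T m k n i (dg e) j))"
      by (rule sum.cong[OF refl]) (simp add: QR d_def sum_distrib_right mult.assoc)
    also have "\<dots> = (\<Sum>l<d. Q x l * (\<Sum>j<d. R l j * signal_coord T m k n i (dg e) j))"
      by (subst sum.swap) (simp add: sum_distrib_left)
    finally show ?thesis by (simp add: s)
  qed
  \<comment> \<open>A combination of the columns of \<open>Q\<close> is one of the columns of the
    loadings, so \<open>signal_lower\<close> applies in every thread, with \<open>c0\<close> as
    common constant.\<close>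
  have lower: "\<kappa> * (\<Sum>x<q. (\<Sum>j<d. Q x j * z j)\<^sup>2) \<le> (\<Sum>s\<in>J. (\<Sum>x<q. (\<Sum>j<d. Q x j * z j) * L x s)\<^sup>2)" for z
  proof -
    define w where "w x = (\<Sum>j<d. Q x j * z j)" for x
    define W where "W = (\<Sum>x<q. (w x)\<^sup>2)"
    have W: "0 \<le> W" by (auto simp: W_def intro: sum_nonneg)
    have wa: "w x = (\<Sum>j<d. a m k x j * (\<Sum>l<d. H j l * z l))" for x
    proof -
      have "w x = (\<Sum>l<d. \<Sum>j<d. a m k x j * (H j l * z l))"
        by (simp add: w_def QH d_def sum_distrib_right mult.assoc)
      also have "\<dots> = (\<Sum>j<d. a m k x j * (\<Sum>l<d. H j l * z l))"
        by (subst sum.swap) (simp add: sum_distrib_left)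
      finally show ?thesis .
    qed
    have prod_half: "(\<Prod>h<K m. real (p m h) / 2) = v / 2 ^ K m"
      by (simp add: v_def prod_dividef)
    have "\<kappa> * W = (\<Sum>n\<in>I. c0 * (v / 2 ^ K m) * real (card (S n)) * W)"
      by (simp add: \<kappa>_def N_def sum_distrib_left sum_distrib_right)
    also have "\<dots> \<le> (\<Sum>n\<in>I. (\<Prod>h<K m. real (p m h) / 2) * ((s n)\<^sup>2 * real (card (S n))) * c n * W)"
    proof (rule sum_mono)
      fix n assume n: "n \<in> I"
      have "c0 * (v / 2 ^ K m * real (card (S n)) * W) \<le> ((s n)\<^sup>2 * c n) * (v / 2 ^ K m * real (card (S n)) * W)"
        using c0(2)[OF n] v W by (intro mult_right_mono) auto
      then show "c0 * (v / 2 ^ K m) * real (card (S n)) * W \<le>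
          (\<Prod>h<K m. real (p m h) / 2) * ((s n)\<^sup>2 * real (card (S n))) * c n * W"
        unfolding prod_half by (simp only: mult_ac)
    qed
    also have "\<dots> \<le> (\<Sum>n\<in>I. \<Sum>i\<in>S n. \<Sum>e\<in>PiE ?I (\<lambda>h. {..<p m h}). (\<Sum>x<q. w x * signal T m n (e(k := x)) i)\<^sup>2)"
    proof (rule sum_mono)
      fix n assume n: "n \<in> I"
      show "(\<Prod>h<K m. real (p m h) / 2) * ((s n)\<^sup>2 * real (card (S n))) * c n * W \<le>
          (\<Sum>i\<in>S n. \<Sum>e\<in>PiE ?I (\<lambda>h. {..<p m h}). (\<Sum>x<q. w x * signal T m n (e(k := x)) i)\<^sup>2)"
        unfolding W_def q_def
      proof (rule signal_lower[where z = "\<lambda>j. \<Sum>l<d. H j l * z l" and p = p and x = w, OF k finS[OF n] load core[OF n] sel[OF n]])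
        show "0 \<le> c n" using c[OF n] by simp
        show "0 \<le> (s n)\<^sup>2 * real (card (S n))" by simp
        show "w x = (\<Sum>j<r m k. a m k x j * (\<Sum>l<d. H j l * z l))" for x
          using wa[of x] by (simp add: d_def)
      qed
    qed
    also have "\<dots> = (\<Sum>s\<in>J. (\<Sum>x<q. w x * L x s)\<^sup>2)"
      unfolding sumJ L_def prod.case by (simp only: sum_dg[symmetric])
    finally show ?thesis by (simp add: W_def w_def)
  qed
  have noise: "(\<Sum>s\<in>J. \<Sum>x<q. (\<Omega> x s - L x s)\<^sup>2) \<le> \<zeta>"
  proof -
    have "(\<Sum>s\<in>J. \<Sum>x<q. (\<Omega> x s - L x s)\<^sup>2) =
        (\<Sum>n\<in>I. \<Sum>i\<in>S n. \<Sum>e<Qc. \<Sum>x<q. (deviation T m n ((dg e)(k := x)) i \<omega>)\<^sup>2)"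
      by (simp add: sumJ \<Omega>_def L_def deviation_def)
    also have "\<dots> = (\<Sum>n\<in>I. \<Sum>i\<in>S n. \<Sum>x\<in>idx (K m) (p m). (deviation T m n x i \<omega>)\<^sup>2)"
    proof (rule sum.cong[OF refl], rule sum.cong[OF refl])
      fix n i
      show "(\<Sum>e<Qc. \<Sum>x<q. (deviation T m n ((dg e)(k := x)) i \<omega>)\<^sup>2) =
          (\<Sum>x\<in>idx (K m) (p m). (deviation T m n x i \<omega>)\<^sup>2)"
        unfolding sum_idx_remove[OF k] q_def
        by (rule sum_dg[of "\<lambda>e. \<Sum>x<p m k. (deviation T m n (e(k := x)) i \<omega>)\<^sup>2"])
    qed
    also have "\<dots> \<le> (\<Sum>n\<in>I. A * (v / real T) * real (card (S n)))"
      unfolding v_def by (rule sum_mono) (rule dev[unfolded deviation_bound_def])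
    also have "\<dots> = \<zeta>"
      by (simp add: \<zeta>_def N_def sum_distrib_left)
    finally show ?thesis .
  qed
  have \<kappa>0: "0 < \<kappa>"
    unfolding \<kappa>_def using c0(1) v N by (intro mult_pos_pos) auto
  have \<zeta>\<kappa>: "\<zeta> \<le> \<kappa> / 4"
  proof -
    have "\<zeta> = (A / real T) * (v * N)" by (simp add: \<zeta>_def)
    also have "\<dots> \<le> (c0 / (4 * 2 ^ K m)) * (v * N)"
      using A v N by (intro mult_right_mono) auto
    also have "\<dots> = \<kappa> / 4" by (simp add: \<kappa>_def)
    finally show ?thesis .
  qed
  have "range_dist q d Q V \<le> 4 * real d * \<zeta> / \<kappa>"
  proof (rule range_dist_leading[OF Sig, where y = "\<lambda>l s. case s of (n, i, e) \<Rightarrow> \<Sum>j<d. R l j * signal_coord T m k n i (dg e) j"])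
    show "leading_eigenvectors (Sigma_hat M K X S T p m k \<omega>) d V" using lead by (simp add: d_def)
    show "0 < d" using r_pos[OF m k] by (simp add: d_def)
    show "d \<le> q" using p(2) by (simp add: d_def q_def)
    show "(\<Sum>a<q. Q a i * Q a j) = (if i = j then 1 else 0)" if "i < d" "j < d" for i j
      using Q that by (simp add: d_def q_def)
  qed (use Lrange lower noise \<zeta>\<kappa> \<kappa>0 in auto)
  also have "\<zeta> / \<kappa> = A * 2 ^ K m / (c0 * real T)"
    unfolding \<zeta>_def \<kappa>_def using v N c0(1) T by (simp add: field_simps)
  then have "4 * real d * \<zeta> / \<kappa> = 4 * real d * (A * 2 ^ K m / (c0 * real T))"
    by (metis times_divide_eq_right)
  finally show ?thesis
    by (simp add: q_def d_def mult.assoc)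
qed

end

theorem theorem4p2:
  fixes P :: "'w measure"
    and M :: nat and K :: "nat \<Rightarrow> nat" and r u :: dims and a b :: loadings
    and G F E X :: "'w process"
    and m k :: nat
    and S :: "nat \<Rightarrow> dims \<Rightarrow> nat \<Rightarrow> 'w \<Rightarrow> midx set"
    and Ah :: "nat \<Rightarrow> dims \<Rightarrow> 'w \<Rightarrow> real mat"
  assumes model: "tensor_factor_model P M K r u a b G F E X"
    and identification: "identification_condition P M K r u G F"
    and loading: "loading_condition M K r u a b"
    and core_factor: "core_factor_condition P M K r u G F"
    and noise: "noise_condition P M K E"
    and cross_thread: "cross_thread_condition P M K r u G F E X"
    and m: "m < M"
    and S: "\<And>T p n. n < M \<Longrightarrow> n \<noteq> m \<Longrightarrow> (\<forall>h<K n. 1 \<le> p n h) \<Longrightarrow>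
              independent_index_set P M K X T p n (S T p n)"
    and S_sing_val: "\<And>n j. n < M \<Longrightarrow> n \<noteq> m \<Longrightarrow> j < (\<Prod>h<K n. r n h) \<Longrightarrow>
      \<exists>c\<^sub>1>0. \<exists>c\<^sub>2. \<forall>\<^sub>F (T, p) in large M K. AE \<omega> in P.
        let R = rows_of (K n) (p n) (S T p n \<omega>);
            s = sing_val (submatrix
                  (kron_desc (\<lambda>h. loading_mat (p n h) (r n h) (a n h)) (K n)) R UNIV) j
        in c\<^sub>1 * sqrt (real (card R)) \<le> s \<and> s \<le> c\<^sub>2 * sqrt (real (card R))"
    and k: "k < K m"
    and Ah: "\<And>T p \<omega>. \<omega> \<in> space P \<Longrightarrow> r m k \<le> p m k \<Longrightarrow>
      loading_estimator (Sigma_hat M K X (\<lambda>n. S T p n \<omega>) T p m k \<omega>) (r m k) (Ah T p \<omega>)"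
  shows "\<exists>H :: nat \<Rightarrow> dims \<Rightarrow> 'w \<Rightarrow> real mat.
    (\<forall>\<^sub>F (T, p) in large M K. \<forall>\<omega>\<in>space P.
       H T p \<omega> \<in> carrier_mat (r m k) (r m k) \<and>
       (let AH = loading_mat (p m k) (r m k) (a m k) * H T p \<omega>
        in transpose_mat AH * AH = real (p m k) \<cdot>\<^sub>m 1\<^sub>m (r m k))) \<and>
    bigOP P (large M K)
      (\<lambda>(T, p) \<omega>. (1 / real (p m k)) *
         (frob_norm (Ah T p \<omega> - loading_mat (p m k) (r m k) (a m k) * H T p \<omega>))\<^sup>2)
      (\<lambda>(T, p). 1 / real T)"
proof -
  interpret factor_model P M K r u a b G F E X
    by (rule factor_model.intro[OF model identification loading core_factor noise cross_thread])
  define I where "I = {..<M} - {m}"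
  define d where "d = r m k"
  have finI: "finite I" by (simp add: I_def)
  have I: "n < M" "n \<noteq> m" if "n \<in> I" for n using that by (auto simp: I_def)

  \<comment> \<open>Deterministic bases of the loading range\<close>
  have "\<forall>h\<in>{..<K m}. \<exists>N. \<forall>q\<ge>N. loading_bound m h q"
    using loading_lower[OF m] by simp
  from bchoice[OF this] obtain Nh where Nh: "\<forall>h\<in>{..<K m}. \<forall>q\<ge>Nh h. loading_bound m h q" ..
  \<comment> \<open>The sum dominates the threshold of every mode; adding d + 1 makes the dimension
    of mode k positive and at least the number of eigenvectors.\<close>
  define Nl where "Nl = (\<Sum>h<K m. Nh h) + d + 1"
  have load: "loading_bound m h q" if "h < K m" "Nl \<le> q" for h q
  proof -
    have "Nh h \<le> (\<Sum>h<K m. Nh h)" using that(1) by (intro member_le_sum) auto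
    then have "Nh h \<le> q" using that(2) by (simp add: Nl_def)
    then show ?thesis using Nh that(1) by auto
  qed
  define factorizes where "factorizes q HR \<longleftrightarrow>
      (\<forall>l<d. \<forall>l'<d. (\<Sum>x<q. (\<Sum>j<d. a m k x j * fst HR j l) * (\<Sum>j<d. a m k x j * fst HR j l')) =
        (if l = l' then 1 else (0 :: real))) \<and>
      (\<forall>x. \<forall>j<d. a m k x j = (\<Sum>l<d. (\<Sum>j<d. a m k x j * fst HR j l) * snd HR l j))"
    for q and HR :: "(nat \<Rightarrow> nat \<Rightarrow> real) \<times> (nat \<Rightarrow> nat \<Rightarrow> real)"
  have "\<forall>q\<in>{Nl..}. \<exists>HR. factorizes q HR"
  proof
    fix q assume q: "q \<in> {Nl..}"
    then have "0 < real q / 2" by (auto simp: Nl_def)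
    moreover have "real q / 2 * (\<Sum>j<d. (z j)\<^sup>2) \<le> (\<Sum>x<q. (\<Sum>j<d. a m k x j * z j)\<^sup>2)" for z
      using load[OF k, of q] q by (simp add: loading_bound_def d_def)
    ultimately have "\<exists>H R. (\<forall>l<d. \<forall>l'<d. (\<Sum>x<q. (\<Sum>j<d. a m k x j * H j l) * (\<Sum>j<d. a m k x j * H j l')) =
        (if l = l' then 1 else (0 :: real))) \<and>
      (\<forall>x. \<forall>j<d. a m k x j = (\<Sum>l<d. (\<Sum>j<d. a m k x j * H j l) * R l j))"
      by (rule loading_factorization[where \<beta> = "real q / 2" and d = d and q = q and a = "a m k"])
    then show "\<exists>HR. factorizes q HR"
      by (simp only: factorizes_def split_paired_Ex fst_conv snd_conv)
  qed
  \<comment> \<open>The basis is chosen once per dimension \<open>q\<close>, so it depends neither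
    on the sample nor on \<open>T\<close>.\<close>
  from bchoice[OF this] obtain HR where HR: "\<forall>q\<in>{Nl..}. factorizes q (HR q)" ..
  define Q where "Q q x l = (\<Sum>j<d. a m k x j * fst (HR q) j l)" for q x l
  have factD: "factorizes q (HR q)" if "Nl \<le> q" for q
    using HR that by simp
  have Q: "(\<Sum>x<q. Q q x l * Q q x l') = (if l = l' then 1 else 0)" if "Nl \<le> q" "l < d" "l' < d" for q l l'
    unfolding Q_def
    by (rule factD[OF that(1), unfolded factorizes_def, THEN conjunct1, THEN spec, THEN mp, OF that(2), THEN spec, THEN mp, OF that(3)])
  have QR: "a m k x j = (\<Sum>l<d. Q q x l * snd (HR q) l j)" if "Nl \<le> q" "j < d" for q x j
    unfolding Q_def
    by (rule factD[OF that(1), unfolded factorizes_def, THEN conjunct2, THEN spec, THEN spec, THEN mp, OF that(2)])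

  \<comment> \<open>The sample-dependent rotation\<close>
  define Sig where "Sig T p \<omega> = Sigma_hat M K X (\<lambda>n. S T p n \<omega>) T p m k \<omega>" for T p \<omega>
  \<comment> \<open>The error bound is kept conditional on a range distance below one, so that a
    suitable matrix exists at every sample point once \<open>p m k\<close> is large.\<close>
  define good where "good T p \<omega> H \<longleftrightarrow> H \<in> carrier_mat d d \<and>
      transpose_mat (loading_mat (p m k) d (a m k) * H) * (loading_mat (p m k) d (a m k) * H) =
        real (p m k) \<cdot>\<^sub>m 1\<^sub>m d \<and>
      (\<exists>V. leading_eigenvectors (Sig T p \<omega>) d V \<and> (range_dist (p m k) d (Q (p m k)) V < 1 \<longrightarrow>
        (1 / real (p m k)) * (frob_norm (Ah T p \<omega> - loading_mat (p m k) d (a m k) * H))\<^sup>2 \<le>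
          2 * range_dist (p m k) d (Q (p m k)) V))" for T p \<omega> H
  \<comment> \<open>The choice is made separately at each sample point. \<open>bigOP\<close> asks
    only for a measurable event on which the bound holds, so the choice may be
    non-measurable.\<close>
  define H where "H T p \<omega> = (SOME H. good T p \<omega> H)" for T p \<omega>
  have good: "good T p \<omega> (H T p \<omega>)" if q: "Nl \<le> p m k" and \<omega>: "\<omega> \<in> space P" for T p \<omega>
    unfolding H_def
  proof (rule someI_ex[where P = "good T p \<omega>"])
    have dq: "d \<le> p m k" using q by (simp add: Nl_def)
    have dr: "dim_row (Sig T p \<omega>) = p m k" by (simp add: Sig_def Sigma_hat_def mat_sum_def)
    obtain V where V: "leading_eigenvectors (Sig T p \<omega>) d V" "Ah T p \<omega> = sqrt (real (p m k)) \<cdot>\<^sub>m V"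
      using Ah[of \<omega> p T] \<omega> dq dr unfolding loading_estimator_def Sig_def d_def by auto
    have V': "V \<in> carrier_mat (p m k) d" "transpose_mat V * V = 1\<^sub>m d"
      using V(1) dr by (auto simp: leading_eigenvectors_def)
    have Q_eq: "Q (p m k) = (\<lambda>x l. \<Sum>j<d. a m k x j * fst (HR (p m k)) j l)"
      by (simp add: Q_def fun_eq_iff)
    have "\<exists>H\<in>carrier_mat d d.
      transpose_mat (loading_mat (p m k) d (a m k) * H) * (loading_mat (p m k) d (a m k) * H) =
        real (p m k) \<cdot>\<^sub>m 1\<^sub>m d \<and>
      (range_dist (p m k) d (Q (p m k)) V < 1 \<longrightarrow>
        (1 / real (p m k)) * (frob_norm (sqrt (real (p m k)) \<cdot>\<^sub>m V - loading_mat (p m k) d (a m k) * H))\<^sup>2 \<le>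
          2 * range_dist (p m k) d (Q (p m k)) V)"
      unfolding Q_eq
    proof (rule rotation_exists[OF _ _ V'])
      show "(\<Sum>x<p m k. (\<Sum>j<d. a m k x j * fst (HR (p m k)) j l) * (\<Sum>j<d. a m k x j * fst (HR (p m k)) j l')) =
          (if l = l' then 1 else 0)" if "l < d" "l' < d" for l l'
        using Q[OF q that] by (simp add: Q_def)
      show "0 < p m k" using q by (simp add: Nl_def)
    qed
    then obtain H where H: "H \<in> carrier_mat d d"
      "transpose_mat (loading_mat (p m k) d (a m k) * H) * (loading_mat (p m k) d (a m k) * H) =
        real (p m k) \<cdot>\<^sub>m 1\<^sub>m d \<and>
      (range_dist (p m k) d (Q (p m k)) V < 1 \<longrightarrow>
        (1 / real (p m k)) * (frob_norm (sqrt (real (p m k)) \<cdot>\<^sub>m V - loading_mat (p m k) d (a m k) * H))\<^sup>2 \<le>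
          2 * range_dist (p m k) d (Q (p m k)) V)" ..
    have "good T p \<omega> H"
      unfolding good_def V(2) using H V(1) by blast
    then show "\<exists>H. good T p \<omega> H" ..
  qed
  have norm: "\<forall>\<^sub>F (T, p) in large M K. \<forall>\<omega>\<in>space P. H T p \<omega> \<in> carrier_mat (r m k) (r m k) \<and>
       (let AH = loading_mat (p m k) (r m k) (a m k) * H T p \<omega>
        in transpose_mat AH * AH = real (p m k) \<cdot>\<^sub>m 1\<^sub>m (r m k))"
    using eventually_large_ge[of Nl M K]
  proof eventually_elim
    case (elim x)
    obtain T p where x: "x = (T, p)" by (cases x)
    have "Nl \<le> p m k" using elim m k by (simp add: x)
    from good[of p _ T, OF this] show ?case
      by (simp add: x good_def d_def Let_def)
  qed

  \<comment> \<open>Constants uniform over the other threads\<close>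
  have "\<forall>n\<in>I. \<exists>c. 0 < c \<and> (\<forall>\<^sub>F (T, p) in large M K. core_bound c T m k n)"
    using core_lower[OF m _ k] I by blast
  from bchoice[OF this] obtain c where c: "\<forall>n\<in>I. 0 < c n \<and> (\<forall>\<^sub>F (T, p) in large M K. core_bound (c n) T m k n)" ..
  \<comment> \<open>Counting from 0, the last index is one below the product of the core dimensions
    and picks the smallest singular value.\<close>
  define sv where "sv T p n \<omega> = sing_val (submatrix (kron_desc (\<lambda>h. loading_mat (p n h) (r n h) (a n h)) (K n))
      (rows_of (K n) (p n) (S T p n \<omega>)) UNIV) ((\<Prod>h<K n. r n h) - 1)" for T p n \<omega>
  have "\<forall>n\<in>I. \<exists>s. 0 < s \<and> (\<forall>\<^sub>F (T, p) in large M K. AE \<omega> in P.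
      s * sqrt (real (card (rows_of (K n) (p n) (S T p n \<omega>)))) \<le> sv T p n \<omega>)"
  proof
    fix n assume n: "n \<in> I"
    have "0 < (\<Prod>h<K n. r n h)" using r_pos[OF I(1)[OF n]] by (auto simp: Suc_le_eq intro!: prod_pos)
    then have "(\<Prod>h<K n. r n h) - 1 < (\<Prod>h<K n. r n h)" by simp
    from S_sing_val[OF I[OF n] this] obtain c\<^sub>1 c\<^sub>2 where c1: "0 < c\<^sub>1"
      and ev: "\<forall>\<^sub>F (T, p) in large M K. AE \<omega> in P.
        c\<^sub>1 * sqrt (real (card (rows_of (K n) (p n) (S T p n \<omega>)))) \<le> sv T p n \<omega> \<and>
        sv T p n \<omega> \<le> c\<^sub>2 * sqrt (real (card (rows_of (K n) (p n) (S T p n \<omega>))))"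
      unfolding Let_def sv_def by blast
    from ev have "\<forall>\<^sub>F (T, p) in large M K. AE \<omega> in P.
        c\<^sub>1 * sqrt (real (card (rows_of (K n) (p n) (S T p n \<omega>)))) \<le> sv T p n \<omega>"
    proof eventually_elim
      case (elim x)
      then show ?case by (cases x) auto
    qed
    with c1 show "\<exists>s. 0 < s \<and> (\<forall>\<^sub>F (T, p) in large M K. AE \<omega> in P.
      s * sqrt (real (card (rows_of (K n) (p n) (S T p n \<omega>)))) \<le> sv T p n \<omega>)" by blast
  qed
  from bchoice[OF this] obtain s where s: "\<forall>n\<in>I. 0 < s n \<and> (\<forall>\<^sub>F (T, p) in large M K. AE \<omega> in P.
      s n * sqrt (real (card (rows_of (K n) (p n) (S T p n \<omega>)))) \<le> sv T p n \<omega>)" ..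
  have "\<forall>n\<in>I. \<exists>C. 0 \<le> C \<and> (\<forall>T\<ge>1. \<forall>p S A. independent_index_set P M K X T p n S \<longrightarrow> 0 < A \<longrightarrow>
    (\<exists>B\<in>events. prob B \<ge> 1 - C / A \<and> (\<forall>\<omega>\<in>B.
      deviation_bound A T p m n (S \<omega>) \<omega>)))"
    using selected_deviation[OF m I] by blast
  from bchoice[OF this] obtain C where C: "\<forall>n\<in>I. 0 \<le> C n \<and> (\<forall>T\<ge>1. \<forall>p S A.
    independent_index_set P M K X T p n S \<longrightarrow> 0 < A \<longrightarrow>
    (\<exists>B\<in>events. prob B \<ge> 1 - C n / A \<and> (\<forall>\<omega>\<in>B.
      deviation_bound A T p m n (S \<omega>) \<omega>)))" ..
  \<comment> \<open>Thread n contributes signal strength proportional to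
    \<open>(s n)\<^sup>2 * c n\<close>; among finitely many threads a common positive lower bound
    exists.\<close>
  have "\<exists>c0>0. \<forall>n\<in>I. c0 \<le> (s n)\<^sup>2 * c n"
  proof (rule finite_positive_lower_bound[OF finI])
    fix n assume "n \<in> I"
    then have "0 < c n" "0 < s n" using c s by blast+
    then show "0 < (s n)\<^sup>2 * c n" by simp
  qed
  then obtain c0 where c0: "0 < c0" "\<forall>n\<in>I. c0 \<le> (s n)\<^sup>2 * c n" by blast
  have core_ev: "\<forall>\<^sub>F x in large M K. \<forall>n\<in>I. core_bound (c n) (fst x) m k n"
    using c by (intro eventually_ball_finite finI) (simp add: case_prod_unfold)
  have sel_ev: "\<forall>\<^sub>F x in large M K. \<forall>n\<in>I. AE \<omega> in P.
      s n * sqrt (real (card (rows_of (K n) (snd x n) (S (fst x) (snd x) n \<omega>)))) \<le> sv (fst x) (snd x) n \<omega>"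
    using s by (intro eventually_ball_finite finI) (simp add: case_prod_unfold)

  \<comment> \<open>The rate in probability\<close>
  have "bigOP P (large M K)
      (\<lambda>(T, p) \<omega>. (1 / real (p m k)) *
         (frob_norm (Ah T p \<omega> - loading_mat (p m k) (r m k) (a m k) * H T p \<omega>))\<^sup>2)
      (\<lambda>(T, p). 1 / real T)"
    unfolding bigOP_def
  proof (intro allI impI)
    fix e :: real assume e: "0 < e"
    \<comment> \<open>The failure probabilities C n / A of the threads then add up to at most
      \<open>e\<close>; the added 1 keeps \<open>A\<close> positive.\<close>
    define A where "A = ((\<Sum>n\<in>I. C n) + 1) / e"
    have sumC: "0 \<le> (\<Sum>n\<in>I. C n)" using C by (intro sum_nonneg) auto
    have A: "0 < A" using e sumC by (simp add: A_def)
    have CA: "(\<Sum>n\<in>I. C n / A) \<le> e"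
    proof -
      have "(\<Sum>n\<in>I. C n / A) = (\<Sum>n\<in>I. C n) / A" by (simp add: sum_divide_distrib)
      also have "\<dots> \<le> e"
        using A sumC e by (simp add: pos_divide_le_eq) (simp add: A_def)
      finally show ?thesis .
    qed
    \<comment> \<open>The constant of \<open>estimator_range_dist\<close>, so that the range
      distance is at most D / T.\<close>
    define D where "D = 4 * real d * A * 2 ^ K m / c0"
    have d1: "1 \<le> real d" using r_pos[OF m k] by (simp add: d_def)
    have D: "0 < D" using d1 A c0 by (simp add: D_def)
    \<comment> \<open>T > D serves twice: the range distance falls below one, and the squared
      deviation falls below a quarter of the signal strength, as \<open>estimator_range_dist\<close>
      demands.\<close>
    define N where "N = Nl + nat \<lceil>D\<rceil> + 1"
    show "\<exists>C>0. \<forall>\<^sub>F x in large M K. \<exists>B\<in>sets P. 1 - e \<le> prob B \<and>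
        (\<forall>\<omega>\<in>B. \<bar>(case x of (T, p) \<Rightarrow> \<lambda>\<omega>. (1 / real (p m k)) *
         (frob_norm (Ah T p \<omega> - loading_mat (p m k) (r m k) (a m k) * H T p \<omega>))\<^sup>2) \<omega>\<bar> \<le>
         C * (case x of (T, p) \<Rightarrow> 1 / real T))"
    \<comment> \<open>The factor 2 is the price, from \<open>procrustes\<close>, of replacing the
      projection by an orthonormal system.\<close>
    proof (intro exI[of _ "2 * D"] conjI)
      show "0 < 2 * D" using D by simp
      show "\<forall>\<^sub>F x in large M K. \<exists>B\<in>sets P. 1 - e \<le> prob B \<and>
        (\<forall>\<omega>\<in>B. \<bar>(case x of (T, p) \<Rightarrow> \<lambda>\<omega>. (1 / real (p m k)) *
         (frob_norm (Ah T p \<omega> - loading_mat (p m k) (r m k) (a m k) * H T p \<omega>))\<^sup>2) \<omega>\<bar> \<le>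
         2 * D * (case x of (T, p) \<Rightarrow> 1 / real T))"
        using eventually_large_ge[of N M K] core_ev sel_ev
      proof eventually_elim
        case (elim x)
        obtain T p where x: "x = (T, p)" by (cases x)
        have TN: "N \<le> T" and pN: "\<And>m k. m < M \<Longrightarrow> k < K m \<Longrightarrow> N \<le> p m k"
          using elim(1) by (auto simp: x)
        have T1: "1 \<le> T" using TN by (simp add: N_def)
        have DT: "D < real T"
        proof -
          have "D \<le> real (nat \<lceil>D\<rceil>)" by (rule real_nat_ceiling_ge)
          also have "\<dots> < real T" using TN by (simp add: N_def)
          finally show ?thesis .
        qed
        have p1: "1 \<le> p n h" if "n < M" "h < K n" for n h
          using pN[OF that] by (simp add: N_def)
        have pl: "Nl \<le> p m h" if "h < K m" for h
          using pN[OF m that] by (simp add: N_def)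
        have ind: "independent_index_set P M K X T p n (S T p n)" if "n \<in> I" for n
          using I[OF that] p1 by (intro S) auto
        have Sn: "S T p n \<omega> \<subseteq> idx (K n) (p n) \<and> S T p n \<omega> \<noteq> {}" if "n \<in> I" "\<omega> \<in> space P" for n \<omega>
        proof -
          have meas: "S T p n \<in> measurable P (count_space (Pow (idx (K n) (p n))))"
            and ne: "\<forall>\<omega>\<in>space P. S T p n \<omega> \<noteq> {}"
            using ind[OF that(1)] unfolding independent_index_set_def Let_def by auto
          show ?thesis using measurable_space[OF meas that(2)] ne that(2) by auto
        qed
        have "\<exists>B\<in>events. 1 - (\<Sum>n\<in>I. C n / A) \<le> prob B \<and> (\<forall>\<omega>\<in>B. \<forall>n\<in>I.
          deviation_bound A T p m n (S T p n \<omega>) \<omega> \<and>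
          s n * sqrt (real (card (rows_of (K n) (p n) (S T p n \<omega>)))) \<le> sv T p n \<omega>)"
        proof (rule finite_Int_prob[OF finI])
          fix n assume n: "n \<in> I"
          have "\<exists>B\<in>events. prob B \<ge> 1 - C n / A \<and> (\<forall>\<omega>\<in>B.
              deviation_bound A T p m n (S T p n \<omega>) \<omega>)"
            by (rule C[THEN bspec, OF n, THEN conjunct2, THEN spec, THEN mp, OF T1, THEN spec, of p, THEN spec,
                  of "S T p n", THEN spec, of A, THEN mp, OF ind[OF n], THEN mp, OF A])
          then obtain B where B1: "B \<in> events" and B2: "prob B \<ge> 1 - C n / A \<and> (\<forall>\<omega>\<in>B.
              deviation_bound A T p m n (S T p n \<omega>) \<omega>)" ..
          note B = B1 B2[THEN conjunct1] and dev = B2[THEN conjunct2]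
          \<comment> \<open>The singular value bound holds only almost surely; its exceptional null
            set is removed from the event, which leaves the probability unchanged.\<close>
          have "AE \<omega> in P. s n * sqrt (real (card (rows_of (K n) (p n) (S T p n \<omega>)))) \<le> sv T p n \<omega>"
            using elim(3) n by (simp add: x)
          then obtain N where N: "{\<omega> \<in> space P. \<not> s n * sqrt (real (card (rows_of (K n) (p n) (S T p n \<omega>)))) \<le>
              sv T p n \<omega>} \<subseteq> N" "N \<in> null_sets P"
            by (auto elim!: AE_E simp: null_sets_def)
          have "prob (B - N) = prob B"
            by (rule measure_Diff_null_set[OF B(1) N(2)])
          moreover have "B - N \<in> events" using B(1) N(2) by auto
          moreover have "\<omega> \<in> space P" if "\<omega> \<in> B" for \<omega>
            using sets.sets_into_space[OF B(1)] that by blast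
          ultimately show "\<exists>B\<in>events. 1 - C n / A \<le> prob B \<and> (\<forall>\<omega>\<in>B.
            deviation_bound A T p m n (S T p n \<omega>) \<omega> \<and>
            s n * sqrt (real (card (rows_of (K n) (p n) (S T p n \<omega>)))) \<le> sv T p n \<omega>)"
            using B(2) dev N(1) by (intro bexI[of _ "B - N"]) auto
        qed
        then obtain B where B: "B \<in> events" "1 - (\<Sum>n\<in>I. C n / A) \<le> prob B"
          and dev: "\<And>\<omega> n. \<omega> \<in> B \<Longrightarrow> n \<in> I \<Longrightarrow> deviation_bound A T p m n (S T p n \<omega>) \<omega>"
          and sel: "\<And>\<omega> n. \<omega> \<in> B \<Longrightarrow> n \<in> I \<Longrightarrow>
            s n * sqrt (real (card (rows_of (K n) (p n) (S T p n \<omega>)))) \<le> sv T p n \<omega>"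
          by blast
        have "(1 / real (p m k)) * (frob_norm (Ah T p \<omega> - loading_mat (p m k) d (a m k) * H T p \<omega>))\<^sup>2 \<le> 2 * D * (1 / real T)"
          if \<omega>B: "\<omega> \<in> B" for \<omega>
        proof -
          have \<omega>: "\<omega> \<in> space P" using sets.sets_into_space[OF B(1)] \<omega>B by blast
          obtain V where V: "leading_eigenvectors (Sig T p \<omega>) d V"
            "range_dist (p m k) d (Q (p m k)) V < 1 \<longrightarrow>
              (1 / real (p m k)) * (frob_norm (Ah T p \<omega> - loading_mat (p m k) d (a m k) * H T p \<omega>))\<^sup>2 \<le>
              2 * range_dist (p m k) d (Q (p m k)) V"
            using good[of p \<omega> T, OF pl[OF k] \<omega>] unfolding good_def by blast
          have "range_dist (p m k) (r m k) (Q (p m k)) V \<le> 4 * real (r m k) * A * 2 ^ K m / (c0 * real T)"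
          proof (rule estimator_range_dist[OF m k T1, where S = "\<lambda>n. S T p n \<omega>" and \<omega> = \<omega> and c = c and s = s,
                folded I_def])
            show "1 \<le> p m h" if "h < K m" for h using p1[OF m that] .
            show "r m k \<le> p m k" using pl[OF k] by (simp add: Nl_def d_def)
            show "S T p n \<omega> \<subseteq> idx (K n) (p n) \<and> S T p n \<omega> \<noteq> {}" if "n \<in> I" for n
              by (rule Sn[OF that \<omega>])
            show "loading_bound m h (p m h)" if "h < K m" for h by (rule load[OF that pl[OF that]])
            show "core_bound (c n) T m k n" if "n \<in> I" for n
              using elim(2) that by (simp add: x)
            show "selection_bound ((s n)\<^sup>2 * real (card (S T p n \<omega>))) n (S T p n \<omega>)" if "n \<in> I" for n
              using s that Sn[OF that \<omega>] sel[OF \<omega>B that] unfolding sv_def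
              by (intro selection_lower[OF I(1)[OF that]]) auto
            show "deviation_bound A T p m n (S T p n \<omega>) \<omega>" if "n \<in> I" for n
              by (rule dev[OF \<omega>B that])
            show "0 < c n" if "n \<in> I" for n using c that by blast
            show "0 < c0" by (rule c0(1))
            show "c0 \<le> (s n)\<^sup>2 * c n" if "n \<in> I" for n using c0(2) that by blast
            \<comment> \<open>As d >= 1, the constant \<open>D\<close> also dominates 4 A 2^K /
              c0.\<close>
            show "A / real T \<le> c0 / (4 * 2 ^ K m)"
            proof -
              have "4 * 1 * A * 2 ^ K m / c0 \<le> D"
                unfolding D_def using d1 A c0 by (intro divide_right_mono mult_right_mono mult_left_mono) auto
              then have "4 * A * 2 ^ K m / c0 \<le> real T" using DT by simp
              then have "4 * A * 2 ^ K m \<le> real T * c0"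
                using c0(1) by (simp add: pos_divide_le_eq)
              then show ?thesis
                using T1 by (simp add: field_simps)
            qed
            show "(\<Sum>x<p m k. Q (p m k) x l * Q (p m k) x l') = (if l = l' then 1 else 0)"
              if "l < r m k" "l' < r m k" for l l'
              using Q[OF pl[OF k]] that by (simp add: d_def)
            show "Q (p m k) x l = (\<Sum>j<r m k. a m k x j * fst (HR (p m k)) j l)" for x l
              by (simp add: Q_def d_def)
            show "a m k x j = (\<Sum>l<r m k. Q (p m k) x l * snd (HR (p m k)) l j)" if "j < r m k" for x j
              using QR[OF pl[OF k], of j x] that by (simp add: d_def)
            show "leading_eigenvectors (Sigma_hat M K X (\<lambda>n. S T p n \<omega>) T p m k \<omega>) (r m k) V"
              using V(1) by (simp add: Sig_def d_def)
          qed
          also have "\<dots> = D / real T" by (simp add: D_def d_def)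
          finally have le: "range_dist (p m k) d (Q (p m k)) V \<le> D / real T" by (simp add: d_def)
          also have "\<dots> < 1" using DT D by simp
          finally show ?thesis using V(2) le by simp
        qed
        then show ?case
          using B CA by (intro bexI[of _ B]) (auto simp: x d_def)
      qed
    qed
  qed
  with norm show ?thesis by blast
qed

end
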